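(* Let $\Omega$ be a finite set and let $G\leq S_\Omega$ be a group of permutations of $\Omega$. There exists a unique $G$-symmetric quasi-value on $\Omega$ if and only if $G$ acts supertransitively on $\Omega$. Equivalently, this holds if and only if one of the following conditions is satisfied: (i) $G=S_\Omega$, the full symmetric group; (ii) $|\Omega|>3$ and $G=A_\Omega$, the alternating group; (iii) $|\Omega|=6$ and $G$ is the image of an exotic embedding $S_5\hookrightarrow S_6$ (where $S_6$ is identified with $S_\Omega$).
   Context: Let $\Omega$ be a finite set (of players). A cooperative game is a function $v:2^\Omega\to\mathbb{R}$ with $v(\emptyset)=0$; it is additive if $v(R\cup T)=v(R)+v(T)$ whenever $R\cap T=\emptyset$. Let $\Gamma$ be the real vector space of all cooperative games and $\Gamma_1$ the subspace of additive ones. A game value is a map $\varphi:\Gamma\to\Gamma_1$; put $\varphi_i(v):=\varphi(v)(\{i\})$ for $i\in\Omega$. A permutation $\pi$ of $\Omega$ acts on games by $(\pi\cdot v)(R)=v(\pi^{-1}(R))$. A quasi-value is a game value $\varphi$ satisfying: (1) Linearity: $\varphi(\alpha v+\beta w)=\alpha\varphi(v)+\beta\varphi(w)$ for all $v,w\in\Gamma$, $\alpha,\beta\in\mathbb{R}$; (2) Null-player property: if $v(R\cup\{i\})=v(R)$ for every $R\subseteq\Omega$, then $\varphi_i(v)=0$; (3) Efficiency: $\sum_{i\in\Omega}\varphi_i(v)=v(\Omega)$ for all $v\in\Gamma$. For a group $G$ of permutations of $\Omega$, a $G$-symmetric quasi-value is a quasi-value $\varphi$ such that $\varphi(\pi\cdot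 v)=\pi\cdot\varphi(v)$ for all $\pi\in G$ and all $v\in\Gamma$. For $A\subseteq\Omega$, the stabilizer $G_A$ is the subgroup of all $g\in G$ with $g\cdot A\subseteq A$. The action of $G$ on $\Omega$ is supertransitive if for every subset $A\subseteq\Omega$ the stabilizer $G_A$ acts transitively on $A$ (i.e. for all $i,j\in A$ there is $g\in G$ with $g(A)=A$ and $g(i)=j$). An exotic embedding $S_5\hookrightarrow S_6$ is an injective group homomorphism that is not the standard one, i.e. whose image is not the stabilizer of a single point. Its image is unique up to conjugation in $S_6$, and can be realized as the action of $PGL(2,5)$ on the six points of the projective line over $\mathbb{Z}_5$. *)

theory Defs
  imports Complex_Main "HOL-Library.FuncSet" "HOL-Algebra.Sym_Groups"
begin

text \<open>
  The player set \<open>\<Omega>\<close> is a finite carrier set rather than a type, so that it may be empty.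
  Games on \<open>\<Omega>\<close> are functions on \<open>Pow \<Omega>\<close> and game values are functions on the set of games;
  both are represented as extensional functions, so that equality of HOL functions is equality
  of the mathematical objects. This matters for the uniqueness of a quasi-value.
\<close>

definition games :: "'a set \<Rightarrow> ('a set \<Rightarrow> real) set" where
  "games \<Omega> = {v \<in> Pow \<Omega> \<rightarrow>\<^sub>E UNIV. v {} = 0}"

definition additive_games :: "'a set \<Rightarrow> ('a set \<Rightarrow> real) set" where
  "additive_games \<Omega> =
    {v \<in> games \<Omega>. \<forall>R T. R \<subseteq> \<Omega> \<longrightarrow> T \<subseteq> \<Omega> \<longrightarrow> R \<inter> T = {} \<longrightarrow> v (R \<union> T) = v R + v T}"

definition lin_comb ::
    "'a set \<Rightarrow> real \<Rightarrow> ('a set \<Rightarrow> real) \<Rightarrow> real \<Rightarrow> ('a set \<Rightarrow> real) \<Rightarrow> 'a set \<Rightarrow> real" where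
  "lin_comb \<Omega> \<alpha> v \<beta> w = (\<lambda>R\<in>Pow \<Omega>. \<alpha> * v R + \<beta> * w R)"

definition act :: "'a set \<Rightarrow> ('a \<Rightarrow> 'a) \<Rightarrow> ('a set \<Rightarrow> real) \<Rightarrow> 'a set \<Rightarrow> real" where
  "act \<Omega> \<pi> v = (\<lambda>R\<in>Pow \<Omega>. v (\<pi> -` R))"

definition game_values :: "'a set \<Rightarrow> (('a set \<Rightarrow> real) \<Rightarrow> 'a set \<Rightarrow> real) set" where
  "game_values \<Omega> = games \<Omega> \<rightarrow>\<^sub>E additive_games \<Omega>"

definition linear_value :: "'a set \<Rightarrow> (('a set \<Rightarrow> real) \<Rightarrow> 'a set \<Rightarrow> real) \<Rightarrow> bool" where
  "linear_value \<Omega> \<phi> \<longleftrightarrow>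
    (\<forall>v\<in>games \<Omega>. \<forall>w\<in>games \<Omega>. \<forall>\<alpha> \<beta>.
      \<phi> (lin_comb \<Omega> \<alpha> v \<beta> w) = lin_comb \<Omega> \<alpha> (\<phi> v) \<beta> (\<phi> w))"

definition null_player :: "'a set \<Rightarrow> (('a set \<Rightarrow> real) \<Rightarrow> 'a set \<Rightarrow> real) \<Rightarrow> bool" where
  "null_player \<Omega> \<phi> \<longleftrightarrow>
    (\<forall>v\<in>games \<Omega>. \<forall>i\<in>\<Omega>. (\<forall>R\<subseteq>\<Omega>. v (R \<union> {i}) = v R) \<longrightarrow> \<phi> v {i} = 0)"

definition efficient :: "'a set \<Rightarrow> (('a set \<Rightarrow> real) \<Rightarrow> 'a set \<Rightarrow> real) \<Rightarrow> bool" where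
  "efficient \<Omega> \<phi> \<longleftrightarrow> (\<forall>v\<in>games \<Omega>. (\<Sum>i\<in>\<Omega>. \<phi> v {i}) = v \<Omega>)"

definition quasi_value :: "'a set \<Rightarrow> (('a set \<Rightarrow> real) \<Rightarrow> 'a set \<Rightarrow> real) \<Rightarrow> bool" where
  "quasi_value \<Omega> \<phi> \<longleftrightarrow>
    \<phi> \<in> game_values \<Omega> \<and> linear_value \<Omega> \<phi> \<and> null_player \<Omega> \<phi> \<and> efficient \<Omega> \<phi>"

definition symmetric_quasi_value ::
    "'a set \<Rightarrow> ('a \<Rightarrow> 'a) set \<Rightarrow> (('a set \<Rightarrow> real) \<Rightarrow> 'a set \<Rightarrow> real) \<Rightarrow> bool" where
  "symmetric_quasi_value \<Omega> G \<phi> \<longleftrightarrow>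
    quasi_value \<Omega> \<phi> \<and> (\<forall>\<pi>\<in>G. \<forall>v\<in>games \<Omega>. \<phi> (act \<Omega> \<pi> v) = act \<Omega> \<pi> (\<phi> v))"

text \<open>
  The symmetric group on an arbitrary set, generalising \<^const>\<open>sym_group\<close>, which is only
  defined for \<open>{1..n}\<close>.
\<close>

definition sym_group_on :: "'a set \<Rightarrow> ('a \<Rightarrow> 'a) monoid" where
  "sym_group_on \<Omega> = \<lparr>carrier = {p. p permutes \<Omega>}, mult = (\<circ>), one = id\<rparr>"

lemma sym_group_on_atLeastAtMost: "sym_group_on {1..n} = sym_group n"
  by (simp add: sym_group_on_def sym_group_def)

lemma group_sym_group_on: "group (sym_group_on \<Omega>)"
proof (rule groupI)
  fix p assume "p \<in> carrier (sym_group_on \<Omega>)"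
  then have "p permutes \<Omega>"
    by (simp add: sym_group_on_def)
  then show "\<exists>q\<in>carrier (sym_group_on \<Omega>). q \<otimes>\<^bsub>sym_group_on \<Omega>\<^esub> p = \<one>\<^bsub>sym_group_on \<Omega>\<^esub>"
    by (auto simp: sym_group_on_def intro: permutes_inv permutes_inv_o)
qed (auto simp: sym_group_on_def comp_assoc intro: permutes_compose permutes_id)

definition alt_set :: "'a set \<Rightarrow> ('a \<Rightarrow> 'a) set" where
  "alt_set \<Omega> = {p. p permutes \<Omega> \<and> evenperm p}"

definition set_stabilizer :: "('a \<Rightarrow> 'a) set \<Rightarrow> 'a set \<Rightarrow> ('a \<Rightarrow> 'a) set" where
  "set_stabilizer G A = {g \<in> G. g ` A \<subseteq> A}"

definition supertransitive :: "'a set \<Rightarrow> ('a \<Rightarrow> 'a) set \<Rightarrow> bool" where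
  "supertransitive \<Omega> G \<longleftrightarrow>
    (\<forall>A\<subseteq>\<Omega>. \<forall>i\<in>A. \<forall>j\<in>A. \<exists>g\<in>set_stabilizer G A. g i = j)"

text \<open>
  For \<open>card \<Omega> = 6\<close>: embeddings of the symmetric group on five letters whose image is not the
  stabilizer of a point.
\<close>

definition exotic_embedding :: "'a set \<Rightarrow> ((nat \<Rightarrow> nat) \<Rightarrow> 'a \<Rightarrow> 'a) \<Rightarrow> bool" where
  "exotic_embedding \<Omega> f \<longleftrightarrow>
    f \<in> hom (sym_group 5) (sym_group_on \<Omega>) \<and>
    inj_on f (carrier (sym_group 5)) \<and>
    \<not> (\<exists>x\<in>\<Omega>. f ` carrier (sym_group 5) = {p \<in> carrier (sym_group_on \<Omega>). p x = x})"

end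

(*
  In the basis of unanimity games, a quasi-value is a choice, for every nonempty coalition A, of a
  distribution of one unit among the members of A; G-symmetry is equivariance of these choices.
  Hence the symmetric quasi-value is unique iff every stabilizer G_A is transitive on A.

  For the classification, supertransitivity makes G transitive on k-subsets for every k, so a single
  3-cycle forces G to contain the alternating group.  Let n = card \<Omega>.  For a prime p > n / 2, Cauchy's
  theorem in G_A gives a p-cycle on every p-subset A.  If n >= 8, a variant of Bertrand's postulate
  (proved as Erdos did) provides such a p <= n - 3; then G induces the full symmetric group on the
  complement of A, and by a Frattini argument two transpositions of the complement lift to
  normalizers of the p-cycle.  The p-th power of their commutator is a 3-cycle.  If n = 7, a 4-subset
  carries either a transposition in G or all three double transpositions, and these multiply to a
  3-cycle.  If n = 6 and there is no 3-cycle, an element with three fixed points is trivial; counting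
  gives order 120, and the action on the five nontrivial cosets of G in the symmetric group
  identifies G with S_5.  Conversely, a group of order 120 on six points that is not a point
  stabilizer is sharply 3-transitive.
*)
theory Submission
  imports Defs "HOL-Algebra.Sylow" "HOL-Algebra.Multiplicative_Group" "HOL-Library.Discrete_Functions"
begin

section \<open>Symmetric quasi-values and supertransitivity\<close>

text \<open>Existence is never at stake: the Shapley value, which splits every dividend equally, is
  symmetric under any group, so the first half is about uniqueness alone. In the classification the
  two bounds on the prime do different jobs. Since \<open>p > n / 2\<close>, fewer than
  \<open>p\<close> points lie outside a \<open>p\<close>-subset, so an element of order
  \<open>p\<close> that preserves the subset fixes all of them and is a single cycle; since
  \<open>p <= n - 3\<close>, the complement has room for a 3-cycle. For n from 3 to 5 the prime 3
  itself exceeds n / 2 and the cycle obtained is already a 3-cycle. For n = 6 and n = 7 no prime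
  satisfies both bounds, and degree six has a genuine exception, so these two degrees are settled by
  counting. The commutator enters because automorphisms of a cyclic group commute: whatever two
  lifted transpositions do to the p-cycle, their commutator centralizes it, and \<open>p > 3\<close>
  ensures that the p-th power of a 3-cycle is still a 3-cycle.\<close>

text \<open>Harsanyi dividends: the coefficients of a game in the basis of unanimity games.\<close>

definition dividend :: "('a set \<Rightarrow> real) \<Rightarrow> 'a set \<Rightarrow> real" where
  "dividend v A = (-1) ^ card A * (\<Sum>T\<in>Pow A. (-1) ^ card T * v T)"

definition unanimity :: "'a set \<Rightarrow> 'a set \<Rightarrow> 'a set \<Rightarrow> real" where
  "unanimity \<Omega> A = (\<lambda>R\<in>Pow \<Omega>. if A \<subseteq> R then 1 else 0)"

text \<open>Each dividend is shared equally among the selected players \<open>S A\<close>. The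
  choice \<open>S A = A\<close> is the Shapley value; any other equivariant choice of nonempty
  \<open>S A\<close> inside \<open>A\<close> is a rival, which is how uniqueness gets
  refuted.\<close>

definition selector_value ::
    "'a set \<Rightarrow> ('a set \<Rightarrow> 'a set) \<Rightarrow> ('a set \<Rightarrow> real) \<Rightarrow> 'a set \<Rightarrow> real" where
  "selector_value \<Omega> S = (\<lambda>v\<in>games \<Omega>. \<lambda>R\<in>Pow \<Omega>.
     \<Sum>i\<in>R. \<Sum>A\<in>Pow \<Omega>. if i \<in> S A then dividend v A / card (S A) else 0)"

lemma sum_dividend:
  assumes "finite R"
  shows "(\<Sum>A\<in>Pow R. dividend v A) = v R"
proof -
  have "v R = (\<Sum>T\<in>Pow R. (-1) ^ card T * (\<Sum>U\<in>Pow T. (-1) ^ card U * v U))"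
    by (rule inclusion_exclusion_symmetric[OF refl assms])
  then show ?thesis
    by (simp add: dividend_def)
qed

text \<open>Moebius inversion: the sums over \<open>Pow B\<close> determine \<open>e\<close> by
  recursion on the coalition. The dividends of games with a null player, of unanimity games and of
  permuted games are found by guessing \<open>e\<close> and checking these sums, without handling
  alternating signs.\<close>

lemma dividend_unique:
  assumes "finite A" "\<And>B. B \<subseteq> A \<Longrightarrow> (\<Sum>C\<in>Pow B. e C) = v B"
  shows "dividend v A = e A"
  using assms
proof (induction A rule: finite_psubset_induct)
  case (psubset A)
  have "finite A"
    by (rule psubset)
  then have "dividend v A + (\<Sum>C\<in>Pow A - {A}. dividend v C) = v A"
    using sum_dividend[of A v] by (simp add: sum.remove[of _ A])
  moreover have "e A + (\<Sum>C\<in>Pow A - {A}. e C) = v A"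
    using psubset.prems[of A] \<open>finite A\<close> by (simp add: sum.remove[of _ A])
  moreover have "(\<Sum>C\<in>Pow A - {A}. dividend v C) = (\<Sum>C\<in>Pow A - {A}. e C)"
    by (intro sum.cong refl psubset.IH) (use psubset.prems in auto)
  ultimately show ?case
    by simp
qed

text \<open>Erasing the dividends of all coalitions that contain \<open>i\<close> changes the sum
  over \<open>Pow B\<close> into \<open>v (B - {i})\<close>, which for a null player is again
  \<open>v B\<close>; so those dividends were zero.\<close>

lemma dividend_null_player:
  assumes "finite A" "i \<in> A" "\<And>R. R \<subseteq> A \<Longrightarrow> v (R \<union> {i}) = v R"
  shows "dividend v A = 0"
proof -
  have "dividend v A = (if i \<in> A then 0 else dividend v A)"
  proof (rule dividend_unique[OF assms(1), where e = "\<lambda>C. if i \<in> C then 0 else dividend v C"])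
    fix B assume B: "B \<subseteq> A"
    then have "finite B"
      using assms(1) by (auto intro: finite_subset)
    then have "(\<Sum>C\<in>Pow B. if i \<in> C then 0 else dividend v C)
        = (\<Sum>C\<in>Pow (B - {i}). dividend v C)"
      by (intro sum.mono_neutral_cong_right) auto
    also have "\<dots> = v (B - {i})"
      using \<open>finite B\<close> by (simp add: sum_dividend)
    also have "\<dots> = v B"
    proof (cases "i \<in> B")
      case True
      then have "B - {i} \<union> {i} = B"
        by auto
      then show ?thesis
        using assms(3)[of "B - {i}"] B by (metis Diff_subset subset_trans)
    qed simp
    finally show "(\<Sum>C\<in>Pow B. if i \<in> C then 0 else dividend v C) = v B" .
  qed
  then show ?thesis
    using assms(2) by simp
qed

lemma dividend_unanimity:
  assumes "finite \<Omega>" "A \<subseteq> \<Omega>" "B \<subseteq> \<Omega>"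
  shows "dividend (unanimity \<Omega> A) B = (if B = A then 1 else 0)"
proof (rule dividend_unique[where e = "\<lambda>B. if B = A then 1 else 0"])
  show "finite B"
    using assms by (auto intro: finite_subset)
  fix C assume "C \<subseteq> B"
  then have "C \<subseteq> \<Omega>"
    using assms by auto
  moreover from this have "finite C"
    using assms by (auto intro: finite_subset)
  ultimately show "(\<Sum>D\<in>Pow C. if D = A then 1 else 0) = unanimity \<Omega> A C"
    by (auto simp: unanimity_def)
qed

lemma unanimity_in_games: "A \<noteq> {} \<Longrightarrow> unanimity \<Omega> A \<in> games \<Omega>"
  by (auto simp: unanimity_def games_def)

lemma lin_comb_in_games: "v \<in> games \<Omega> \<Longrightarrow> w \<in> games \<Omega> \<Longrightarrow> lin_comb \<Omega> \<alpha> v \<beta> w \<in> games \<Omega>"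
  by (auto simp: lin_comb_def games_def)

lemma dividend_cong: "(\<And>B. B \<subseteq> A \<Longrightarrow> v B = w B) \<Longrightarrow> dividend v A = dividend w A"
  by (simp add: dividend_def)

lemma dividend_lin_comb:
  "A \<subseteq> \<Omega> \<Longrightarrow> dividend (lin_comb \<Omega> \<alpha> v \<beta> w) A = \<alpha> * dividend v A + \<beta> * dividend w A"
proof -
  assume "A \<subseteq> \<Omega>"
  then have "dividend (lin_comb \<Omega> \<alpha> v \<beta> w) A = dividend (\<lambda>R. \<alpha> * v R + \<beta> * w R) A"
    by (intro dividend_cong) (auto simp: lin_comb_def)
  then show ?thesis
    by (simp add: dividend_def algebra_simps sum.distrib sum_distrib_left)
qed

lemma permutes_vimage_subset:
  assumes "\<pi> permutes \<Omega>" "A \<subseteq> \<Omega>"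
  shows "\<pi> -` A \<subseteq> \<Omega>"
  using assms by (metis permutes_vimage vimage_mono)

lemma permutes_image_vimage: "\<pi> permutes \<Omega> \<Longrightarrow> \<pi> ` (\<pi> -` A) = A"
  using permutes_surj surj_image_vimage_eq by metis

lemma permutes_vimage_image: "\<pi> permutes \<Omega> \<Longrightarrow> \<pi> -` (\<pi> ` A) = A"
  using permutes_inj inj_vimage_image_eq by metis

lemma dividend_act:
  assumes "finite \<Omega>" "\<pi> permutes \<Omega>" "A \<subseteq> \<Omega>"
  shows "dividend (act \<Omega> \<pi> v) A = dividend v (\<pi> -` A)"
proof (rule dividend_unique[where e = "\<lambda>A. dividend v (\<pi> -` A)"])
  show "finite A"
    using assms by (auto intro: finite_subset)
  fix B assume "B \<subseteq> A"
  then have B: "B \<subseteq> \<Omega>"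
    using assms by auto
  have "(\<Sum>C\<in>Pow B. dividend v (\<pi> -` C)) = (\<Sum>C\<in>Pow (\<pi> -` B). dividend v C)"
  proof (rule sum.reindex_bij_witness[where i = "image \<pi>" and j = "vimage \<pi>"])
    show "\<pi> ` C \<in> Pow B" if "C \<in> Pow (\<pi> -` B)" for C
      using that by auto
    show "\<pi> -` C \<in> Pow (\<pi> -` B)" if "C \<in> Pow B" for C
      using that by auto
    show "\<pi> -` (\<pi> ` C) = C" "\<pi> ` (\<pi> -` C) = C" for C
      using permutes_vimage_image permutes_image_vimage assms(2) by metis+
  qed (rule refl)
  also have "\<dots> = v (\<pi> -` B)"
    by (intro sum_dividend finite_subset[OF permutes_vimage_subset[OF assms(2) B] assms(1)])
  finally show "(\<Sum>C\<in>Pow B. dividend v (\<pi> -` C)) = act \<Omega> \<pi> v B"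
    using B by (simp add: act_def)
qed

lemma act_in_games: "\<pi> permutes \<Omega> \<Longrightarrow> v \<in> games \<Omega> \<Longrightarrow> act \<Omega> \<pi> v \<in> games \<Omega>"
  by (auto simp: act_def games_def)

lemma act_unanimity:
  assumes "\<pi> permutes \<Omega>"
  shows "act \<Omega> \<pi> (unanimity \<Omega> A) = unanimity \<Omega> (\<pi> ` A)"
proof
  fix R
  have "A \<subseteq> \<pi> -` R \<longleftrightarrow> \<pi> ` A \<subseteq> R"
    by auto
  then show "act \<Omega> \<pi> (unanimity \<Omega> A) R = unanimity \<Omega> (\<pi> ` A) R"
    using permutes_vimage_subset[OF assms, of R] by (auto simp: act_def unanimity_def)
qed

lemma selector_value_singleton:
  "v \<in> games \<Omega> \<Longrightarrow> i \<in> \<Omega> \<Longrightarrow> selector_value \<Omega> S v {i}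
    = (\<Sum>A\<in>Pow \<Omega>. if i \<in> S A then dividend v A / card (S A) else 0)"
  by (simp add: selector_value_def)

lemma selector_value_in_additive_games:
  assumes "finite \<Omega>" "v \<in> games \<Omega>"
  shows "selector_value \<Omega> S v \<in> additive_games \<Omega>"
  using assms unfolding additive_games_def games_def
  by (auto simp: selector_value_def games_def sum.union_disjoint finite_subset)

text \<open>Containment of \<open>S A\<close> in \<open>A\<close> yields the null-player property,
  because coalitions containing a null player have dividend zero; nonemptiness yields efficiency,
  because no dividend is lost.\<close>

lemma quasi_value_selector_value:
  assumes fin: "finite \<Omega>"
    and S: "\<And>A. A \<subseteq> \<Omega> \<Longrightarrow> S A \<subseteq> A" "\<And>A. A \<subseteq> \<Omega> \<Longrightarrow> A \<noteq> {} \<Longrightarrow> S A \<noteq> {}"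
  shows "quasi_value \<Omega> (selector_value \<Omega> S)"
  unfolding quasi_value_def
proof (intro conjI)
  show "selector_value \<Omega> S \<in> game_values \<Omega>"
    using selector_value_in_additive_games[OF fin]
    by (auto simp: game_values_def selector_value_def)
  show "linear_value \<Omega> (selector_value \<Omega> S)"
    unfolding linear_value_def
  proof (intro ballI allI ext)
    fix v w \<alpha> \<beta> R assume "v \<in> games \<Omega>" "w \<in> games \<Omega>"
    then show "selector_value \<Omega> S (lin_comb \<Omega> \<alpha> v \<beta> w) R
        = lin_comb \<Omega> \<alpha> (selector_value \<Omega> S v) \<beta> (selector_value \<Omega> S w) R"
      by (auto simp: selector_value_def lin_comb_in_games lin_comb_def[of _ _ "restrict _ _"]
          dividend_lin_comb sum_distrib_left sum.distrib[symmetric] add_divide_distrib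
          intro!: sum.cong)
  qed
  show "null_player \<Omega> (selector_value \<Omega> S)"
    unfolding null_player_def
  proof (intro ballI impI)
    fix v i assume *: "v \<in> games \<Omega>" "i \<in> \<Omega>" "\<forall>R\<subseteq>\<Omega>. v (R \<union> {i}) = v R"
    have "dividend v A = 0" if "A \<subseteq> \<Omega>" "i \<in> S A" for A
    proof (rule dividend_null_player)
      show "finite A"
        using that fin by (auto intro: finite_subset)
      show "i \<in> A"
        using that S(1) by blast
      show "v (R \<union> {i}) = v R" if "R \<subseteq> A" for R
        using that \<open>A \<subseteq> \<Omega>\<close> * by blast
    qed
    then show "selector_value \<Omega> S v {i} = 0"
      using * by (auto simp: selector_value_singleton intro!: sum.neutral)
  qed
  show "efficient \<Omega> (selector_value \<Omega> S)"
    unfolding efficient_def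
  proof
    fix v assume v: "v \<in> games \<Omega>"
    have "(\<Sum>i\<in>\<Omega>. selector_value \<Omega> S v {i})
        = (\<Sum>A\<in>Pow \<Omega>. \<Sum>i\<in>\<Omega>. if i \<in> S A then dividend v A / card (S A) else 0)"
      using v by (subst sum.swap) (simp add: selector_value_singleton)
    also have "\<dots> = (\<Sum>A\<in>Pow \<Omega>. dividend v A)"
    proof (rule sum.cong[OF refl])
      fix A assume "A \<in> Pow \<Omega>"
      then have "S A \<subseteq> \<Omega>" "finite (S A)"
        using S(1) fin by (blast intro: finite_subset)+
      then have "(\<Sum>i\<in>\<Omega>. if i \<in> S A then dividend v A / card (S A) else 0)
          = (\<Sum>i\<in>S A. dividend v A / card (S A))"
        using fin by (intro sum.mono_neutral_cong_right) auto
      also have "\<dots> = dividend v A"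
      \<comment> \<open>\<open>S {}\<close> is empty, so the equal share would divide by zero there;
        nothing is lost, as the dividend of the empty coalition is \<open>v {} = 0\<close>.\<close>
      proof (cases "A = {}")
        case True
        then show ?thesis
          using v by (simp add: dividend_def games_def)
      next
        case False
        then have "card (S A) \<noteq> 0"
          using S(2) \<open>A \<in> Pow \<Omega>\<close> \<open>finite (S A)\<close> by auto
        then show ?thesis
          by simp
      qed
      finally show "(\<Sum>i\<in>\<Omega>. if i \<in> S A then dividend v A / card (S A) else 0) = dividend v A" .
    qed
    also have "\<dots> = v \<Omega>"
      by (rule sum_dividend[OF fin])
    finally show "(\<Sum>i\<in>\<Omega>. selector_value \<Omega> S v {i}) = v \<Omega>" .
  qed
qed

lemma selector_value_act:
  assumes fin: "finite \<Omega>" and \<pi>: "\<pi> permutes \<Omega>"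
    and S: "\<And>A. A \<subseteq> \<Omega> \<Longrightarrow> S (\<pi> ` A) = \<pi> ` S A" and v: "v \<in> games \<Omega>"
  shows "selector_value \<Omega> S (act \<Omega> \<pi> v) = act \<Omega> \<pi> (selector_value \<Omega> S v)"
proof
  fix R
  show "selector_value \<Omega> S (act \<Omega> \<pi> v) R = act \<Omega> \<pi> (selector_value \<Omega> S v) R"
  proof (cases "R \<subseteq> \<Omega>")
    case True
    have "(\<Sum>i\<in>R. \<Sum>A\<in>Pow \<Omega>.
          if i \<in> S A then dividend (act \<Omega> \<pi> v) A / card (S A) else 0)
        = (\<Sum>i\<in>\<pi> -` R. \<Sum>A\<in>Pow \<Omega>.
          if \<pi> i \<in> S A then dividend (act \<Omega> \<pi> v) A / card (S A) else 0)"
      using \<pi> by (intro sum.reindex_bij_witness[where i = \<pi> and j = "inv' \<pi>"])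
        (auto simp: permutes_inverses)
    also have "\<dots> = (\<Sum>i\<in>\<pi> -` R. \<Sum>A\<in>Pow \<Omega>.
          if i \<in> S A then dividend v A / card (S A) else 0)"
    proof (rule sum.cong[OF refl])
      fix i
      have "(\<Sum>A\<in>Pow \<Omega>. if \<pi> i \<in> S A then dividend (act \<Omega> \<pi> v) A / card (S A) else 0)
          = (\<Sum>A\<in>Pow \<Omega>. if \<pi> i \<in> S (\<pi> ` A) then
              dividend (act \<Omega> \<pi> v) (\<pi> ` A) / card (S (\<pi> ` A)) else 0)"
      proof (rule sum.reindex_bij_witness[where i = "image \<pi>" and j = "vimage \<pi>"])
        fix A assume "A \<in> Pow \<Omega>"
        then show "\<pi> -` A \<in> Pow \<Omega>" "\<pi> ` A \<in> Pow \<Omega>"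
          using permutes_vimage_subset[OF \<pi>] permutes_image[OF \<pi>] by blast+
      qed (use \<pi> permutes_image_vimage permutes_vimage_image in \<open>metis+\<close>)
      also have "\<dots> = (\<Sum>A\<in>Pow \<Omega>. if i \<in> S A then dividend v A / card (S A) else 0)"
      proof (rule sum.cong[OF refl])
        fix A assume A: "A \<in> Pow \<Omega>"
        then have "\<pi> ` A \<subseteq> \<Omega>"
          using permutes_image[OF \<pi>] by blast
        then show "(if \<pi> i \<in> S (\<pi> ` A) then
              dividend (act \<Omega> \<pi> v) (\<pi> ` A) / card (S (\<pi> ` A)) else 0)
            = (if i \<in> S A then dividend v A / card (S A) else 0)"
          using A \<pi> by (simp add: S dividend_act[OF fin \<pi>] permutes_vimage_image
              inj_image_mem_iff[OF permutes_inj] card_image inj_on_subset[OF permutes_inj])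
      qed
      finally show "(\<Sum>A\<in>Pow \<Omega>. if \<pi> i \<in> S A then dividend (act \<Omega> \<pi> v) A / card (S A) else 0)
          = (\<Sum>A\<in>Pow \<Omega>. if i \<in> S A then dividend v A / card (S A) else 0)" .
    qed
    finally show ?thesis
      using True v permutes_vimage_subset[OF \<pi> True]
      by (simp add: selector_value_def act_in_games[OF \<pi>] act_def[of _ _ "restrict _ _"])
  qed (use v in \<open>simp add: selector_value_def act_in_games[OF \<pi>] act_def[of _ _ "restrict _ _"]\<close>)
qed

lemma additive_game_eqI:
  assumes "finite \<Omega>" "f \<in> additive_games \<Omega>" "g \<in> additive_games \<Omega>"
    and "\<And>i. i \<in> \<Omega> \<Longrightarrow> f {i} = g {i}"
  shows "f = g"
proof (rule extensionalityI)
  show "f \<in> extensional (Pow \<Omega>)" "g \<in> extensional (Pow \<Omega>)"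
    using assms(2,3) by (auto simp: additive_games_def games_def PiE_iff)
  fix R assume "R \<in> Pow \<Omega>"
  then have "finite R" "R \<subseteq> \<Omega>"
    using assms(1) by (auto intro: finite_subset)
  then show "f R = g R"
  proof (induction R rule: finite_induct)
    case empty
    then show ?case
      using assms(2,3) by (simp add: additive_games_def games_def)
  next
    case (insert x F)
    have split: "h (insert x F) = h {x} + h F" if "h \<in> additive_games \<Omega>" for h
    proof -
      have "h ({x} \<union> F) = h {x} + h F"
        using that insert.prems insert.hyps by (auto simp: additive_games_def simp del: Un_insert_left)
      then show ?thesis
        by simp
    qed
    show ?case
      using split[of f] split[of g] assms(2-4) insert.IH insert.prems by simp
  qed
qed

lemma quasi_value_unanimity_outside:
  assumes "quasi_value \<Omega> \<phi>" "A \<noteq> {}" "i \<in> \<Omega>" "i \<notin> A"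
  shows "\<phi> (unanimity \<Omega> A) {i} = 0"
proof -
  have "\<forall>R\<subseteq>\<Omega>. unanimity \<Omega> A (R \<union> {i}) = unanimity \<Omega> A R"
    using assms(3,4) by (auto simp: unanimity_def)
  moreover have "null_player \<Omega> \<phi>"
    using assms(1) by (simp add: quasi_value_def)
  ultimately show ?thesis
    using assms(2,3) by (simp add: null_player_def unanimity_in_games)
qed

text \<open>Players outside \<open>A\<close> are null in the unanimity game, so efficiency leaves
  its whole worth to the members of \<open>A\<close>.\<close>

lemma sum_quasi_value_unanimity:
  assumes "finite \<Omega>" "quasi_value \<Omega> \<phi>" "A \<noteq> {}" "A \<subseteq> \<Omega>"
  shows "(\<Sum>i\<in>A. \<phi> (unanimity \<Omega> A) {i}) = 1"
proof -
  have "(\<Sum>i\<in>A. \<phi> (unanimity \<Omega> A) {i}) = (\<Sum>i\<in>\<Omega>. \<phi> (unanimity \<Omega> A) {i})"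
    by (rule sum.mono_neutral_left) (use assms quasi_value_unanimity_outside[OF assms(2,3)] in auto)
  also have "\<dots> = unanimity \<Omega> A \<Omega>"
    using assms(2,3) by (simp add: quasi_value_def efficient_def unanimity_in_games)
  finally show ?thesis
    using assms by (simp add: unanimity_def)
qed

text \<open>Unanimity games span all games, with the dividends as coordinates. Linearity speaks of
  two summands, so the expansion is built up one coalition at a time.\<close>

lemma linear_values_eqI:
  assumes fin: "finite \<Omega>" and lin: "linear_value \<Omega> \<phi>" "linear_value \<Omega> \<psi>"
    and eq: "\<And>A. A \<noteq> {} \<Longrightarrow> A \<subseteq> \<Omega> \<Longrightarrow> \<phi> (unanimity \<Omega> A) = \<psi> (unanimity \<Omega> A)"
    and v: "v \<in> games \<Omega>"
  shows "\<phi> v = \<psi> v"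
proof -
  define comb where
    "comb F = (\<lambda>R\<in>Pow \<Omega>. \<Sum>A\<in>F. dividend v A * unanimity \<Omega> A R)" for F
  have comb: "comb F \<in> games \<Omega> \<and> \<phi> (comb F) = \<psi> (comb F)"
    if "finite F" "F \<subseteq> Pow \<Omega> - {{}}" for F
    using that
  proof (induction F rule: finite_induct)
    case empty
    \<comment> \<open>Linearity has no separate clause for the zero game; it is reached as a
      combination of \<open>v\<close> with itself in which both coefficients are zero.\<close>
    have "lin_comb \<Omega> 0 (\<phi> v) 0 (\<phi> v) = lin_comb \<Omega> 0 (\<psi> v) 0 (\<psi> v)"
      by (simp add: lin_comb_def)
    then have "\<phi> (lin_comb \<Omega> 0 v 0 v) = \<psi> (lin_comb \<Omega> 0 v 0 v)"
      using lin v by (simp add: linear_value_def)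
    moreover have "comb {} = lin_comb \<Omega> 0 v 0 v"
      by (simp add: comb_def lin_comb_def)
    ultimately show ?case
      using lin_comb_in_games[OF v v] by simp
  next
    case (insert A F)
    have "comb (insert A F) = lin_comb \<Omega> (dividend v A) (unanimity \<Omega> A) 1 (comb F)"
      using insert.hyps by (auto simp: comb_def lin_comb_def)
    moreover have "A \<noteq> {}" "A \<subseteq> \<Omega>" "F \<subseteq> Pow \<Omega> - {{}}"
      using insert.prems by auto
    ultimately show ?case
      using insert.IH lin eq[of A] unanimity_in_games[of A \<Omega>]
      by (simp add: linear_value_def lin_comb_in_games)
  qed
  have "v = comb (Pow \<Omega> - {{}})"
  proof
    fix R
    show "v R = comb (Pow \<Omega> - {{}}) R"
    proof (cases "R \<subseteq> \<Omega>")
      case True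
      have "v R = (\<Sum>A\<in>Pow R. dividend v A)"
        using finite_subset[OF True fin] by (simp add: sum_dividend)
      also have "\<dots> = (\<Sum>A\<in>Pow \<Omega> - {{}}. dividend v A * unanimity \<Omega> A R)"
        using True fin v
        by (intro sum.mono_neutral_cong) (auto simp: unanimity_def dividend_def games_def
            intro: finite_subset)
      finally show ?thesis
        using True by (simp add: comb_def)
    qed (use v in \<open>auto simp: comb_def games_def PiE_iff extensional_def\<close>)
  qed
  then show ?thesis
    using comb[of "Pow \<Omega> - {{}}"] fin by auto
qed

section \<open>Permutation groups and the uniqueness criterion\<close>

locale permutation_group =
  fixes \<Omega> :: "'a set" and G :: "('a \<Rightarrow> 'a) set"
  assumes fin: "finite \<Omega>"
    and permutes: "g \<in> G \<Longrightarrow> g permutes \<Omega>"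
    and id_mem: "id \<in> G"
    and comp_mem: "g \<in> G \<Longrightarrow> h \<in> G \<Longrightarrow> g \<circ> h \<in> G"
    and inv_mem: "g \<in> G \<Longrightarrow> inv' g \<in> G"
begin

lemma set_stabilizer_image:
  assumes "g \<in> set_stabilizer G A" "A \<subseteq> \<Omega>"
  shows "g ` A = A"
proof -
  have "inj_on g A" "finite A"
    using assms permutes permutes_inj_on[of g] fin finite_subset
    by (auto simp: set_stabilizer_def)
  then show ?thesis
    using assms endo_inj_surj[of A g] by (simp add: set_stabilizer_def)
qed

lemma symmetric_shapley_value: "symmetric_quasi_value \<Omega> G (selector_value \<Omega> (\<lambda>A. A))"
  using quasi_value_selector_value[OF fin] selector_value_act[OF fin permutes]
  by (simp add: symmetric_quasi_value_def)

text \<open>An element of the stabilizer of \<open>A\<close> that moves \<open>i\<close> to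
  \<open>j\<close> fixes the unanimity game, so symmetry gives both players the same share;
  efficiency then determines it.\<close>

lemma supertransitive_imp_value_unanimity:
  assumes "supertransitive \<Omega> G" "symmetric_quasi_value \<Omega> G \<phi>" "A \<subseteq> \<Omega>" "i \<in> A"
  shows "\<phi> (unanimity \<Omega> A) {i} = 1 / card A"
proof -
  have "\<phi> (unanimity \<Omega> A) {j} = \<phi> (unanimity \<Omega> A) {i}" if j: "j \<in> A" for j
  proof -
    have "\<exists>g\<in>set_stabilizer G A. g i = j"
      using assms(1,3,4) j by (simp add: supertransitive_def)
    then obtain g where g: "g \<in> set_stabilizer G A" "g i = j"
      by (rule bexE)
    have "g ` A = A"
      by (rule set_stabilizer_image[OF g(1) assms(3)])
    have "g \<in> G"
      using g(1) by (simp add: set_stabilizer_def)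
    note gp = permutes[OF this]
    have "act \<Omega> g (unanimity \<Omega> A) = unanimity \<Omega> A"
      using act_unanimity[OF gp, of A] \<open>g ` A = A\<close> by simp
    moreover have "\<phi> (act \<Omega> g (unanimity \<Omega> A)) = act \<Omega> g (\<phi> (unanimity \<Omega> A))"
    proof -
      have "unanimity \<Omega> A \<in> games \<Omega>"
        using assms(4) by (intro unanimity_in_games) auto
      then show ?thesis
        using assms(2) \<open>g \<in> G\<close> by (simp add: symmetric_quasi_value_def)
    qed
    moreover have "g -` {j} = {i}"
      using permutes_inj[OF gp] g(2) by (auto simp: inj_def)
    moreover have "act \<Omega> g (\<phi> (unanimity \<Omega> A)) {j} = \<phi> (unanimity \<Omega> A) (g -` {j})"
      using j assms(3) by (auto simp: act_def)
    ultimately show ?thesis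
      by simp
  qed
  then have "(\<Sum>j\<in>A. \<phi> (unanimity \<Omega> A) {j}) = card A * \<phi> (unanimity \<Omega> A) {i}"
    by simp
  moreover have "(\<Sum>j\<in>A. \<phi> (unanimity \<Omega> A) {j}) = 1"
    using assms by (intro sum_quasi_value_unanimity[OF fin])
      (auto simp: symmetric_quasi_value_def)
  ultimately show ?thesis
    by (metis mult_zero_left nonzero_mult_div_cancel_left zero_neq_one)
qed

lemma supertransitive_imp_unique:
  assumes "supertransitive \<Omega> G" "symmetric_quasi_value \<Omega> G \<phi>" "symmetric_quasi_value \<Omega> G \<psi>"
  shows "\<phi> = \<psi>"
proof (rule extensionalityI)
  have qv: "quasi_value \<Omega> \<phi>" "quasi_value \<Omega> \<psi>"
    using assms by (simp_all add: symmetric_quasi_value_def)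
  then have gv: "\<phi> \<in> game_values \<Omega>" "\<psi> \<in> game_values \<Omega>"
    by (simp_all add: quasi_value_def)
  then show "\<phi> \<in> extensional (games \<Omega>)" "\<psi> \<in> extensional (games \<Omega>)"
    by (simp_all add: game_values_def PiE_iff)
  fix v assume v: "v \<in> games \<Omega>"
  show "\<phi> v = \<psi> v"
  proof (rule linear_values_eqI[OF fin _ _ _ v])
    show "linear_value \<Omega> \<phi>" "linear_value \<Omega> \<psi>"
      using qv by (simp_all add: quasi_value_def)
    fix A assume A: "A \<noteq> {}" "A \<subseteq> \<Omega>"
    show "\<phi> (unanimity \<Omega> A) = \<psi> (unanimity \<Omega> A)"
    proof (rule additive_game_eqI[OF fin])
      show "\<phi> (unanimity \<Omega> A) \<in> additive_games \<Omega>" "\<psi> (unanimity \<Omega> A) \<in> additive_games \<Omega>"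
        using gv unanimity_in_games[OF A(1)] by (auto simp: game_values_def)
      fix i assume "i \<in> \<Omega>"
      then show "\<phi> (unanimity \<Omega> A) {i} = \<psi> (unanimity \<Omega> A) {i}"
        using supertransitive_imp_value_unanimity[OF assms(1,2) A(2), of i]
          supertransitive_imp_value_unanimity[OF assms(1,3) A(2), of i]
          quasi_value_unanimity_outside[OF qv(1) A(1), of i]
          quasi_value_unanimity_outside[OF qv(2) A(1), of i] by (cases "i \<in> A") auto
    qed
  qed
qed

text \<open>
  If \<open>i\<close> cannot be moved to \<open>j\<close> inside \<open>A\<close>, share the dividend of each translate of \<open>A\<close> among
  the translates of \<open>i\<close> only.
\<close>

lemma unique_imp_supertransitive:
  assumes unique: "\<And>\<phi> \<psi>. symmetric_quasi_value \<Omega> G \<phi> \<Longrightarrow> symmetric_quasi_value \<Omega> G \<psi> \<Longrightarrow> \<phi> = \<psi>"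
  shows "supertransitive \<Omega> G"
  unfolding supertransitive_def
proof (intro allI impI ballI, rule ccontr)
  fix A i j assume A: "A \<subseteq> \<Omega>" and ij: "i \<in> A" "j \<in> A"
    and no: "\<not> (\<exists>g\<in>set_stabilizer G A. g i = j)"
  \<comment> \<open>On a translate \<open>B\<close> of \<open>A\<close> the images of
    \<open>i\<close> under all elements carrying \<open>A\<close> to \<open>B\<close> are taken, not
    just one of them; this makes \<open>S\<close> equivariant. Other coalitions keep the equal
    split.\<close>
  define S where
    "S B = (if \<exists>g\<in>G. g ` A = B then {g i |g. g \<in> G \<and> g ` A = B} else B)" for B
  have equivariant: "S (\<pi> ` B) = \<pi> ` S B" if \<pi>: "\<pi> \<in> G" for \<pi> B
  proof -
    have inv: "inv' \<pi> \<circ> \<pi> = id" "\<pi> \<circ> inv' \<pi> = id"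
      by (rule permutes_inv_o[OF permutes[OF \<pi>]])+
    have to: "(\<pi> \<circ> g) ` A = \<pi> ` B \<and> \<pi> \<circ> g \<in> G" if "g \<in> G" "g ` A = B" for g
      using that \<pi> by (auto intro: comp_mem simp: image_comp[symmetric])
    have lift: "\<exists>h. h \<in> G \<and> h ` A = B \<and> g = \<pi> \<circ> h" if "g \<in> G" "g ` A = \<pi> ` B" for g
    proof (intro exI[of _ "inv' \<pi> \<circ> g"] conjI)
      show "inv' \<pi> \<circ> g \<in> G"
        using that \<pi> by (simp add: comp_mem inv_mem)
      have "(inv' \<pi> \<circ> g) ` A = (inv' \<pi> \<circ> \<pi>) ` B"
        by (simp only: image_comp[symmetric] that(2))
      then show "(inv' \<pi> \<circ> g) ` A = B"
        by (simp add: inv)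
      show "g = \<pi> \<circ> (inv' \<pi> \<circ> g)"
        by (simp add: comp_assoc[symmetric] inv)
    qed
    have conversely: "\<exists>h\<in>G. h ` A = B \<and> g i = \<pi> (h i)" if g: "g \<in> G" "g ` A = \<pi> ` B" for g
    proof -
      obtain h where "h \<in> G" "h ` A = B" "g = \<pi> \<circ> h"
        using lift[OF g] by (elim exE conjE)
      then show ?thesis
        by (intro bexI[of _ h]) simp_all
    qed
    have "{g i |g. g \<in> G \<and> g ` A = \<pi> ` B} = \<pi> ` {g i |g. g \<in> G \<and> g ` A = B}"
    proof (intro equalityI subsetI)
      fix x assume "x \<in> {g i |g. g \<in> G \<and> g ` A = \<pi> ` B}"
      then obtain g where g: "g \<in> G" "g ` A = \<pi> ` B" and x: "x = g i"
        by auto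
      obtain h where "h \<in> G" "h ` A = B" "g i = \<pi> (h i)"
        using conversely[OF g] by (elim bexE conjE)
      then show "x \<in> \<pi> ` {g i |g. g \<in> G \<and> g ` A = B}"
        unfolding x by (intro image_eqI[of _ _ "h i"]) auto
    next
      fix x assume "x \<in> \<pi> ` {g i |g. g \<in> G \<and> g ` A = B}"
      then obtain g where g: "g \<in> G" "g ` A = B" and x: "x = (\<pi> \<circ> g) i"
        by auto
      show "x \<in> {g i |g. g \<in> G \<and> g ` A = \<pi> ` B}"
        unfolding x using to[OF g] by (intro CollectI exI[of _ "\<pi> \<circ> g"] conjI) simp_all
    qed
    moreover have "(\<exists>g\<in>G. g ` A = \<pi> ` B) \<longleftrightarrow> (\<exists>g\<in>G. g ` A = B)"
      by (metis conversely to)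
    ultimately show ?thesis
      by (simp add: S_def)
  qed
  have S: "S B \<subseteq> B" "B \<noteq> {} \<Longrightarrow> S B \<noteq> {}" for B
    using ij by (auto simp: S_def)
  have "symmetric_quasi_value \<Omega> G (selector_value \<Omega> S)"
    using quasi_value_selector_value[OF fin, of S] S
      selector_value_act[OF fin permutes, of _ S] equivariant
    by (simp add: symmetric_quasi_value_def)
  \<comment> \<open>The unanimity game of \<open>A\<close> has a single nonzero dividend, at
    \<open>A\<close>. There the Shapley value pays \<open>j\<close> the positive amount
    \<open>1 / card A\<close>, while the rival pays nothing because \<open>j\<close> is not an image
    of \<open>i\<close>.\<close>
  then have "selector_value \<Omega> S (unanimity \<Omega> A) {j}
      = selector_value \<Omega> (\<lambda>A. A) (unanimity \<Omega> A) {j}"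
    using unique symmetric_shapley_value by metis
  moreover have "selector_value \<Omega> T (unanimity \<Omega> A) {j} = (if j \<in> T A then 1 / card (T A) else 0)"
    for T
  proof -
    have "selector_value \<Omega> T (unanimity \<Omega> A) {j} = (\<Sum>B\<in>Pow \<Omega>.
        if B = A then if j \<in> T A then 1 / card (T A) else 0 else 0)"
    proof (subst selector_value_singleton)
      show "unanimity \<Omega> A \<in> games \<Omega>"
        using ij by (intro unanimity_in_games) auto
      show "j \<in> \<Omega>"
        using A ij by auto
    qed (intro sum.cong refl, simp add: dividend_unanimity[OF fin A])
    then show ?thesis
      using A fin by simp
  qed
  moreover have "j \<notin> S A"
    using no id_mem by (auto simp: S_def set_stabilizer_def)
  moreover have "card A \<noteq> 0"
    using ij finite_subset[OF A fin] by auto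
  ultimately show False
    using ij by simp
qed

theorem unique_symmetric_quasi_value_iff:
  "(\<exists>!\<phi>. symmetric_quasi_value \<Omega> G \<phi>) \<longleftrightarrow> supertransitive \<Omega> G"
proof
  assume "\<exists>!\<phi>. symmetric_quasi_value \<Omega> G \<phi>"
  then show "supertransitive \<Omega> G"
    by (metis unique_imp_supertransitive)
next
  assume "supertransitive \<Omega> G"
  then show "\<exists>!\<phi>. symmetric_quasi_value \<Omega> G \<phi>"
    using supertransitive_imp_unique[OF _ _ symmetric_shapley_value]
    by (intro ex1I[of _ "selector_value \<Omega> (\<lambda>A. A)"] symmetric_shapley_value) simp
qed

end

text \<open>The locale uses bare closure conditions on sets of maps, so that stabilizers, pointwise
  fixers and cyclic groups are further instances of it over the same
  \<open>\<Omega>\<close>.\<close>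

lemma permutation_groupI:
  assumes "finite \<Omega>" "subgroup G (sym_group_on \<Omega>)"
  shows "permutation_group \<Omega> G"
proof
  show "finite \<Omega>" by fact
  interpret subgroup G "sym_group_on \<Omega>" by fact
  show perm: "g permutes \<Omega>" if "g \<in> G" for g
    using subsetD[OF subset that] by (simp add: sym_group_on_def)
  show "id \<in> G"
    using one_closed by (simp add: sym_group_on_def)
  show "g \<circ> h \<in> G" if "g \<in> G" "h \<in> G" for g h
    using m_closed[OF that] by (simp add: sym_group_on_def)
  show "inv' g \<in> G" if g: "g \<in> G" for g
  proof -
    have "inv\<^bsub>sym_group_on \<Omega>\<^esub> g = inv' g"
      by (rule group.inv_equality[OF group_sym_group_on])
        (simp_all add: sym_group_on_def perm[OF g] permutes_inv permutes_inv_o[OF perm[OF g]])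
    then show ?thesis
      using m_inv_closed[OF g] by simp
  qed
qed

section \<open>A prime between \<open>m\<close> and \<open>2 m - 2\<close>\<close>

text \<open>The last hypothesis says \<open>1 / c = 1 / a - 1 / b\<close>, so \<open>M / c\<close>
  is the difference of the integers \<open>M / a\<close> and \<open>M / b\<close>.\<close>

lemma dvd_of_reciprocal_difference:
  fixes a b c M :: nat
  assumes "a dvd M" "b dvd M" "a < b" "0 < a" "c * (b - a) = a * b"
  shows "c dvd M"
proof -
  obtain x y where xy: "M = a * x" "M = b * y"
    using assms(1,2) unfolding dvd_def by metis
  have "(int b - int a) * int c = int a * int b"
    using assms(3,5) by (metis mult.commute of_nat_diff less_imp_le of_nat_mult)
  then have "int a * int b * int M = (int b - int a) * int c * int M"
    by simp
  also have "\<dots> = int c * (int b * int M - int a * int M)"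
    by (simp add: algebra_simps)
  also have "int b * int M = int a * int b * int x"
    by (simp add: xy(1))
  also have "int a * int M = int a * int b * int y"
    by (subst xy(2)) simp
  finally have "int a * int b * int M = int a * int b * (int c * (int x - int y))"
    by (simp add: algebra_simps)
  then have "int M = int c * (int x - int y)"
    using assms(3,4) by simp
  then have "int c dvd int M"
    by simp
  then show ?thesis
    by simp
qed

text \<open>
  The numbers \<open>L n k = n * (n - 1 choose (k - 1))\<close> are the reciprocals of the entries of
  Leibniz's harmonic triangle, so \<open>1 / L n (k + 1) = 1 / L (n - 1) k - 1 / L n k\<close>.
\<close>

lemma Suc_times_binomial_dvd_Lcm: "k \<le> n \<Longrightarrow> Suc n * (n choose k) dvd Lcm {1..Suc n}"
proof (induction k arbitrary: n)
  case 0
  then show ?case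
    by (simp add: dvd_Lcm)
next
  case (Suc k)
  then obtain n' where n: "n = Suc n'" "k \<le> n'"
    by (cases n) auto
  \<comment> \<open>In the notation introduced above, \<open>a = L (n' + 1) (k + 1)\<close>,
    \<open>b = L (n' + 2) (k + 1)\<close> and \<open>c = L (n' + 2) (k + 2)\<close>, so the
    recurrence reads \<open>1 / c = 1 / a - 1 / b\<close>.\<close>
  define a b c where "a = Suc n' * (n' choose k)"
    and "b = Suc (Suc n') * (Suc n' choose k)" and "c = Suc (Suc n') * (Suc n' choose Suc k)"
  have a: "a = Suc k * (Suc n' choose Suc k)"
    by (simp only: a_def Suc_times_binomial_eq mult.commute)
  have "a dvd Lcm {1..Suc n'}"
    unfolding a_def by (rule Suc.IH) fact
  also have "Lcm {1..Suc n'} dvd Lcm {1..Suc (Suc n')}"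
    by (rule Lcm_subset) auto
  finally have "a dvd Lcm {1..Suc n}"
    by (simp add: n)
  moreover have "b dvd Lcm {1..Suc n}"
    unfolding b_def n(1) by (rule Suc.IH) (use n in auto)
  moreover have "0 < a"
    using n(2) by (simp add: a_def)
  moreover have "a < b"
  proof -
    have "a < Suc (Suc n') * (n' choose k)"
      using n(2) by (simp add: a_def)
    also have "\<dots> \<le> b"
      unfolding b_def by (intro mult_le_mono2) (cases k; simp)
    finally show ?thesis .
  qed
  moreover have "c * (b - a) = a * b"
  proof -
    define y where "y = Suc n' - k"
    have y: "Suc n' = k + y"
      using n(2) by (simp add: y_def)
    have A: "(Suc n' choose Suc k) * Suc k = (Suc n' choose k) * y"
    proof -
      have "(Suc n' choose Suc k) * Suc k = (Suc n' choose k) * (Suc n' - k)"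
        by (metis binomial_absorb_comp binomial_absorption mult.commute diff_Suc_1)
      then show ?thesis
        by (simp add: y_def)
    qed
    have ab: "a = (Suc n' choose k) * y"
      using A by (simp only: a mult.commute)
    have b: "b = (Suc n' choose k) * (k + y + 1)"
      unfolding b_def y[symmetric] by (simp only: Suc_eq_plus1 mult.commute)
    then have "b - a = (Suc n' choose k) * (k + 1)"
      unfolding ab b by (simp only: diff_mult_distrib2[symmetric]) simp
    then have "c * (b - a) = Suc (Suc n') * (Suc n' choose k) * ((Suc n' choose Suc k) * Suc k)"
      by (simp only: c_def Suc_eq_plus1 mult_ac)
    also have "\<dots> = a * b"
      by (simp only: A) (simp only: ab b_def mult_ac)
    finally show ?thesis .
  qed
  ultimately have "c dvd Lcm {1..Suc n}"
    by (intro dvd_of_reciprocal_difference[of a _ b c])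
  then show ?case
    by (simp add: c_def n)
qed

text \<open>The multiplicity of a prime in an lcm is the maximum of its multiplicities in the
  entries, so some single entry carries the full power. Positivity of \<open>e\<close> excludes the
  empty set, whose lcm is 1.\<close>

lemma prime_power_dvd_Lcm:
  fixes p :: nat
  assumes "finite A" "prime p" "0 < e" "p ^ e dvd Lcm A"
  shows "\<exists>a\<in>A. p ^ e dvd a"
  using assms(1,4)
proof (induction A rule: finite_induct)
  case empty
  then show ?case
    using assms(2,3) by (simp add: prime_nat_iff)
next
  case (insert a A)
  have "p ^ e dvd x \<or> p ^ e dvd y" if "p ^ e dvd lcm x y" for x y
  proof (cases "x = 0 \<or> y = 0")
    case False
    then have "multiplicity p (lcm x y) = max (multiplicity p x) (multiplicity p y)"
      using assms(2) by (intro multiplicity_lcm) (auto intro: prime_imp_prime_elem)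
    then show ?thesis
      using that False power_dvd_iff_le_multiplicity[of "lcm x y" p e] prime_gt_1_nat[OF assms(2)]
        power_dvd_iff_le_multiplicity[of x p e] power_dvd_iff_le_multiplicity[of y p e]
      by (auto simp: max_def lcm_eq_0_iff split: if_splits)
  qed auto
  then show ?case
    using insert by auto
qed

text \<open>Usually read off Legendre's formula. Here
  \<open>k * (n choose k) = n * (n - 1 choose (k - 1))\<close> divides the lcm of
  \<open>{1..n}\<close>, so the prime power divides a number between 1 and \<open>n\<close>.\<close>

lemma prime_power_dvd_binomial:
  fixes p :: nat
  assumes "prime p" "p ^ e dvd (n choose k)" "k \<le> n" "0 < n"
  shows "p ^ e \<le> n"
proof (cases "e = 0 \<or> k = 0")
  case True
  then show ?thesis
    using assms by (auto simp: nat_dvd_1_iff_1)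
next
  case False
  then obtain n' k' where nk: "n = Suc n'" "k = Suc k'"
    using assms(4) by (metis not0_implies_Suc not_gr_zero)
  have "p ^ e dvd Suc k' * (Suc n' choose Suc k')"
    using assms(2) nk by simp
  also have "\<dots> = Suc n' * (n' choose k')"
    by (simp only: Suc_times_binomial_eq mult.commute)
  also have "\<dots> dvd Lcm {1..n}"
    using Suc_times_binomial_dvd_Lcm[of k' n'] assms(3) nk by simp
  finally obtain a where "a \<in> {1..n}" "p ^ e dvd a"
    using prime_power_dvd_Lcm[of "{1..n}" p e] assms(1) False by auto
  then show ?thesis
    using dvd_imp_le[of "p ^ e" a] by auto
qed

section \<open>The bound on the product of all primes up to n\<close>

lemma prod_primes_dvd:
  fixes N :: nat
  assumes "finite P" "\<And>p. p \<in> P \<Longrightarrow> prime p" "\<And>p. p \<in> P \<Longrightarrow> p dvd N"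
  shows "\<Prod>P dvd N"
  using assms
proof (induction P rule: finite_induct)
  case (insert p P)
  have "coprime p (\<Prod>P)"
    using insert by (intro prod_coprime_right) (metis insertCI primes_coprime)
  then show ?case
    using insert by (simp add: divides_mult)
qed auto

text \<open>The two middle entries of row \<open>2 * m + 1\<close> are equal, and together they are
  at most the row sum \<open>2 * 4 ^ m\<close>.\<close>

lemma binomial_odd_middle: "(2 * m + 1) choose m \<le> 4 ^ m"
proof -
  have "2 * ((2 * m + 1) choose m) = (\<Sum>k\<in>{m, m + 1}. (2 * m + 1) choose k)"
    using binomial_symmetric[of m "2 * m + 1"] by (simp add: mult_2)
  also have "\<dots> \<le> (\<Sum>k\<le>2 * m + 1. (2 * m + 1) choose k)"
    by (intro sum_mono2) auto
  also have "\<dots> = 2 ^ (2 * m + 1)"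
    by (rule choose_row_sum)
  also have "\<dots> = 2 * 4 ^ m"
    by (simp add: power_mult)
  finally show ?thesis
    by simp
qed

lemma primorial_le: "\<Prod>{p. prime p \<and> p \<le> n} \<le> (4 :: nat) ^ n"
proof (induction n rule: less_induct)
  case (less n)
  have fin: "finite {p :: nat. prime p \<and> p \<le> k}" for k
    by (rule finite_subset[of _ "{..k}"]) auto
  consider "n \<le> 2" | "n > 2" "even n" | "n > 2" "odd n"
    by linarith
  then show ?case
  proof cases
    case 1
    have "{p :: nat. prime p \<and> p \<le> n} = (if n = 2 then {2} else {})"
      using 1 by (auto dest: prime_ge_2_nat)
    then show ?thesis
      by simp
  next
    case 2
    then have "{p :: nat. prime p \<and> p \<le> n} = {p. prime p \<and> p \<le> n - 1}"
      using prime_odd_nat[of n] by (auto simp: le_less intro: Suc_leI)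
    then have "\<Prod>{p :: nat. prime p \<and> p \<le> n} \<le> 4 ^ (n - 1)"
      using less[of "n - 1"] 2 by simp
    also have "\<dots> \<le> 4 ^ n"
      by (intro power_increasing) auto
    finally show ?thesis .
  next
    case 3
    then obtain m where m: "n = 2 * m + 1" "0 < m"
      by (auto elim!: oddE)
    define Q where "Q = {p :: nat. prime p \<and> m + 1 < p \<and> p \<le> n}"
    have "finite Q"
      unfolding Q_def by (rule finite_subset[of _ "{..n}"]) auto
    have "\<Prod>Q dvd (2 * m + 1) choose m"
    proof (rule prod_primes_dvd[OF \<open>finite Q\<close>])
      fix p assume p: "p \<in> Q"
      then have "p dvd fact (2 * m + 1)"
        by (simp only: Q_def m mem_Collect_eq prime_dvd_fact_iff)
      moreover have "fact m * fact (m + 1) * ((2 * m + 1) choose m) = fact (2 * m + 1)"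
        using binomial_fact_lemma[of m "2 * m + 1"] by (simp add: mult_2)
      moreover have "\<not> p dvd fact m" "\<not> p dvd fact (m + 1)"
        using p by (simp_all only: Q_def mem_Collect_eq prime_dvd_fact_iff) auto
      moreover have "prime p"
        using p by (simp add: Q_def)
      ultimately show "p dvd (2 * m + 1) choose m"
        by (metis prime_dvd_mult_iff)
    qed (simp add: Q_def)
    then have "\<Prod>Q \<le> (2 * m + 1) choose m"
      by (rule dvd_imp_le) simp
    then have Q: "\<Prod>Q \<le> 4 ^ m"
      using binomial_odd_middle[of m] by (rule le_trans)
    have "{p. prime p \<and> p \<le> n} = {p. prime p \<and> p \<le> m + 1} \<union> Q"
      using m by (auto simp: Q_def)
    then have "\<Prod>{p. prime p \<and> p \<le> n} = \<Prod>{p. prime p \<and> p \<le> m + 1} * \<Prod>Q"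
      using \<open>finite Q\<close> fin by (simp only:) (rule prod.union_disjoint, auto simp: Q_def)
    also have "\<dots> \<le> 4 ^ (m + 1) * 4 ^ m"
      using m by (intro mult_le_mono less Q) auto
    also have "\<dots> = 4 ^ n"
      by (simp add: m power_add[symmetric] mult_2)
    finally show ?thesis .
  qed
qed

text \<open>Such a prime divides \<open>fact m\<close>, so if it also divided the binomial
  coefficient its square would divide the product of \<open>{Suc m..2 * m}\<close>. The only
  multiple of \<open>p\<close> in that range is \<open>2 * p\<close>, which contains
  \<open>p\<close> once because \<open>p\<close> is odd.\<close>

lemma central_binomial_not_dvd:
  fixes p m :: nat
  assumes "prime p" "p \<noteq> 2" "p \<le> m" "2 * m < 3 * p"
  shows "\<not> p dvd (2 * m) choose m"
proof
  assume "p dvd (2 * m) choose m"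
  moreover have "p dvd fact m"
    using assms by (simp add: prime_dvd_fact_iff)
  ultimately have "p * p dvd fact m * ((2 * m) choose m)"
    by (intro mult_dvd_mono)
  moreover have "fact m * ((2 * m) choose m) = \<Prod>{Suc m..2 * m}"
  proof -
    have "fact m * (fact m * ((2 * m) choose m)) = (fact (2 * m) :: nat)"
      using binomial_fact_lemma[of m "2 * m"] by (simp add: mult_2 mult.assoc)
    also have "\<dots> = fact m * \<Prod>{Suc m..2 * m}"
      by (rule fact_eq_fact_times) simp
    finally show ?thesis
      by simp
  qed
  moreover have "\<Prod>{Suc m..2 * m} = 2 * p * \<Prod>({Suc m..2 * m} - {2 * p})"
    using assms by (intro prod.remove) auto
  ultimately have "p * p dvd p * (2 * \<Prod>({Suc m..2 * m} - {2 * p}))"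
    by (simp add: mult_ac)
  then have "p dvd 2 * \<Prod>({Suc m..2 * m} - {2 * p})"
    using assms(1) by (simp add: prime_gt_0_nat)
  moreover have "\<not> p dvd 2"
    using assms(1,2) primes_dvd_imp_eq two_is_prime_nat by blast
  ultimately have "p dvd \<Prod>({Suc m..2 * m} - {2 * p})"
    using assms(1) by (simp only: prime_dvd_mult_iff) simp
  then obtain i where i: "i \<in> {Suc m..2 * m} - {2 * p}" "p dvd i"
    using prime_dvd_prod_iff[OF _ assms(1), of "{Suc m..2 * m} - {2 * p}" "\<lambda>i. i"]
    by (meson finite_Diff finite_atLeastAtMost)
  then obtain k where k: "i = p * k"
    by (auto elim: dvdE)
  have "m < i" "i \<le> 2 * m" "i \<noteq> 2 * p"
    using i(1) by auto
  moreover from this have "k \<noteq> 2"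
    using k by auto
  ultimately have "p < i" "i < p * 3" "k \<noteq> 2"
    using assms(3,4) by linarith+
  then have "p * 1 < p * k" "p * k < p * 3"
    by (simp_all only: k mult_1_right)
  then have "1 < k" "k < 3"
    by (simp_all only: mult_less_cancel1)
  then show False
    using \<open>k \<noteq> 2\<close> by simp
qed

text \<open>The eighth power is what the fourth power of \<open>(s + 1) ^ 2\<close> produces in the
  estimate below. At \<open>s = 43\<close> the inequality still fails. In the induction step the
  left side grows by at most the factor \<open>(46 / 45) ^ 8\<close>, which is less than 2.\<close>

lemma power8_le_power2: "44 \<le> s \<Longrightarrow> (s + 1) ^ 8 \<le> (2 :: nat) ^ s"
proof (induction s rule: dec_induct)
  case base
  show ?case
    by simp
next
  case (step s)
  have "45 ^ 8 * (Suc s + 1) ^ 8 = (45 * (Suc s + 1)) ^ 8"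
    by (simp only: power_mult_distrib)
  also have "\<dots> \<le> (46 * (s + 1)) ^ 8"
    using step(1) by (intro power_mono) auto
  also have "\<dots> = 46 ^ 8 * (s + 1) ^ 8"
    by (simp only: power_mult_distrib)
  also have "\<dots> \<le> (45 ^ 8 * 2) * (s + 1) ^ 8"
    by (intro mult_le_mono1) simp
  also have "\<dots> \<le> (45 ^ 8 * 2) * 2 ^ s"
    using step.IH by (intro mult_le_mono2)
  finally have "45 ^ 8 * (Suc s + 1) ^ 8 \<le> 45 ^ 8 * (2 :: nat) ^ Suc s"
    by (simp only: power_Suc mult.assoc)
  then show ?case
    by (subst (asm) mult_le_cancel1) simp
qed

text \<open>In the factorization of the central binomial coefficient every prime power is at most
  \<open>2 * m\<close>, and there are at most \<open>s\<close> primes up to \<open>s\<close>. A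
  prime above \<open>s\<close> occurs only once, since its square exceeds \<open>2 * m\<close>;
  those up to \<open>m\<close> are at most \<open>2 * m div 3\<close>, and their product is bounded
  by the primorial. Above \<open>m\<close> only \<open>2 * m - 1\<close> escapes the hypothesis,
  \<open>2 * m - 2\<close> and \<open>2 * m\<close> being even; it costs one more factor
  \<open>2 * m\<close>, hence the exponent \<open>s + 1\<close>.\<close>

lemma central_binomial_le:
  fixes m :: nat
  defines "s \<equiv> floor_sqrt (2 * m)"
  assumes m: "9 \<le> m" and no_prime: "\<And>p. prime p \<Longrightarrow> m < p \<Longrightarrow> p < 2 * m - 2 \<Longrightarrow> False"
  shows "(2 * m) choose m \<le> (2 * m) ^ (s + 1) * 4 ^ (2 * m div 3)"
proof -
  define N where "N = (2 * m) choose m"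
  define P where "P = prime_factors N"
  have "N > 0"
    by (simp add: N_def)
  have P: "prime p" "p dvd N" if "p \<in> P" for p
    using that by (auto simp: P_def)
  have pow: "p ^ multiplicity p N \<le> 2 * m" if "p \<in> P" for p
    using P[OF that] m unfolding N_def
    by (intro prime_power_dvd_binomial[of p _ "2 * m" m]) (auto simp: multiplicity_dvd)
  have le: "p \<le> 2 * m" if "p \<in> P" for p
    using P[OF that] m prime_power_dvd_binomial[of p 1 "2 * m" m] by (simp add: N_def)
  define P1 P2 P3 where "P1 = {p\<in>P. p \<le> s}" and "P2 = {p\<in>P. s < p \<and> p \<le> m}"
    and "P3 = {p\<in>P. s < p \<and> m < p}"
  have fin: "finite P" "finite P1" "finite P2" "finite P3"
    by (simp_all add: P_def P1_def P2_def P3_def)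
  have simple: "p ^ multiplicity p N \<le> p" if "p \<in> P" "s < p" for p
  proof (rule ccontr)
    assume *: "\<not> p ^ multiplicity p N \<le> p"
    have "p > 0"
      using P[OF that(1)] prime_gt_0_nat by blast
    then have "multiplicity p N \<ge> 2"
      using * by (cases "multiplicity p N" rule: nat.exhaust;
          cases "multiplicity p N - 1" rule: nat.exhaust) auto
    then have "p ^ 2 \<le> p ^ multiplicity p N"
      using \<open>p > 0\<close> by (intro power_increasing) auto
    also have "\<dots> \<le> 2 * m"
      by (rule pow) fact
    finally have "p \<le> s"
      unfolding s_def by (intro le_floor_sqrtI[of p "2 * m"]) auto
    then show False
      using that by simp
  qed
  have "P3 \<subseteq> {2 * m - 1}"
  proof
    fix p assume "p \<in> P3"
    then have p: "prime p" "m < p" "p \<le> 2 * m"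
      using P le by (auto simp: P3_def)
    then have "odd p"
      using m prime_odd_nat[of p] by auto
    then have "p \<noteq> 2 * m" "p \<noteq> 2 * m - 2"
      using m by auto
    moreover have "\<not> p < 2 * m - 2"
      using no_prime p by blast
    ultimately show "p \<in> {2 * m - 1}"
      using p by auto
  qed
  have "p \<le> 2 * m div 3" if "p \<in> P2" for p
  proof (rule ccontr)
    assume *: "\<not> p \<le> 2 * m div 3"
    then have "2 * m < 3 * p"
      by linarith
    moreover have "p \<noteq> 2"
      using calculation m by auto
    ultimately show False
      using central_binomial_not_dvd[of p m] that P[of p] by (auto simp: P2_def N_def)
  qed
  then have P2: "P2 \<subseteq> {p. prime p \<and> p \<le> 2 * m div 3}"
    using P by (auto simp: P2_def)
  have "N = (\<Prod>p\<in>P. p ^ multiplicity p N)"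
    unfolding P_def using \<open>N > 0\<close> by (simp add: prime_factorization_nat)
  also have "P = P1 \<union> (P2 \<union> P3)"
    by (auto simp: P1_def P2_def P3_def)
  also have "(\<Prod>p\<in>\<dots>. p ^ multiplicity p N)
      = (\<Prod>p\<in>P1. p ^ multiplicity p N) * ((\<Prod>p\<in>P2. p ^ multiplicity p N) * (\<Prod>p\<in>P3. p ^ multiplicity p N))"
    using fin by (subst prod.union_disjoint, simp_all add: P1_def P2_def P3_def)
      (auto intro!: prod.union_disjoint)
  also have "\<dots> \<le> (2 * m) ^ s * (4 ^ (2 * m div 3) * (2 * m))"
  proof (intro mult_le_mono)
    have "(\<Prod>p\<in>P1. p ^ multiplicity p N) \<le> (\<Prod>p\<in>P1. 2 * m)"
      by (intro prod_mono) (auto simp: P1_def intro: pow)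
    also have "\<dots> = (2 * m) ^ card P1"
      by simp
    also have "\<dots> \<le> (2 * m) ^ s"
    proof (rule power_increasing)
      have "P1 \<subseteq> {1..s}"
        using P(1) prime_ge_1_nat unfolding P1_def by fastforce
      then show "card P1 \<le> s"
        using card_mono[of "{1..s}" P1] by simp
    qed (use m in simp)
    finally show "(\<Prod>p\<in>P1. p ^ multiplicity p N) \<le> (2 * m) ^ s" .
    have "(\<Prod>p\<in>P2. p ^ multiplicity p N) \<le> \<Prod>P2"
      by (intro prod_mono) (auto simp: P2_def intro: simple)
    also have "\<Prod>P2 \<le> \<Prod>{p. prime p \<and> p \<le> 2 * m div 3}"
    proof (rule dvd_imp_le[OF prod_dvd_prod_subset[OF _ P2]])
      show "finite {p. prime p \<and> p \<le> 2 * m div 3}"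
        by (rule finite_subset[of _ "{..2 * m div 3}"]) auto
    qed (auto intro!: prod_pos prime_gt_0_nat)
    also have "\<dots> \<le> 4 ^ (2 * m div 3)"
      by (rule primorial_le)
    finally show "(\<Prod>p\<in>P2. p ^ multiplicity p N) \<le> 4 ^ (2 * m div 3)" .
    have "(\<Prod>p\<in>P3. p ^ multiplicity p N) \<le> \<Prod>P3"
      by (intro prod_mono) (auto simp: P3_def intro: simple)
    also have "\<Prod>P3 \<le> 2 * m"
      using \<open>P3 \<subseteq> {2 * m - 1}\<close> m by (auto simp: subset_singleton_iff)
    finally show "(\<Prod>p\<in>P3. p ^ multiplicity p N) \<le> 2 * m" .
  qed
  also have "\<dots> = (2 * m) ^ (s + 1) * 4 ^ (2 * m div 3)"
    by simp
  finally show ?thesis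
    by (simp add: N_def)
qed

text \<open>Compared with the lower bound \<open>4 ^ m / (2 * m)\<close>, the upper bound leaves
  roughly \<open>4 ^ (m / 3) <= (2 * m) ^ (s + 2)\<close>. With
  \<open>s ^ 2 <= 2 * m < (s + 1) ^ 2\<close> this becomes
  \<open>2 ^ (s ^ 2) <= (s + 1) ^ (6 * (s + 2))\<close>, which is false for large \<open>s\<close>.
  The threshold is \<open>968 = 44 ^ 2 / 2\<close>, so that \<open>s >= 44\<close>.\<close>

lemma bertrand_large:
  fixes m :: nat
  assumes "968 \<le> m"
  shows "\<exists>p. prime p \<and> m < p \<and> p < 2 * m - 2"
proof (rule ccontr)
  define s where "s = floor_sqrt (2 * m)"
  assume "\<not> ?thesis"
  then have "(2 * m) choose m \<le> (2 * m) ^ (s + 1) * 4 ^ (2 * m div 3)"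
    unfolding s_def using assms by (intro central_binomial_le) auto
  moreover have "4 ^ m \<le> 2 * m * ((2 * m) choose m)"
  proof -
    have "real (4 ^ m) \<le> real (2 * m * ((2 * m) choose m))"
      using central_binomial_lower_bound[of m] assms by (simp add: field_simps)
    then show ?thesis
      by (simp only: of_nat_le_iff)
  qed
  ultimately have "4 ^ m \<le> 2 * m * ((2 * m) ^ (s + 1) * 4 ^ (2 * m div 3))"
    by (meson le_trans mult_le_mono2)
  also have "\<dots> = 4 ^ (2 * m div 3) * (2 * m) ^ (s + 2)"
    by simp
  finally have "4 ^ (2 * m div 3) * 4 ^ (m - 2 * m div 3) \<le> 4 ^ (2 * m div 3) * (2 * m) ^ (s + 2)"
    by (simp add: power_add[symmetric])
  then have "4 ^ (m - 2 * m div 3) \<le> (2 * m) ^ (s + 2)"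
    by (subst (asm) mult_le_cancel1) simp
  \<comment> \<open>Cubing removes the truncated division by 3.\<close>
  then have "(4 ^ (m - 2 * m div 3)) ^ 3 \<le> ((2 * m) ^ (s + 2)) ^ 3"
    by (intro power_mono) auto
  then have *: "4 ^ (3 * (m - 2 * m div 3)) \<le> (2 * m) ^ (3 * (s + 2))"
    by (simp only: power_mult[symmetric] mult.commute)
  have s: "s ^ 2 \<le> 2 * m" "2 * m < (s + 1) ^ 2"
    using Suc_floor_sqrt_power2_gt[of "2 * m"] by (simp_all add: s_def)
  have "44 ^ 2 \<le> 2 * m"
    using assms by simp
  then have s44: "44 \<le> s"
    unfolding s_def by (rule le_floor_sqrtI)
  have "2 ^ s\<^sup>2 \<le> (2 :: nat) ^ (2 * m)"
    by (intro power_increasing s) simp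
  also have "\<dots> = 4 ^ m"
    by (simp add: power_mult)
  also have "\<dots> \<le> 4 ^ (3 * (m - 2 * m div 3))"
    by (intro power_increasing) linarith+
  also note *
  also have "(2 * m) ^ (3 * (s + 2)) \<le> ((s + 1) ^ 2) ^ (3 * (s + 2))"
    using s by (intro power_mono) auto
  \<comment> \<open>The fourth power turns \<open>(s + 1) ^ 2\<close> into
    \<open>(s + 1) ^ 8\<close>; comparing exponents of 2 then gives
    \<open>4 * s ^ 2 <= 3 * s * (s + 2)\<close>, hence \<open>s <= 6\<close>.\<close>
  finally have "(2 ^ s\<^sup>2) ^ 4 \<le> (((s + 1) ^ 2) ^ (3 * (s + 2))) ^ 4"
    by (intro power_mono) auto
  also have "\<dots> = ((s + 1) ^ 8) ^ (3 * (s + 2))"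
    by (simp only: power_mult[symmetric]) (simp add: algebra_simps)
  also have "\<dots> \<le> (2 ^ s) ^ (3 * (s + 2))"
    by (intro power_mono power8_le_power2 s44) simp
  finally have "s\<^sup>2 * 4 \<le> s * (3 * (s + 2))"
    by (simp only: power_mult[symmetric]) (subst (asm) power_increasing_iff, simp_all)
  then have "s * s \<le> s * 6"
    by (simp add: power2_eq_square algebra_simps)
  then show False
    using s44 by simp
qed

text \<open>Trial division up to the square root. The candidates form a list so that the simplifier
  can run through them when \<open>n\<close> and \<open>k\<close> are numerals.\<close>

lemma prime_if_no_small_divisor:
  fixes n :: nat
  assumes "1 < n" "n < k ^ 2" "\<forall>d\<in>set [2..<k]. \<not> d dvd n"
  shows "prime n"
proof (rule ccontr)
  assume "\<not> prime n"
  then obtain d where d: "d dvd n" "d \<noteq> 1" "d \<noteq> n"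
    using assms(1) unfolding prime_nat_iff by auto
  then obtain e where e: "n = d * e"
    by (auto elim: dvdE)
  then have "1 < d" "1 < e"
    using d assms(1) by (auto simp: nat_neq_iff)
  moreover have "d < k \<or> e < k"
    using e assms(2) by (metis leI mult_le_mono not_le power2_eq_square)
  moreover have "e dvd n"
    using e by simp
  ultimately show False
    using assms(3) d(1) by auto
qed

text \<open>The upper bound \<open>2 * m - 2\<close> is chosen for \<open>m = n div 2\<close>, where
  it gives \<open>p <= n - 3\<close> for even and odd \<open>n\<close> alike. Below 968 a chain of
  primes suffices: each \<open>p\<close> in it and its predecessor \<open>q\<close> satisfy
  \<open>p + 2 < 2 * q\<close>, so \<open>p\<close> serves all \<open>m\<close> with
  \<open>q <= m < p\<close>.\<close>

lemma bertrand_variant: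
  fixes m :: nat
  assumes "4 \<le> m"
  shows "\<exists>p. prime p \<and> m < p \<and> p < 2 * m - 2"
proof (cases "968 \<le> m")
  case True
  then show ?thesis
    by (rule bertrand_large)
next
  case False
  have "prime (5 :: nat)" "prime (7 :: nat)" "prime (11 :: nat)" "prime (13 :: nat)"
    "prime (23 :: nat)" "prime (43 :: nat)" "prime (83 :: nat)" "prime (163 :: nat)"
    "prime (317 :: nat)" "prime (631 :: nat)" "prime (1259 :: nat)"
    by (rule prime_if_no_small_divisor[where k = 3] prime_if_no_small_divisor[where k = 8]
        prime_if_no_small_divisor[where k = 20] prime_if_no_small_divisor[where k = 37];
        (simp; fail))+
  note primes = this
  have *: ?thesis if "prime (p :: nat)" "m < p" "p + 2 < 2 * m" for p
    using that by (intro exI[of _ p]) auto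
  have "m < 5 \<or> 5 \<le> m \<and> m < 7 \<or> 7 \<le> m \<and> m < 11 \<or> 11 \<le> m \<and> m < 13 \<or>
      13 \<le> m \<and> m < 23 \<or> 23 \<le> m \<and> m < 43 \<or> 43 \<le> m \<and> m < 83 \<or> 83 \<le> m \<and> m < 163 \<or>
      163 \<le> m \<and> m < 317 \<or> 317 \<le> m \<and> m < 631 \<or> 631 \<le> m \<and> m < 1259"
    using False by linarith
  then show ?thesis
    using assms by (elim disjE) (rule primes[THEN *]; (simp; fail))+
qed

section \<open>Orbits, stabilizers and elements of prime order\<close>

text \<open>By Bezout \<open>m * a = n * b + 1\<close>, so applying \<open>f\<close> once more after
  \<open>n * b\<close> steps, which return to \<open>x\<close>, again gives \<open>x\<close>. No
  inverse of \<open>f\<close> is involved.\<close>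

lemma fixed_point_if_coprime_periods:
  assumes "(f ^^ m) x = x" "(f ^^ n) x = x" "coprime m n"
  shows "f x = x"
proof (cases "m = 0")
  case True
  then show ?thesis
    using assms by simp
next
  case False
  obtain a b where "m * a = n * b + 1"
    using bezout_nat[OF False, of n] assms(3) by (auto simp: coprime_iff_gcd_eq_1)
  moreover have "(f ^^ (m * a)) x = x" "(f ^^ (n * b)) x = x"
    using assms(1,2) funpow_mod_eq[OF assms(1), of "m * a"]
      funpow_mod_eq[OF assms(2), of "n * b"] by simp_all
  ultimately show ?thesis
    by simp
qed

text \<open>A coincidence of two iterates makes their distance a second period, and a positive
  number below \<open>p\<close> is coprime to \<open>p\<close>.\<close>

lemma inj_on_prime_orbit:
  assumes "prime p" "(f ^^ p) x = x" "f x \<noteq> x"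
  shows "inj_on (\<lambda>i. (f ^^ i) x) {..<p}"
proof (rule linorder_inj_onI)
  fix i j assume ij: "i < j" "i \<in> {..<p}" "j \<in> {..<p}"
  show "(f ^^ i) x \<noteq> (f ^^ j) x"
  proof
    assume eq: "(f ^^ i) x = (f ^^ j) x"
    have "x = (f ^^ (p - i + i)) x"
      using ij assms(2) by simp
    also have "\<dots> = (f ^^ (p - i + j)) x"
      by (simp only: funpow_add comp_apply eq)
    also have "p - i + j = (j - i) + p"
      using ij by auto
    finally have "(f ^^ (j - i)) x = x"
      by (simp add: funpow_add assms(2))
    moreover have "coprime p (j - i)"
    proof (rule prime_imp_coprime[OF assms(1)])
      show "\<not> p dvd j - i"
        using ij by (intro nat_dvd_not_less) auto
    qed
    ultimately show False
      using fixed_point_if_coprime_periods[OF assms(2)] assms(3) by blast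
  qed
qed auto

lemma funpow_fixed: "f x = x \<Longrightarrow> (f ^^ n) x = x"
  by (induction n) auto

lemma funpow_image_subset: "f ` X \<subseteq> X \<Longrightarrow> x \<in> X \<Longrightarrow> (f ^^ i) x \<in> X"
  by (induction i) auto

lemma prime_orbit:
  assumes "prime p" "(f ^^ p) x = x" "f x \<noteq> x" "f ` X \<subseteq> X" "x \<in> X"
  shows "(\<lambda>i. (f ^^ i) x) ` {..<p} \<subseteq> X" "card ((\<lambda>i. (f ^^ i) x) ` {..<p}) = p"
  using inj_on_prime_orbit[OF assms(1-3)] assms(4,5) by (auto simp: card_image funpow_image_subset)

text \<open>A moved point would have \<open>p\<close> distinct iterates, more than \<open>X\<close>
  can hold.\<close>

lemma fixed_point_of_prime_period:
  assumes "prime p" "(f ^^ p) x = x" "f ` X \<subseteq> X" "x \<in> X" "finite X" "card X < p"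
  shows "f x = x"
proof (rule ccontr)
  assume "f x \<noteq> x"
  note orbit = prime_orbit[OF assms(1,2) this assms(3,4)]
  show False
    using card_mono[OF assms(5) orbit(1)] assms(6) unfolding orbit(2) by simp
qed

text \<open>Removing one orbit takes away exactly \<open>p\<close> points and leaves an invariant
  set, so \<open>X\<close> is a disjoint union of orbits of size \<open>p\<close>.\<close>

lemma prime_dvd_card_if_no_fixed_point:
  assumes "prime p" "finite X" "f ` X \<subseteq> X" "\<And>x. x \<in> X \<Longrightarrow> (f ^^ p) x = x"
    and "\<And>x. x \<in> X \<Longrightarrow> f x \<noteq> x"
  shows "p dvd card X"
  using assms(2-5)
proof (induction X rule: finite_psubset_induct)
  case (psubset X)
  show ?case
  proof (cases "X = {}")
    case False
    then obtain x where x: "x \<in> X"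
      by blast
    define Y where "Y = (\<lambda>i. (f ^^ i) x) ` {..<p}"
    have Y: "Y \<subseteq> X" "card Y = p"
      unfolding Y_def using psubset.prems x by (intro prime_orbit[OF assms(1)]; simp)+
    have p: "0 < p"
      using assms(1) by (rule prime_gt_0_nat)
    have "x \<in> Y"
      unfolding Y_def using p by (intro image_eqI[of _ _ 0]) auto
    have iter: "(f ^^ i) x \<in> Y" for i
    proof -
      have "(f ^^ i) x = (f ^^ (i mod p)) x"
        by (rule funpow_mod_eq[symmetric]) (rule psubset.prems(2)[OF x])
      then show ?thesis
        using p by (auto simp: Y_def)
    qed
    have "p dvd card (X - Y)"
    proof (rule psubset.IH)
      show "X - Y \<subset> X"
        using \<open>x \<in> Y\<close> Y(1) by blast
      show "f ` (X - Y) \<subseteq> X - Y"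
      proof
        fix z assume "z \<in> f ` (X - Y)"
        then obtain y where y: "y \<in> X" "y \<notin> Y" "z = f y"
          by blast
        have "z \<notin> Y"
        proof
          assume "z \<in> Y"
          then obtain i where "f y = (f ^^ i) x"
            by (auto simp: Y_def y(3))
          \<comment> \<open>On \<open>X\<close> the iterate \<open>f ^^ (p - 1)\<close> inverts
            \<open>f\<close>, so a point sent into the orbit \<open>Y\<close> already belongs to
            it.\<close>
          moreover have "y = (f ^^ (p - 1)) (f y)"
            using psubset.prems(2)[OF y(1)] p by (cases p) (auto simp: funpow_swap1)
          ultimately have "y = (f ^^ (p - 1 + i)) x"
            by (simp add: funpow_add)
          then show False
            using iter y(2) by simp
        qed
        then show "z \<in> X - Y"
          using y psubset.prems(1) by blast
      qed
    qed (use psubset.prems in auto)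
    moreover have "card X = card (X - Y) + p"
      using Y psubset(1) card_mono[of X Y] by (simp add: card_Diff_subset finite_subset)
    ultimately show ?thesis
      by simp
  qed simp
qed

text \<open>A cycle of prime length with support \<open>A\<close>. The description of orbits is
  built in so that every point of \<open>A\<close> is at hand as an iterate of any other.\<close>

definition prime_cycle :: "('a \<Rightarrow> 'a) \<Rightarrow> 'a set \<Rightarrow> bool" where
  "prime_cycle c A \<longleftrightarrow> prime (card A) \<and> c permutes A \<and> c ^^ card A = id \<and>
    (\<forall>x\<in>A. c x \<noteq> x \<and> A = (\<lambda>i. (c ^^ i) x) ` {..<card A})"

text \<open>A moved point has \<open>card A\<close> distinct iterates, which exhaust
  \<open>A\<close>; a fixed point in \<open>A\<close> would be one of them, and iterating back to
  the start shows that the moved point is fixed too.\<close>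

lemma prime_cycleI:
  assumes "prime (card A)" "c permutes A" "c ^^ card A = id" "c \<noteq> id"
  shows "prime_cycle c A"
proof -
  define p where "p = card A"
  have "finite A"
    using assms(1) by (intro card_ge_0_finite prime_gt_0_nat)
  have c: "c ` A \<subseteq> A"
    using permutes_image[OF assms(2)] by simp
  have orbit: "A = (\<lambda>i. (c ^^ i) x) ` {..<p}" if "x \<in> A" "c x \<noteq> x" for x
    by (rule card_subset_eq[symmetric, OF \<open>finite A\<close>])
      (use prime_orbit[of p c x A] assms(1,3) that c in \<open>simp_all add: p_def\<close>)
  have moved: "c x \<noteq> x" if "x \<in> A" for x
  proof
    assume x: "c x = x"
    obtain y where "c y \<noteq> y"
      using assms(4) by (metis ext id_apply)
    then have y: "y \<in> A" "c y \<noteq> y"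
      using assms(2) by (auto simp: permutes_def)
    obtain i where i: "x = (c ^^ i) y" "i < p"
      using orbit[OF y] \<open>x \<in> A\<close> by auto
    have "(c ^^ (p - i)) x = x"
      using x by (rule funpow_fixed)
    moreover have "(c ^^ (p - i)) x = y"
    proof -
      have "(c ^^ (p - i + i)) y = y"
        using i(2) assms(3) by (simp add: p_def)
      then show ?thesis
        by (simp only: funpow_add comp_apply i(1))
    qed
    ultimately show False
      using x y by simp
  qed
  show ?thesis
    using assms orbit moved by (simp add: prime_cycle_def p_def)
qed

section \<open>Orbit counting, Lagrange's and Cauchy's theorems\<close>

context permutation_group
begin

lemma inv_apply: "g \<in> G \<Longrightarrow> inv' g (g x) = x" "g \<in> G \<Longrightarrow> g (inv' g x) = x"
  by (rule permutes_inverses[OF permutes], assumption)+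

lemma inv_comp: "g \<in> G \<Longrightarrow> inv' g \<circ> g = id" "g \<in> G \<Longrightarrow> g \<circ> inv' g = id"
  by (rule permutes_inv_o[OF permutes], assumption)+

lemma inj_mem: "g \<in> G \<Longrightarrow> inj g"
  using permutes_inj[OF permutes] .

lemma image_Omega: "g \<in> G \<Longrightarrow> g ` \<Omega> = \<Omega>"
  using permutes_image[OF permutes] .

lemma funpow_mem: "g \<in> G \<Longrightarrow> g ^^ n \<in> G"
  by (induction n) (auto intro: id_mem comp_mem)

lemma finite_G: "finite G"
  using finite_permutations[OF fin] by (rule finite_subset[rotated]) (auto intro: permutes)

lemma subgroupI:
  assumes "H \<subseteq> G" "id \<in> H" "\<And>g h. g \<in> H \<Longrightarrow> h \<in> H \<Longrightarrow> g \<circ> h \<in> H"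
    and "\<And>g. g \<in> H \<Longrightarrow> inv' g \<in> H"
  shows "permutation_group \<Omega> H"
proof
  show "finite \<Omega>"
    by (rule fin)
  show "g permutes \<Omega>" if "g \<in> H" for g
    using permutes subsetD[OF assms(1) that] .
qed (rule assms; assumption?)+

lemma stabilizer_group: "permutation_group \<Omega> {g\<in>G. g ` A = A}"
proof (rule subgroupI)
  fix g assume g: "g \<in> {g\<in>G. g ` A = A}"
  then have "inv' g ` (g ` A) = A"
    unfolding image_image by (simp only: inv_apply mem_Collect_eq image_ident)
  then have "inv' g ` A = A"
    using g by simp
  then show "inv' g \<in> {g\<in>G. g ` A = A}"
    using g inv_mem by auto
next
  fix g h assume "g \<in> {g\<in>G. g ` A = A}" "h \<in> {g\<in>G. g ` A = A}"
  then show "g \<circ> h \<in> {g\<in>G. g ` A = A}"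
    using comp_mem[of g h] by (simp add: image_comp[symmetric] del: comp_apply)
qed (auto intro: id_mem)

lemma fixer_group: "permutation_group \<Omega> {g\<in>G. \<forall>x\<in>B. g x = x}"
proof (rule subgroupI)
  fix g assume g: "g \<in> {g\<in>G. \<forall>x\<in>B. g x = x}"
  then have "inv' g x = x" if "x \<in> B" for x
    using inv_apply(1)[of g x] that by auto
  then show "inv' g \<in> {g\<in>G. \<forall>x\<in>B. g x = x}"
    using g inv_mem by auto
qed (auto intro: id_mem comp_mem)

text \<open>The hypothesis says that \<open>\<alpha>\<close> behaves at \<open>x\<close> like an action of \<open>G\<close>.\<close>

lemma orbit_stabilizer:
  assumes \<alpha>: "\<And>g h. g \<in> G \<Longrightarrow> h \<in> G \<Longrightarrow> \<alpha> g x = \<alpha> h x \<longleftrightarrow> \<alpha> (inv' g \<circ> h) x = x"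
  shows "card G = card ((\<lambda>g. \<alpha> g x) ` G) * card {g\<in>G. \<alpha> g x = x}"
proof -
  have fibre: "card {h\<in>G. \<alpha> h x = \<alpha> g x} = card {g\<in>G. \<alpha> g x = x}" if g: "g \<in> G" for g
  proof -
    have "bij_betw ((\<circ>) (inv' g)) {h\<in>G. \<alpha> h x = \<alpha> g x} {g\<in>G. \<alpha> g x = x}"
    proof (rule bij_betw_byWitness[where f' = "(\<circ>) g"])
      show "\<forall>h\<in>{h\<in>G. \<alpha> h x = \<alpha> g x}. g \<circ> (inv' g \<circ> h) = h"
        by (simp add: comp_assoc[symmetric] inv_comp[OF g])
      show "\<forall>h\<in>{g\<in>G. \<alpha> g x = x}. inv' g \<circ> (g \<circ> h) = h"
        by (simp add: comp_assoc[symmetric] inv_comp[OF g])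
      show "(\<circ>) (inv' g) ` {h\<in>G. \<alpha> h x = \<alpha> g x} \<subseteq> {g\<in>G. \<alpha> g x = x}"
      proof
        fix k assume "k \<in> (\<circ>) (inv' g) ` {h\<in>G. \<alpha> h x = \<alpha> g x}"
        then obtain h where h: "h \<in> G" "\<alpha> h x = \<alpha> g x" "k = inv' g \<circ> h"
          by auto
        then show "k \<in> {g\<in>G. \<alpha> g x = x}"
          using \<alpha>[OF g h(1)] comp_mem[OF inv_mem[OF g] h(1)] by simp
      qed
      show "(\<circ>) g ` {g\<in>G. \<alpha> g x = x} \<subseteq> {h\<in>G. \<alpha> h x = \<alpha> g x}"
      proof
        fix k assume "k \<in> (\<circ>) g ` {g\<in>G. \<alpha> g x = x}"
        then obtain h where h: "h \<in> G" "\<alpha> h x = x" "k = g \<circ> h"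
          by auto
        moreover have "inv' g \<circ> (g \<circ> h) = h"
          by (simp add: comp_assoc[symmetric] inv_comp[OF g])
        ultimately show "k \<in> {h\<in>G. \<alpha> h x = \<alpha> g x}"
          using \<alpha>[OF g comp_mem[OF g h(1)]] comp_mem[OF g h(1)] by simp
      qed
    qed
    then show ?thesis
      by (rule bij_betw_same_card)
  qed
  have "card G = (\<Sum>y\<in>(\<lambda>g. \<alpha> g x) ` G. card {h\<in>G. \<alpha> h x = y})"
    using sum.image_gen[OF finite_G, of "\<lambda>_. 1 :: nat" "\<lambda>g. \<alpha> g x"] by simp
  also have "\<dots> = (\<Sum>y\<in>(\<lambda>g. \<alpha> g x) ` G. card {g\<in>G. \<alpha> g x = x})"
    by (intro sum.cong refl) (use fibre in auto)
  finally show ?thesis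
    by simp
qed

lemma card_orbit_times_point_stabilizer:
  "card G = card ((\<lambda>g. g x) ` G) * card {g\<in>G. g x = x}"
proof (rule orbit_stabilizer[where \<alpha> = "\<lambda>g x. g x"])
  fix g h assume g: "g \<in> G"
  have "inv' g (h x) = x \<longleftrightarrow> h x = g x"
    using inv_apply[OF g] by metis
  then show "g x = h x \<longleftrightarrow> (inv' g \<circ> h) x = x"
    by auto
qed

lemma image_eq_iff:
  assumes "g \<in> G"
  shows "g ` A = h ` A \<longleftrightarrow> (inv' g \<circ> h) ` A = A"
proof
  assume "g ` A = h ` A"
  then have "(inv' g \<circ> h) ` A = (inv' g \<circ> g) ` A"
    by (simp only: image_comp[symmetric])
  then show "(inv' g \<circ> h) ` A = A"
    by (simp only: inv_comp[OF assms] image_id id_apply)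
next
  assume "(inv' g \<circ> h) ` A = A"
  then have "g ` A = g ` ((inv' g \<circ> h) ` A)"
    by (rule arg_cong[symmetric])
  then have "g ` A = (g \<circ> inv' g) ` h ` A"
    by (simp only: image_comp comp_assoc)
  then show "g ` A = h ` A"
    by (simp only: inv_comp[OF assms] image_id id_apply)
qed

lemma card_orbit_times_set_stabilizer:
  "card G = card ((\<lambda>g. g ` A) ` G) * card {g\<in>G. g ` A = A}"
  by (rule orbit_stabilizer[where \<alpha> = "\<lambda>g A. g ` A"]) (rule image_eq_iff)

text \<open>Left cosets are images of \<open>H\<close> under composition, so that left translation
  acts on sets of maps and the orbit-stabilizer count applies to it.\<close>

lemma coset_eq_iff:
  fixes H :: "('a \<Rightarrow> 'a) set"
  shows "g \<in> G \<Longrightarrow> (\<circ>) g ` H = (\<circ>) h ` H \<longleftrightarrow> (\<circ>) (inv' g \<circ> h) ` H = H"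
proof -
  assume g: "g \<in> G"
  have comp: "(\<circ>) (f \<circ> f') ` H = (\<circ>) f ` (\<circ>) f' ` H" for f f' :: "'a \<Rightarrow> 'a"
    by (simp add: image_image comp_assoc)
  have "(\<circ>) g ` (\<circ>) (inv' g) ` K = K" "(\<circ>) (inv' g) ` (\<circ>) g ` K = K" for K :: "('a \<Rightarrow> 'a) set"
    by (simp_all add: image_image comp_assoc[symmetric] inv_comp[OF g])
  note cancel = this
  show ?thesis
    unfolding comp
  proof
    assume "(\<circ>) g ` H = (\<circ>) h ` H"
    then show "(\<circ>) (inv' g) ` (\<circ>) h ` H = H"
      using cancel(2)[of H] by simp
  next
    assume "(\<circ>) (inv' g) ` (\<circ>) h ` H = H"
    then show "(\<circ>) g ` H = (\<circ>) h ` H"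
      using cancel(1)[of "(\<circ>) h ` H"] by simp
  qed
qed

lemma coset_eq_subgroup_iff:
  assumes "permutation_group \<Omega> H" "g \<in> G"
  shows "(\<circ>) g ` H = H \<longleftrightarrow> g \<in> H"
proof
  interpret H: permutation_group \<Omega> H by fact
  show "g \<in> H" if "(\<circ>) g ` H = H"
    using that imageI[OF H.id_mem, of "(\<circ>) g"] by simp
  show "(\<circ>) g ` H = H" if g: "g \<in> H"
  proof
    show "(\<circ>) g ` H \<subseteq> H"
      using g H.comp_mem by blast
    show "H \<subseteq> (\<circ>) g ` H"
    proof
      fix h assume h: "h \<in> H"
      have "h = g \<circ> (inv' g \<circ> h)"
        by (simp add: comp_assoc[symmetric] H.inv_comp[OF g])
      then show "h \<in> (\<circ>) g ` H"
        using H.comp_mem[OF H.inv_mem[OF g] h] by (rule image_eqI)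
    qed
  qed
qed

text \<open>Lagrange's theorem: under left translation the orbit of \<open>H\<close> is its set of
  cosets and the stabilizer of \<open>H\<close> is \<open>H\<close> itself.\<close>

lemma card_cosets_times_subgroup:
  assumes "permutation_group \<Omega> H" "H \<subseteq> G"
  shows "card G = card ((\<lambda>g. (\<circ>) g ` H) ` G) * card H"
proof -
  have "card G = card ((\<lambda>g. (\<circ>) g ` H) ` G) * card {g\<in>G. (\<circ>) g ` H = H}"
    by (rule orbit_stabilizer[where \<alpha> = "\<lambda>g H. (\<circ>) g ` H"]) (rule coset_eq_iff)
  also have "{g\<in>G. (\<circ>) g ` H = H} = H"
    using coset_eq_subgroup_iff[OF assms(1)] assms(2) by auto
  finally show ?thesis .
qed

text \<open>Sylow's theorem with exponent 1 supplies a subgroup of order \<open>p\<close>; it has a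
  nontrivial element, whose \<open>p\<close>-th power is the identity.\<close>

lemma cauchy:
  assumes "prime p" "p dvd card G"
  shows "\<exists>g\<in>G. g \<noteq> id \<and> g ^^ p = id"
proof -
  define M :: "('a \<Rightarrow> 'a) monoid" where "M = \<lparr>carrier = G, mult = (\<circ>), one = id\<rparr>"
  interpret M: group M
  proof (rule groupI)
    fix g assume "g \<in> carrier M"
    then show "\<exists>h\<in>carrier M. h \<otimes>\<^bsub>M\<^esub> g = \<one>\<^bsub>M\<^esub>"
      using inv_mem inv_comp by (auto simp: M_def)
  qed (auto simp: M_def id_mem comp_mem comp_assoc)
  have pow: "g [^]\<^bsub>M\<^esub> n = g ^^ n" for g and n :: nat
    by (induction n) (simp_all add: M_def nat_pow_def funpow_Suc_right del: funpow.simps(2))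
  obtain H where H: "subgroup H M" "card H = p ^ 1"
    using sylow_thm[of p M 1 "card G div p"] assms finite_G M.group_axioms
    by (auto simp: M_def order_def)
  then have "1 < card H"
    using prime_gt_1_nat[OF assms(1)] by simp
  then have "\<not> H \<subseteq> {id}"
    using card_mono[of "{id}" H] by auto
  then obtain g where g: "g \<in> H" "g \<noteq> id"
    by blast
  have fin_H: "finite H"
    using \<open>1 < card H\<close> by (intro card_ge_0_finite) simp
  interpret H: group "M\<lparr>carrier := H\<rparr>"
    by (rule subgroup.subgroup_is_group[OF H(1) M.group_axioms])
  have "g [^]\<^bsub>M\<lparr>carrier := H\<rparr>\<^esub> p = \<one>\<^bsub>M\<^esub>"
    using group.pow_order_eq_1[OF H.is_group, of g] g fin_H H(2) by (simp add: order_def)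
  then have "g [^]\<^bsub>M\<^esub> p = id"
    using M.nat_pow_consistent[of g p H] by (simp add: M_def)
  then have "g ^^ p = id"
    by (simp only: pow)
  then show ?thesis
    using g subgroup.subset[OF H(1)] by (intro bexI[of _ g]) (auto simp: M_def)
qed

lemma image_diff_eq: "g \<in> G \<Longrightarrow> g ` A = A \<Longrightarrow> g ` (\<Omega> - A) = \<Omega> - A"
  by (simp add: image_set_diff[OF inj_mem] image_Omega)

lemma permutes_if_fixes: "g \<in> G \<Longrightarrow> (\<And>x. x \<in> \<Omega> - A \<Longrightarrow> g x = x) \<Longrightarrow> g permutes A"
  using permutes[of g] unfolding permutes_def by blast

lemma cycle_of_prime_length:
  assumes "prime (card A)" "A \<subseteq> \<Omega>" "card \<Omega> < 2 * card A"
    and g: "g \<in> G" "g ` A = A" "g ^^ card A = id" "g \<noteq> id"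
  shows "prime_cycle g A"
proof (rule prime_cycleI[OF assms(1)])
  have "card (\<Omega> - A) < card A"
    using assms(2,3) fin by (simp add: card_Diff_subset finite_subset)
  then have "g x = x" if "x \<in> \<Omega> - A" for x
    using fixed_point_of_prime_period[OF assms(1) _ _ that] g image_diff_eq[OF g(1,2)] fin by simp
  then show "g permutes A"
    by (rule permutes_if_fixes[OF g(1)])
qed fact+

end

section \<open>Three-cycles\<close>

abbreviation transp :: "'a \<Rightarrow> 'a \<Rightarrow> 'a \<Rightarrow> 'a" where
  "transp \<equiv> Transposition.transpose"

definition three_cycle :: "'a \<Rightarrow> 'a \<Rightarrow> 'a \<Rightarrow> 'a \<Rightarrow> 'a" where
  "three_cycle a b c = transp a b \<circ> transp b c"

lemma three_cycleI:
  assumes "distinct [a, b, c]" "g a = b" "g b = c" "g c = a"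
    and "\<And>x. x \<noteq> a \<Longrightarrow> x \<noteq> b \<Longrightarrow> x \<noteq> c \<Longrightarrow> g x = x"
  shows "g = three_cycle a b c"
proof
  fix x
  consider "x = a" | "x = b" | "x = c" | "x \<noteq> a" "x \<noteq> b" "x \<noteq> c"
    by blast
  then show "g x = three_cycle a b c x"
    using assms(1) by cases (auto simp: three_cycle_def transpose_def assms(2-5))
qed

lemma three_cycle_simps:
  assumes "distinct [a, b, c]"
  shows "three_cycle a b c a = b" "three_cycle a b c b = c" "three_cycle a b c c = a"
    "x \<noteq> a \<Longrightarrow> x \<noteq> b \<Longrightarrow> x \<noteq> c \<Longrightarrow> three_cycle a b c x = x"
  using assms by (auto simp: three_cycle_def transpose_def)

lemma three_cycle_rotate: "distinct [a, b, c] \<Longrightarrow> three_cycle b c a = three_cycle a b c"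
  by (rule three_cycleI) (auto simp: three_cycle_simps)

lemma three_cycle_square:
  "distinct [a, b, c] \<Longrightarrow> three_cycle a b c \<circ> three_cycle a b c = three_cycle a c b"
  by (rule three_cycleI) (auto simp: three_cycle_simps)

lemma three_cycle_permutes:
  "a \<in> A \<Longrightarrow> b \<in> A \<Longrightarrow> c \<in> A \<Longrightarrow> three_cycle a b c permutes A"
  unfolding three_cycle_def by (intro permutes_compose permutes_swap_id)

lemma evenperm_three_cycle: "distinct [a, b, c] \<Longrightarrow> evenperm (three_cycle a b c)"
  by (simp add: three_cycle_def evenperm_comp permutation_swap_id evenperm_swap)

text \<open>Conjugation is written as an intertwining relation, which needs only injectivity;
  \<open>conj_mem\<close> converts such a relation into membership.\<close>

lemma conj_three_cycle:
  assumes "inj g" "distinct [a, b, c]"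
  shows "g \<circ> three_cycle a b c = three_cycle (g a) (g b) (g c) \<circ> g"
  using assms by (auto simp: fun_eq_iff three_cycle_def transpose_def inj_eq)

lemma conj_transpose: "inj g \<Longrightarrow> g \<circ> transp a b = transp (g a) (g b) \<circ> g"
  by (auto simp: fun_eq_iff transpose_def inj_eq)

context permutation_group
begin

lemma eq_conj: "g \<in> G \<Longrightarrow> g \<circ> h = k \<circ> g \<Longrightarrow> k = g \<circ> h \<circ> inv' g"
  by (simp add: comp_assoc inv_comp(2))

lemma conj_mem: "g \<in> G \<Longrightarrow> h \<in> G \<Longrightarrow> g \<circ> h = k \<circ> g \<Longrightarrow> k \<in> G"
  unfolding eq_conj[of g h k] by (intro comp_mem inv_mem)

lemma three_cycle_conj_mem:
  "g \<in> G \<Longrightarrow> distinct [a, b, c] \<Longrightarrow> three_cycle a b c \<in> G \<Longrightarrow> three_cycle (g a) (g b) (g c) \<in> G"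
  by (rule conj_mem[OF _ _ conj_three_cycle[OF inj_mem]])

text \<open>The orderings of three points name only two permutations, the cycle and its
  square.\<close>

lemma three_cycle_mem_perm:
  assumes "distinct [a, b, c]" "three_cycle a b c \<in> G"
  shows "three_cycle b c a \<in> G" "three_cycle c a b \<in> G"
    "three_cycle a c b \<in> G" "three_cycle c b a \<in> G" "three_cycle b a c \<in> G"
proof -
  have rot: "three_cycle y z x \<in> G" if "distinct [x, y, z]" "three_cycle x y z \<in> G" for x y z
    using that(2) unfolding three_cycle_rotate[OF that(1)] .
  show 1: "three_cycle b c a \<in> G"
    using assms by (rule rot)
  show "three_cycle c a b \<in> G"
    using 1 assms(1) by (intro rot[of b c a]) auto
  show 3: "three_cycle a c b \<in> G"
    using comp_mem[OF assms(2,2)] by (simp only: three_cycle_square[OF assms(1)])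
  show 4: "three_cycle c b a \<in> G"
    using 3 assms(1) by (intro rot[of a c b]) auto
  show "three_cycle b a c \<in> G"
    using 4 assms(1) by (intro rot[of c b a]) auto
qed

text \<open>Induction on the number of moved points. If \<open>p\<close> moves \<open>x\<close> to
  \<open>y\<close> and moves a third point \<open>z\<close>, composing with the cycle
  \<open>y, x, z\<close> makes \<open>x\<close> fixed and moves no new point. If only
  \<open>x\<close> and \<open>y\<close> are moved, \<open>p\<close> is a transposition and not
  even.\<close>

lemma alt_set_subset:
  assumes "\<And>a b c. distinct [a, b, c] \<Longrightarrow> {a, b, c} \<subseteq> \<Omega> \<Longrightarrow> three_cycle a b c \<in> G"
  shows "alt_set \<Omega> \<subseteq> G"
proof
  fix p assume "p \<in> alt_set \<Omega>"
  then have "p permutes \<Omega>" "evenperm p"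
    by (auto simp: alt_set_def)
  then show "p \<in> G"
  proof (induction "card {x. p x \<noteq> x}" arbitrary: p rule: less_induct)
    case less
    have supp: "{x. p x \<noteq> x} \<subseteq> \<Omega>"
      using less.prems(1) by (auto simp: permutes_def)
    have inj: "p u = p v \<longleftrightarrow> u = v" for u v
      using permutes_inj[OF less.prems(1)] by (rule inj_eq)
    show ?case
    proof (cases "p = id")
      case True
      then show ?thesis
        using id_mem by simp
    next
      case False
      then obtain x where x: "p x \<noteq> x"
        by (auto simp: fun_eq_iff)
      define y where "y = p x"
      have y: "p y \<noteq> y" "x \<noteq> y"
        using x inj by (auto simp: y_def)
      show ?thesis
      proof (cases "\<exists>z. p z \<noteq> z \<and> z \<noteq> x \<and> z \<noteq> y")
        case True
        then obtain z where z: "p z \<noteq> z" "z \<noteq> x" "z \<noteq> y"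
          by blast
        have d: "distinct [y, x, z]"
          using y z by auto
        define t where "t = three_cycle y x z"
        note t_simps = three_cycle_simps[OF d, folded t_def]
        have mem: "{y, x, z} \<subseteq> \<Omega>"
          using supp x y z by auto
        then have t: "t \<in> G"
          unfolding t_def by (rule assms[OF d])
        have "t \<circ> p \<in> G"
        proof (rule less.hyps)
          have "{w. (t \<circ> p) w \<noteq> w} \<subset> {w. p w \<noteq> w}"
          proof (rule psubsetI)
            show "{w. (t \<circ> p) w \<noteq> w} \<subseteq> {w. p w \<noteq> w}"
            proof (intro subsetI CollectI notI)
              fix w assume *: "w \<in> {w. (t \<circ> p) w \<noteq> w}" "p w = w"
              then have "w \<noteq> x" "w \<noteq> y" "w \<noteq> z"
                using x y z by auto
              then show False
                using * t_simps(4) by simp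
            qed
            have "x \<notin> {w. (t \<circ> p) w \<noteq> w}"
              using t_simps(1) by (simp add: y_def)
            then show "{w. (t \<circ> p) w \<noteq> w} \<noteq> {w. p w \<noteq> w}"
              using x by blast
          qed
          then show "card {w. (t \<circ> p) w \<noteq> w} < card {w. p w \<noteq> w}"
            using supp fin by (intro psubset_card_mono finite_subset[OF supp])
          show "t \<circ> p permutes \<Omega>"
            using less.prems(1) permutes[OF t] by (rule permutes_compose)
          have "permutation t" "permutation p"
            using permutes[OF t] less.prems(1) fin by (auto simp: permutation_permutes)
          then show "evenperm (t \<circ> p)"
            using less.prems(2) evenperm_three_cycle[OF d] by (simp add: evenperm_comp t_def)
        qed
        then have "inv' t \<circ> (t \<circ> p) \<in> G"
          using inv_mem[OF t] comp_mem by blast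
        then show ?thesis
          by (simp add: comp_assoc[symmetric] inv_comp[OF t])
      next
        case False
        then have rest: "p w = w" if "w \<noteq> x" "w \<noteq> y" for w
          using that by blast
        have "p y = x"
          using rest[of "p y"] inj y by (metis y_def)
        then have "p = transp x y"
          using rest by (auto simp: fun_eq_iff transpose_def y_def)
        then show ?thesis
          using less.prems(2) y(2) by (simp add: evenperm_swap)
      qed
    qed
  qed
qed

lemma eq_symmetric_if_odd:
  assumes "alt_set \<Omega> \<subseteq> G" "g \<in> G" "\<not> evenperm g"
  shows "G = {p. p permutes \<Omega>}"
proof (intro equalityI subsetI CollectI)
  fix p assume "p \<in> {p. p permutes \<Omega>}"
  then have p: "p permutes \<Omega>"
    by simp
  show "p \<in> G"
  proof (cases "evenperm p")
    case True
    then show ?thesis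
      using assms(1) p by (auto simp: alt_set_def)
  next
    case False
    have "permutation p" "permutation g"
      using p permutes[OF assms(2)] fin by (auto simp: permutation_permutes)
    then have "evenperm (p \<circ> g)"
      using False assms(3) by (simp add: evenperm_comp)
    moreover have "p \<circ> g permutes \<Omega>"
      using permutes[OF assms(2)] p by (rule permutes_compose)
    ultimately have "p \<circ> g \<in> G"
      using assms(1) by (auto simp: alt_set_def)
    then have "p \<circ> g \<circ> inv' g \<in> G"
      using inv_mem[OF assms(2)] comp_mem by blast
    then show ?thesis
      by (simp add: comp_assoc inv_comp[OF assms(2)])
  qed
qed (rule permutes)

lemma eq_alt_or_symmetric:
  assumes "alt_set \<Omega> \<subseteq> G"
  shows "G = {p. p permutes \<Omega>} \<or> G = alt_set \<Omega>"
proof (cases "\<exists>g\<in>G. \<not> evenperm g")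
  case True
  then show ?thesis
    using eq_symmetric_if_odd[OF assms] by blast
next
  case False
  then have "G \<subseteq> alt_set \<Omega>"
    using permutes by (auto simp: alt_set_def)
  then show ?thesis
    using assms by blast
qed

end

section \<open>Consequences of supertransitivity and the small degrees\<close>

locale supertransitive_group = permutation_group +
  assumes super: "supertransitive \<Omega> G"
begin

lemma stabilizer_transitive:
  assumes "A \<subseteq> \<Omega>" "x \<in> A" "y \<in> A"
  obtains g where "g \<in> G" "g ` A = A" "g x = y"
proof -
  have "\<exists>g\<in>set_stabilizer G A. g x = y"
    using super assms by (simp add: supertransitive_def)
  then obtain g where g: "g \<in> set_stabilizer G A" "g x = y"
    by (rule bexE)
  then show ?thesis
    using that[of g] set_stabilizer_image[OF g(1) assms(1)] by (simp add: set_stabilizer_def)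
qed

text \<open>An exchange argument: an element of the stabilizer of \<open>insert b A\<close> that
  moves \<open>b\<close> to \<open>a\<close> maps \<open>A\<close> onto \<open>A\<close> with
  \<open>a\<close> replaced by \<open>b\<close>. With \<open>a\<close> outside and \<open>b\<close>
  inside \<open>B\<close> this brings \<open>A\<close> closer to \<open>B\<close>.\<close>

lemma homogeneous:
  assumes "A \<subseteq> \<Omega>" "B \<subseteq> \<Omega>" "card A = card B"
  obtains g where "g \<in> G" "g ` A = B"
proof -
  have "\<exists>g\<in>G. g ` A = B"
    using assms
  proof (induction "card (A - B)" arbitrary: A rule: less_induct)
    case less
    have finA: "finite A" "finite B"
      using less.prems fin finite_subset by blast+
    show ?case
    proof (cases "A = B")
      case True
      then show ?thesis
        using id_mem by (intro bexI[of _ id]) auto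
    next
      case False
      then have "\<not> A \<subseteq> B" "\<not> B \<subseteq> A"
        using card_subset_eq[OF finA(2), of A] card_subset_eq[OF finA(1), of B] less.prems(3) by auto
      then obtain a b where a: "a \<in> A" "a \<notin> B" and b: "b \<in> B" "b \<notin> A"
        by blast
      obtain g where g: "g \<in> G" "g ` insert b A = insert b A" "g b = a"
        by (rule stabilizer_transitive[of "insert b A" b a]) (use less.prems a b in auto)
      have "g ` A = g ` (insert b A - {b})"
        using b by simp
      also have "\<dots> = insert b A - {a}"
        using g(2,3) by (simp only: image_set_diff[OF inj_mem[OF g(1)]]) simp
      finally have gA: "g ` A = insert b A - {a}" .
      have "\<exists>h\<in>G. h ` (g ` A) = B"
      proof (rule less.hyps)
        have "g ` A - B = (A - B) - {a}"
          using gA b by auto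
        then show "card (g ` A - B) < card (A - B)"
          using a finA by (simp only:) (intro card_Diff1_less; simp)
        show "g ` A \<subseteq> \<Omega>"
          using gA less.prems b by auto
        show "card (g ` A) = card B"
          using less.prems(3) by (simp add: card_image inj_on_subset[OF inj_mem[OF g(1)]])
      qed fact
      then obtain h where "h \<in> G" "h ` g ` A = B"
        by blast
      then show ?thesis
        using comp_mem[of h g] g(1) by (intro bexI[of _ "h \<circ> g"]) (auto simp: image_comp)
    qed
  qed
  then show ?thesis
    using that by blast
qed

lemma contains_alternating:
  assumes "distinct [a, b, c]" "{a, b, c} \<subseteq> \<Omega>" "three_cycle a b c \<in> G"
  shows "alt_set \<Omega> \<subseteq> G"
proof (rule alt_set_subset)
  fix x y z assume xyz: "distinct [x, y, z]" "{x, y, z} \<subseteq> \<Omega>"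
  obtain g where g: "g \<in> G" "g ` {a, b, c} = {x, y, z}"
    by (rule homogeneous[OF assms(2) xyz(2)]) (use assms(1) xyz(1) in auto)
  have t: "three_cycle (g a) (g b) (g c) \<in> G"
    using g(1) assms(1,3) by (rule three_cycle_conj_mem)
  have d: "distinct [g a, g b, g c]"
    using assms(1) inj_mem[OF g(1)] by (auto simp: inj_eq)
  have "{g a, g b, g c} = {x, y, z}"
    using g(2) by simp
  \<comment> \<open>The image is known only as a set, so any of the six orderings may occur; the
    group contains the cycle for each of them.\<close>
  then have "(x, y, z) \<in> {(g a, g b, g c), (g b, g c, g a), (g c, g a, g b),
      (g a, g c, g b), (g c, g b, g a), (g b, g a, g c)}"
    using d xyz(1) by (simp add: set_eq_iff) metis
  then show "three_cycle x y z \<in> G"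
    using three_cycle_mem_perm[OF d t] t by auto
qed

text \<open>An element swapping \<open>a\<close> and \<open>b\<close> has at most one other point to
  act on. This supplies odd elements in degree 3, which is why the alternating group appears only
  above 3.\<close>

lemma transposition_if_card_le:
  assumes "card \<Omega> \<le> 3" "a \<in> \<Omega>" "b \<in> \<Omega>" "a \<noteq> b"
  shows "transp a b \<in> G"
proof -
  obtain g where g: "g \<in> G" "g ` {a, b} = {a, b}" "g a = b"
    by (rule stabilizer_transitive[of "{a, b}" a b]) (use assms in auto)
  have "g b = a"
  proof -
    have "g b \<in> {a, b}"
      using g(2) by blast
    moreover have "g b \<noteq> g a"
      using assms(4) inj_mem[OF g(1)] by (simp add: inj_eq)
    ultimately show ?thesis
      using g(3) by auto
  qed
  have "card (\<Omega> - {a, b}) \<le> 1"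
    using assms fin by (subst card_Diff_subset) auto
  have "g x = x" if "x \<noteq> a" "x \<noteq> b" for x
  proof (cases "x \<in> \<Omega>")
    case True
    then have "g x \<in> \<Omega> - {a, b}" "x \<in> \<Omega> - {a, b}"
      using that image_diff_eq[OF g(1,2)] by blast+
    then show ?thesis
      using \<open>card (\<Omega> - {a, b}) \<le> 1\<close> fin by (simp only: card_le_Suc0_iff_eq[OF finite_Diff[OF fin]] One_nat_def)
  next
    case False
    then show ?thesis
      using permutes[OF g(1)] by (simp add: permutes_def)
  qed
  then have "g = transp a b"
    using g(3) \<open>g b = a\<close> by (auto simp: fun_eq_iff transpose_def)
  then show ?thesis
    using g(1) by simp
qed

lemma classification_if_three_cycle:
  assumes "distinct [a, b, c]" "{a, b, c} \<subseteq> \<Omega>" "three_cycle a b c \<in> G"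
  shows "G = {p. p permutes \<Omega>} \<or> card \<Omega> > 3 \<and> G = alt_set \<Omega>"
proof (cases "card \<Omega> \<le> 3")
  case True
  have "transp a b \<in> G" "\<not> evenperm (transp a b)"
    using transposition_if_card_le[OF True, of a b] assms by (auto simp: evenperm_swap)
  then show ?thesis
    using eq_symmetric_if_odd[OF contains_alternating[OF assms]] by blast
next
  case False
  then show ?thesis
    using eq_alt_or_symmetric[OF contains_alternating[OF assms]] by auto
qed

lemma classification_if_card_le_2:
  assumes "card \<Omega> \<le> 2"
  shows "G = {p. p permutes \<Omega>}"
proof (intro equalityI subsetI CollectI)
  fix p assume "p \<in> {p. p permutes \<Omega>}"
  then have p: "p permutes \<Omega>"
    by simp
  consider "card \<Omega> \<le> 1" | "card \<Omega> = 2"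
    using assms by linarith
  then show "p \<in> G"
  proof cases
    case 1
    then have "p x = x" for x
      using p card_le_Suc0_iff_eq[OF fin] permutes_in_image[OF p, of x]
      by (cases "x \<in> \<Omega>") (auto simp: permutes_def)
    then show ?thesis
      using id_mem by (simp add: id_def ext[of p "\<lambda>x. x"])
  next
    case 2
    then obtain a b where ab: "\<Omega> = {a, b}" "a \<noteq> b"
      by (auto simp: card_2_iff)
    then show ?thesis
      using p transposition_if_card_le[of a b] id_mem by (auto simp: permutes_doubleton_iff)
  qed
qed (rule permutes)

lemma exists_prime_cycle:
  assumes "A \<subseteq> \<Omega>" "prime (card A)" "card \<Omega> < 2 * card A"
  obtains c where "c \<in> G" "prime_cycle c A"
proof -
  interpret H: permutation_group \<Omega> "{g\<in>G. g ` A = A}"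
    by (rule stabilizer_group)
  obtain x where x: "x \<in> A"
    using assms(2) by (cases "A = {}") auto
  have "(\<lambda>g. g x) ` {g\<in>G. g ` A = A} = A"
  proof (intro equalityI subsetI)
    fix y assume "y \<in> A"
    obtain g where "g \<in> G" "g ` A = A" "g x = y"
      by (rule stabilizer_transitive[OF assms(1) x \<open>y \<in> A\<close>])
    then show "y \<in> (\<lambda>g. g x) ` {g\<in>G. g ` A = A}"
      by (intro image_eqI[of _ _ g]) simp_all
  qed (use x in auto)
  then have "card A dvd card {g\<in>G. g ` A = A}"
    unfolding H.card_orbit_times_point_stabilizer[of x] by simp
  from H.cauchy[OF assms(2) this]
  obtain c where c: "c \<in> G" "c ` A = A" "c \<noteq> id" "c ^^ card A = id"
    by (elim bexE conjE CollectE)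
  show ?thesis
    using that[OF c(1) cycle_of_prime_length[OF assms(2,1,3) c(1,2,4,3)]] .
qed

lemma classification_if_card_3_to_5:
  assumes "3 \<le> card \<Omega>" "card \<Omega> \<le> 5"
  shows "G = {p. p permutes \<Omega>} \<or> card \<Omega> > 3 \<and> G = alt_set \<Omega>"
proof -
  obtain A where A: "A \<subseteq> \<Omega>" "card A = 3"
    using obtain_subset_with_card_n[OF assms(1)] by metis
  obtain c where c: "c \<in> G" "prime_cycle c A"
    by (rule exists_prime_cycle[OF A(1)]) (use A(2) assms in auto)
  obtain x where x: "x \<in> A"
    using A(2) by fastforce
  have "A = (\<lambda>i. (c ^^ i) x) ` {..<3}" "c permutes A" "c ^^ 3 = id"
    using c(2) x A(2) by (auto simp: prime_cycle_def)
  then have A': "A = {x, c x, c (c x)}" "c (c (c x)) = x"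
    by (auto simp: lessThan_nat_numeral numeral_3_eq_3 lessThan_Suc fun_eq_iff)
  then have d: "distinct [x, c x, c (c x)]"
    using A(2) by (auto simp: card_insert_if split: if_splits)
  have "c = three_cycle x (c x) (c (c x))"
  proof (rule three_cycleI[OF d])
    fix y assume "y \<noteq> x" "y \<noteq> c x" "y \<noteq> c (c x)"
    then have "y \<notin> A"
      using A'(1) by blast
    then show "c y = y"
      by (rule permutes_not_in[OF \<open>c permutes A\<close>])
  qed (simp_all add: A'(2))
  then show ?thesis
    using classification_if_three_cycle[OF d] A A' c(1) by auto
qed

end

section \<open>Degree at least eight\<close>

context permutation_group
begin

lemma funpow_conj: "g \<in> G \<Longrightarrow> (g \<circ> c \<circ> inv' g) ^^ n = g \<circ> c ^^ n \<circ> inv' g"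
proof (induction n)
  case 0
  then show ?case
    by (simp add: inv_comp(2))
next
  case (Suc n)
  have "(g \<circ> c \<circ> inv' g) ^^ Suc n = g \<circ> c \<circ> (inv' g \<circ> g) \<circ> c ^^ n \<circ> inv' g"
    using Suc by (simp only: funpow.simps(2) comp_assoc)
  also have "\<dots> = g \<circ> c ^^ Suc n \<circ> inv' g"
    by (simp only: inv_comp(1)[OF Suc.prems] funpow.simps(2) comp_id comp_assoc)
  finally show ?case .
qed

lemma cyclic_group:
  assumes "c \<in> G" "c ^^ p = id" "0 < p"
  shows "permutation_group \<Omega> (range (\<lambda>i. c ^^ i))"
proof (rule subgroupI)
  show "range (\<lambda>i. c ^^ i) \<subseteq> G"
    using funpow_mem[OF assms(1)] by blast
  show "id \<in> range (\<lambda>i. c ^^ i)"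
    by (rule range_eqI[of _ _ 0]) simp
  show "g \<circ> h \<in> range (\<lambda>i. c ^^ i)" if "g \<in> range (\<lambda>i. c ^^ i)" "h \<in> range (\<lambda>i. c ^^ i)" for g h
    using that by (auto simp: funpow_add[symmetric])
  show "inv' g \<in> range (\<lambda>i. c ^^ i)" if g: "g \<in> range (\<lambda>i. c ^^ i)" for g
  proof -
    obtain i where i: "g = c ^^ i"
      using g by blast
    have "c ^^ (p * i) = id"
      by (simp add: funpow_mult[symmetric] assms(2))
    moreover have "p * i = i * (p - 1) + i" "p * i = i + i * (p - 1)"
      using assms(3) by (cases p; simp)+
    ultimately have "c ^^ (i * (p - 1)) \<circ> c ^^ i = id" "c ^^ i \<circ> c ^^ (i * (p - 1)) = id"
      by (simp_all only: funpow_add[symmetric])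
    then have "inv' g = c ^^ (i * (p - 1))"
      unfolding i by (intro inv_unique_comp)
    then show ?thesis
      by blast
  qed
qed

text \<open>The powers of \<open>c\<close> act freely on \<open>A\<close>, so the cyclic group they
  form has exactly \<open>card A\<close> elements.\<close>

lemma prime_cycle_funpow_fixed:
  assumes "prime_cycle c A" "x \<in> A" "(c ^^ i) x = x"
  shows "c ^^ i = id"
proof -
  define p where "p = card A"
  have p: "prime p" "c ^^ p = id" "c x \<noteq> x"
    using assms(1,2) by (auto simp: prime_cycle_def p_def)
  have "p dvd i"
  proof (rule ccontr)
    assume "\<not> p dvd i"
    then have "coprime p i"
      by (rule prime_imp_coprime[OF p(1)])
    moreover have "(c ^^ p) x = x"
      by (simp add: p(2))
    ultimately show False
      using fixed_point_if_coprime_periods[of p c x i] assms(3) p(3) by blast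
  qed
  then obtain k where "i = p * k"
    by (auto elim: dvdE)
  then show ?thesis
    by (simp add: funpow_mult[symmetric] p(2))
qed

text \<open>
  A Frattini argument: the conjugates of \<open>c\<close> under the pointwise stabilizer \<open>K\<close> of the complement
  of \<open>A\<close> generate Sylow subgroups of \<open>K\<close>, so \<open>g\<close> can be corrected by an element of \<open>K\<close> to
  normalize \<open>c\<close>.
\<close>

lemma normalizer_lift:
  assumes c: "c \<in> G" "prime_cycle c A" and A: "A \<subseteq> \<Omega>" and g: "g \<in> G" "g ` A = A"
  obtains h i where "h \<in> G" "h ` A = A" "\<forall>b\<in>\<Omega> - A. h b = g b" "h \<circ> c = c ^^ i \<circ> h"
proof -
  define p where "p = card A"
  have p: "prime p" "c ^^ p = id" "c permutes A"
    and orbit: "\<And>x. x \<in> A \<Longrightarrow> A = (\<lambda>i. (c ^^ i) x) ` {..<p}"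
    using c(2) by (auto simp: prime_cycle_def p_def)
  have p0: "0 < p"
    using p(1) by (rule prime_gt_0_nat)
  define K where "K = {k\<in>G. \<forall>x\<in>\<Omega> - A. k x = x}"
  interpret K: permutation_group \<Omega> K
    unfolding K_def by (rule fixer_group)
  have cK: "c \<in> K"
    using c(1) permutes_not_in[OF p(3)] by (simp add: K_def)
  define P where "P = range (\<lambda>i. c ^^ i)"
  interpret P: permutation_group \<Omega> P
    unfolding P_def by (rule cyclic_group[OF c(1) p(2) p0])
  have PK: "P \<subseteq> K"
    unfolding P_def using K.funpow_mem[OF cK] by blast
  have KA: "k permutes A" if "k \<in> K" for k
    using that by (intro permutes_if_fixes) (auto simp: K_def)
  obtain x where x: "x \<in> A"
    using p(1) by (cases "A = {}") (auto simp: p_def)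
  have orbit_eq: "(\<lambda>k. k x) ` H = A" if H: "P \<subseteq> H" "H \<subseteq> K" for H
  proof (intro equalityI subsetI)
    fix y assume "y \<in> A"
    then obtain i where "y = (c ^^ i) x"
      using orbit[OF x] by auto
    then show "y \<in> (\<lambda>k. k x) ` H"
      using H(1) by (auto simp: P_def)
  next
    fix y assume "y \<in> (\<lambda>k. k x) ` H"
    then obtain k where "k \<in> K" "y = k x"
      using H(2) by blast
    then show "y \<in> A"
      using x permutes_in_image[OF KA] by simp
  qed
  have "{q\<in>P. q x = x} = {id}"
    using prime_cycle_funpow_fixed[OF c(2) x] P.id_mem by (auto simp: P_def)
  then have card_P: "card P = p"
    using P.card_orbit_times_point_stabilizer[of x] orbit_eq[OF order_refl PK] by (simp add: p_def)
  define L where "L = {k\<in>K. \<forall>y\<in>{x}. k y = y}"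
  interpret L: permutation_group \<Omega> L
    unfolding L_def by (rule K.fixer_group)
  \<comment> \<open>\<open>L\<close> acts on the \<open>p - 1\<close> points of \<open>A\<close>
    other than \<open>x\<close>, too few for an element of order \<open>p\<close>; so
    \<open>p\<close> divides the order of \<open>K\<close> exactly once.\<close>
  have "\<not> p dvd card L"
  proof
    assume "p dvd card L"
    then obtain l where l: "l \<in> L" "l \<noteq> id" "l ^^ p = id"
      using L.cauchy[OF p(1)] by blast
    have lA: "l permutes A"
      using l(1) KA by (simp add: L_def)
    have lx: "l x = x"
      using l(1) by (simp add: L_def)
    have "l y = y" for y
    proof (cases "y \<in> A - {x}")
      case True
      have "l ` (A - {x}) = l ` A - l ` {x}"
        by (rule image_set_diff[OF permutes_inj[OF lA]])
      then have "l ` (A - {x}) \<subseteq> A - {x}"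
        using permutes_image[OF lA] lx by simp
      moreover have "card (A - {x}) < p"
        using x p0 by (simp add: p_def card_gt_0_iff)
      moreover have "(l ^^ p) y = y" "finite (A - {x})"
        using l(3) finite_subset[OF A fin] by simp_all
      ultimately show ?thesis
        using True by (intro fixed_point_of_prime_period[OF p(1), of l y "A - {x}"])
    next
      case False
      then show ?thesis
        using lx permutes_not_in[OF lA] by blast
    qed
    then show False
      using l(2) by (simp add: fun_eq_iff)
  qed
  \<comment> \<open>There are \<open>card L\<close> cosets of \<open>P\<close>, a number prime to
    \<open>p\<close>. The conjugate \<open>d\<close> of \<open>c\<close> permutes them and its
    \<open>p\<close>-th power is the identity, so it fixes one of them: conjugacy of Sylow subgroups
    by counting.\<close>
  define X where "X = (\<lambda>k. (\<circ>) k ` P) ` K"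
  have "card X * p = card L * p"
    using K.card_cosets_times_subgroup[OF P.permutation_group_axioms PK]
      K.card_orbit_times_point_stabilizer[of x] orbit_eq[OF PK order_refl] card_P
    by (auto simp: X_def L_def p_def)
  then have "\<not> p dvd card X"
    using \<open>\<not> p dvd card L\<close> p0 by simp
  define d where "d = g \<circ> c \<circ> inv' g"
  have "d \<in> G"
    unfolding d_def by (intro comp_mem inv_mem g c)
  have dK: "d \<in> K"
  proof -
    have "d b = b" if b: "b \<in> \<Omega> - A" for b
    proof -
      have "b \<in> g ` (\<Omega> - A)"
        using b image_diff_eq[OF g] by simp
      then obtain b' where "b' \<in> \<Omega> - A" "b = g b'"
        by blast
      then show ?thesis
        using permutes_not_in[OF p(3), of b'] by (simp add: d_def inv_apply(1)[OF g(1)])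
    qed
    then show ?thesis
      using \<open>d \<in> G\<close> by (simp add: K_def)
  qed
  have comp: "(\<circ>) f ` (\<circ>) f' ` P = (\<circ>) (f \<circ> f') ` P" for f f' :: "'a \<Rightarrow> 'a"
    by (simp add: image_image comp_assoc)
  have "\<exists>Y\<in>X. (\<circ>) d ` Y = Y"
  proof (rule ccontr)
    assume no: "\<not> ?thesis"
    have "p dvd card X"
    proof (rule prime_dvd_card_if_no_fixed_point[OF p(1), of X "image ((\<circ>) d)"])
      show "finite X"
        unfolding X_def by (rule finite_imageI[OF K.finite_G])
      show "(`) ((\<circ>) d) ` X \<subseteq> X"
        using K.comp_mem[OF dK] by (auto simp: X_def comp simp del: image_comp)
      have "((`) ((\<circ>) d) ^^ n) Y = (\<circ>) (d ^^ n) ` Y" for n and Y :: "('a \<Rightarrow> 'a) set"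
        by (induction n) (simp_all add: image_image comp_assoc)
      moreover have "d ^^ p = id"
        by (simp add: d_def funpow_conj[OF g(1)] p(2) inv_comp(2)[OF g(1)])
      ultimately show "((`) ((\<circ>) d) ^^ p) Y = Y" if "Y \<in> X" for Y
        by (simp only:) (simp add: image_def)
    qed (use no in blast)
    then show False
      using \<open>\<not> p dvd card X\<close> by blast
  qed
  then obtain k where k: "k \<in> K" "(\<circ>) d ` (\<circ>) k ` P = (\<circ>) k ` P"
    by (auto simp: X_def simp del: image_comp)
  then have "(\<circ>) (inv' k \<circ> (d \<circ> k)) ` P = P"
    using K.coset_eq_iff[OF k(1), of P "d \<circ> k"] by (simp add: comp)
  moreover have "inv' k \<circ> (d \<circ> k) \<in> K"
    by (intro K.comp_mem K.inv_mem k dK)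
  ultimately have "inv' k \<circ> (d \<circ> k) \<in> P"
    using K.coset_eq_subgroup_iff[OF P.permutation_group_axioms] by blast
  then obtain i where i: "inv' k \<circ> (d \<circ> k) = c ^^ i"
    by (auto simp: P_def)
  \<comment> \<open>\<open>k\<close> is the identity off \<open>A\<close>, so \<open>h\<close>
    agrees with \<open>g\<close> there. Conjugation of \<open>c\<close> by \<open>g\<close> gives
    \<open>d\<close>; the correction by \<open>k\<close> turns this into a power of
    \<open>c\<close>.\<close>
  define h where "h = inv' k \<circ> g"
  show thesis
  proof (rule that[of h i])
    have kinv: "inv' k \<in> K"
      by (rule K.inv_mem[OF k(1)])
    then have kG: "inv' k \<in> G" "k \<in> G"
      using k(1) by (simp_all add: K_def)
    show "h \<in> G"
      unfolding h_def by (intro comp_mem kG g)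
    show "h ` A = A"
      unfolding h_def image_comp[symmetric] g(2) by (rule permutes_image[OF KA[OF kinv]])
    show "\<forall>b\<in>\<Omega> - A. h b = g b"
    proof
      fix b assume "b \<in> \<Omega> - A"
      then have "g b \<in> \<Omega> - A"
        using image_diff_eq[OF g] by blast
      then show "h b = g b"
        using kinv by (simp add: h_def K_def)
    qed
    have "c ^^ i \<circ> h = inv' k \<circ> g \<circ> c \<circ> (inv' g \<circ> (k \<circ> inv' k) \<circ> g)"
      by (simp only: i[symmetric] h_def d_def comp_assoc)
    also have "\<dots> = h \<circ> c"
      by (simp only: inv_comp(2)[OF kG(2)] inv_comp(1)[OF g(1)] comp_id h_def)
    finally show "h \<circ> c = c ^^ i \<circ> h"
      by simp
  qed
qed

lemma funpow_commute_funpow: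
  assumes "g \<circ> c = c ^^ i \<circ> g"
  shows "g \<circ> c ^^ n = c ^^ (i * n) \<circ> g"
proof (induction n)
  case (Suc n)
  have "g \<circ> c ^^ Suc n = (g \<circ> c ^^ n) \<circ> c"
    by (simp only: funpow_Suc_right comp_assoc)
  also have "\<dots> = c ^^ (i * n) \<circ> (g \<circ> c)"
    by (simp only: Suc comp_assoc)
  also have "\<dots> = c ^^ (i * n + i) \<circ> g"
    by (simp only: assms funpow_add comp_assoc)
  finally show ?case
    by (simp only: mult_Suc_right add.commute)
qed simp

text \<open>
  If \<open>u\<close> and \<open>w\<close> normalize \<open>c\<close>, their commutator centralizes \<open>c\<close>; so it acts on \<open>A\<close> as a power of
  \<open>c\<close>, and its \<open>p\<close>-th power fixes \<open>A\<close> pointwise.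
\<close>

lemma three_cycle_from_transpositions:
  assumes c: "c \<in> G" "prime_cycle c A" and A: "A \<subseteq> \<Omega>" and p: "card A \<noteq> 3"
    and d: "distinct [x, y, z]" "{x, y, z} \<subseteq> \<Omega> - A"
    and u: "u \<in> G" "u ` A = A" "\<And>b. b \<in> \<Omega> - A \<Longrightarrow> u b = transp x y b"
    and w: "w \<in> G" "w ` A = A" "\<And>b. b \<in> \<Omega> - A \<Longrightarrow> w b = transp y z b"
  shows "three_cycle x y z \<in> G"
proof -
  define p where "p = card A"
  have cp: "prime p" "c ^^ p = id"
    and orbit: "\<And>x. x \<in> A \<Longrightarrow> A = (\<lambda>i. (c ^^ i) x) ` {..<p}"
    using c(2) by (auto simp: prime_cycle_def p_def)
  obtain u' i where u': "u' \<in> G" "u' ` A = A" "\<forall>b\<in>\<Omega> - A. u' b = u b" "u' \<circ> c = c ^^ i \<circ> u'"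
    by (rule normalizer_lift[OF c A u(1,2)])
  obtain w' j where w': "w' \<in> G" "w' ` A = A" "\<forall>b\<in>\<Omega> - A. w' b = w b" "w' \<circ> c = c ^^ j \<circ> w'"
    by (rule normalizer_lift[OF c A w(1,2)])
  \<comment> \<open>Both products conjugate \<open>c\<close> to \<open>c ^^ (i * j)\<close>, because
    exponents multiply in either order; so \<open>inv' b \<circ> a\<close>, a commutator, commutes
    with \<open>c\<close>.\<close>
  define a b where "a = u' \<circ> w'" and "b = w' \<circ> u'"
  have aG: "a \<in> G" "b \<in> G"
    unfolding a_def b_def by (intro comp_mem u' w')+
  have ac: "a \<circ> c = c ^^ (i * j) \<circ> a"
    unfolding a_def by (simp only: comp_assoc w'(4))
      (simp only: comp_assoc[symmetric] funpow_commute_funpow[OF u'(4)])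
  have bc: "b \<circ> c = c ^^ (i * j) \<circ> b"
    unfolding b_def by (simp only: comp_assoc u'(4))
      (simp only: comp_assoc[symmetric] funpow_commute_funpow[OF w'(4)] mult.commute[of j i])
  define t where "t = inv' b \<circ> a"
  have tG: "t \<in> G"
    unfolding t_def by (intro comp_mem inv_mem aG)
  have bA: "inv' b ` A = A"
  proof -
    have "b ` A = A"
      unfolding b_def image_comp[symmetric] u'(2) w'(2) ..
    then have "inv' b ` A = (inv' b \<circ> b) ` A"
      by (simp only: image_comp[symmetric])
    then show ?thesis
      by (simp only: inv_comp(1)[OF aG(2)] image_id id_apply)
  qed
  have tA: "t ` A = A"
    unfolding t_def a_def image_comp[symmetric] u'(2) w'(2) bA ..
  have tc: "t \<circ> c = c \<circ> t"
  proof -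
    have "inv' b \<circ> c ^^ (i * j) = inv' b \<circ> (c ^^ (i * j) \<circ> b) \<circ> inv' b"
      by (simp only: comp_assoc inv_comp(2)[OF aG(2)] comp_id)
    also have "\<dots> = c \<circ> inv' b"
      by (simp only: bc[symmetric] comp_assoc[symmetric] inv_comp(1)[OF aG(2)] id_comp)
    finally have "inv' b \<circ> c ^^ (i * j) \<circ> a = c \<circ> (inv' b \<circ> a)"
      by (simp only: comp_assoc)
    then show ?thesis
      by (simp only: t_def comp_assoc ac)
  qed
  \<comment> \<open>The exponent \<open>m\<close> is read off at the single point \<open>v\<close>.
    Since \<open>t\<close> commutes with \<open>c\<close>, the iterate \<open>t ^^ n\<close> acts at
    \<open>v\<close> as \<open>c ^^ (m * n)\<close>, which is trivial for
    \<open>n = p\<close>.\<close>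
  have t_fix: "(t ^^ p) v = v" if v: "v \<in> A" for v
  proof -
    obtain m where m: "t v = (c ^^ m) v"
      using tA orbit[OF v] v by blast
    have comm: "t \<circ> c ^^ n = c ^^ n \<circ> t" for n
      using funpow_commute_funpow[of t c 1 n] tc by simp
    have "(t ^^ n) v = (c ^^ (m * n)) v" for n
    proof (induction n)
      case (Suc n)
      have "(t ^^ Suc n) v = t ((c ^^ (m * n)) v)"
        by (simp add: Suc)
      also have "\<dots> = (c ^^ (m * n)) (t v)"
        using fun_cong[OF comm, of "m * n" v] by simp
      also have "\<dots> = (c ^^ (m * n + m)) v"
        by (simp only: m funpow_add comp_apply)
      finally show ?case
        by (simp only: mult_Suc_right add.commute)
    qed simp
    then show ?thesis
      by (simp only: mult.commute[of m] funpow_mult[symmetric] cp(2)) (simp add: funpow_fixed)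
  qed
  have bB: "b v = w' (u' v)" "a v = u' (w' v)" for v
    by (simp_all add: a_def b_def)
  have uw: "u' v = transp x y v" "w' v = transp y z v" if "v \<in> \<Omega> - A" for v
    using u'(3) u(3) w'(3) w(3) that by auto
  have on_B: "a v = b (three_cycle x z y v)" if v: "v \<in> \<Omega> - A" for v
  proof -
    have x: "{x, y, z} \<subseteq> \<Omega> - A"
      by (rule d)
    consider "v = x" | "v = y" | "v = z" | "v \<noteq> x" "v \<noteq> y" "v \<noteq> z"
      by blast
    then show ?thesis
      using d(1) x v by cases (auto simp: bB uw three_cycle_def transpose_def)
  qed
  have t_B: "t v = three_cycle x z y v" if "v \<in> \<Omega> - A" for v
    by (simp add: t_def on_B[OF that] inv_apply(1)[OF aG(2)])
  define s where "s = three_cycle x z y"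
  have d': "distinct [x, z, y]"
    using d(1) by auto
  have sB: "s v \<in> \<Omega> - A" if "v \<in> \<Omega> - A" for v
    using that d(2) permutes_in_image[OF three_cycle_permutes[of x "\<Omega> - A" z y]]
    by (simp add: s_def)
  have tn: "(t ^^ n) v = (s ^^ n) v \<and> (s ^^ n) v \<in> \<Omega> - A" if "v \<in> \<Omega> - A" for v n
  proof (induction n)
    case (Suc n)
    then have "(s ^^ n) v \<in> \<Omega> - A"
      by blast
    then show ?case
      using Suc sB[of "(s ^^ n) v"] t_B[of "(s ^^ n) v"] by (simp add: s_def[symmetric])
  qed (use that in simp)
  have s_out: "s v = v" if "v \<notin> \<Omega> - A" for v
    unfolding s_def using that d(2) by (intro three_cycle_simps(4)[OF d']) auto
  have "t ^^ p = s ^^ p"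
  proof
    fix v
    consider "v \<in> A" | "v \<in> \<Omega> - A" | "v \<notin> \<Omega>" "v \<notin> A"
      using A by blast
    then show "(t ^^ p) v = (s ^^ p) v"
    proof cases
      case 3
      then have "t v = v"
        using permutes_not_in[OF permutes[OF tG]] by blast
      then show ?thesis
        using 3 s_out[of v] by (simp add: funpow_fixed)
    qed (use t_fix tn s_out in \<open>auto simp: funpow_fixed\<close>)
  qed
  then have sp: "s ^^ p \<in> G"
    using funpow_mem[OF tG, of p] by simp
  have s2: "s \<circ> s = three_cycle x y z"
    unfolding s_def by (rule three_cycle_square[OF d'])
  have s3: "s ^^ 3 = id"
    using three_cycle_simps[OF d'] by (auto simp: fun_eq_iff s_def[symmetric] numeral_3_eq_3) (metis s_def)
  \<comment> \<open>\<open>p\<close> is a prime other than 3, so the \<open>p\<close>-th power of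
    the 3-cycle \<open>s\<close> is \<open>s\<close> or its square; either way
    \<open>s \<circ> s\<close>, the cycle asked for, lies in \<open>G\<close>.\<close>
  have "s ^^ p = s ^^ (p mod 3)"
  proof
    fix v
    show "(s ^^ p) v = (s ^^ (p mod 3)) v"
      using funpow_mod_eq[of 3 s v p] s3 by simp
  qed
  moreover have "p mod 3 \<noteq> 0"
    using cp(1) p primes_dvd_imp_eq[of 3 p] by (auto simp: p_def mod_eq_0_iff_dvd)
  then have "p mod 3 = 1 \<or> p mod 3 = 2"
    by linarith
  moreover have "s ^^ 1 = s" "s ^^ 2 = s \<circ> s"
    by (simp_all add: numeral_2_eq_2)
  ultimately have "s ^^ p = s \<or> s ^^ p = s \<circ> s"
    by metis
  then show ?thesis
  proof
    assume "s ^^ p = s"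
    then show ?thesis
      using comp_mem[of s s] sp s2 by simp
  next
    assume "s ^^ p = s \<circ> s"
    then show ?thesis
      using sp s2 by simp
  qed
qed

end

section \<open>Inducing transpositions on the complement of a prime cycle\<close>

context supertransitive_group
begin

text \<open>Some \<open>p\<close>-subset of \<open>\<Omega> - C\<close> contains both points, and a
  power of the p-cycle on it carries one to the other without touching \<open>C\<close>.\<close>

lemma move_avoiding:
  assumes "prime p" "card \<Omega> < 2 * p" "p \<le> card (\<Omega> - C)" "x \<in> \<Omega> - C" "y \<in> \<Omega> - C"
  obtains h where "h \<in> G" "h x = y" "\<And>v. v \<in> C \<Longrightarrow> h v = v"
proof (cases "x = y")
  case True
  then show ?thesis
    using that[of id] id_mem by simp
next
  case False
  have "card {x, y} \<le> p"
    using prime_ge_2_nat[OF assms(1)] False by simp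
  then obtain A where A: "{x, y} \<subseteq> A" "A \<subseteq> \<Omega> - C" "card A = p"
    using exists_subset_between[of "{x, y}" p "\<Omega> - C"] assms fin by auto
  obtain c where c: "c \<in> G" "prime_cycle c A"
    by (rule exists_prime_cycle[of A]) (use A assms in auto)
  have cA: "c permutes A" "A = (\<lambda>i. (c ^^ i) x) ` {..<card A}"
    using c(2) A(1) unfolding prime_cycle_def by blast+
  have "y \<in> A"
    using A(1) by blast
  then obtain i where "y = (c ^^ i) x"
    by (subst (asm) cA(2)) blast
  show ?thesis
  proof (rule that[of "c ^^ i"])
    show "c ^^ i \<in> G"
      by (rule funpow_mem[OF c(1)])
    show "(c ^^ i) v = v" if "v \<in> C" for v
      using that A(2) by (intro funpow_fixed permutes_not_in[OF cA(1)]) auto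
  qed (simp add: \<open>y = (c ^^ i) x\<close>)
qed

text \<open>One element sends \<open>x\<close> to \<open>y\<close>, a second brings the image of
  \<open>y\<close> back to \<open>x\<close> and leaves \<open>y\<close> in place; both fix the
  remaining points of \<open>B\<close>.\<close>

lemma swap_on:
  assumes "prime p" "card \<Omega> < 2 * p" "p \<le> card (\<Omega> - B)" "B \<subseteq> \<Omega>" "x \<in> B" "y \<in> B" "x \<noteq> y"
  obtains g where "g \<in> G" "\<And>b. b \<in> B \<Longrightarrow> g b = transp x y b"
proof -
  have le: "p \<le> card (\<Omega> - C)" if "C \<subseteq> B" for C
    using assms(3) card_mono[of "\<Omega> - C" "\<Omega> - B"] that fin by fastforce
  obtain g where g: "g \<in> G" "g x = y" "\<And>v. v \<in> B - {x, y} \<Longrightarrow> g v = v"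
    by (rule move_avoiding[of p "B - {x, y}" x y]) (use assms le in auto)
  have inj: "g v = g v' \<longleftrightarrow> v = v'" for v v'
    using inj_mem[OF g(1)] by (rule inj_eq)
  have "g y \<in> \<Omega>"
    using assms(4,6) image_Omega[OF g(1)] by blast
  \<comment> \<open>The second move has to avoid \<open>B - {x}\<close>, so its starting point
    \<open>g y\<close> must not lie there. A point of \<open>B - {x}\<close> is either
    \<open>y = g x\<close> or fixed by \<open>g\<close>, and injectivity excludes both.\<close>
  moreover have "g y \<notin> B - {x}"
  proof
    assume "g y \<in> B - {x}"
    then have "g y = y \<or> g (g y) = g y"
      using g(3) by blast
    then show False
      using inj[of "g y" y] inj[of y x] g(2) assms(7) \<open>g y \<in> B - {x}\<close> by metis
  qed
  ultimately obtain h where h: "h \<in> G" "h (g y) = x" "\<And>v. v \<in> B - {x} \<Longrightarrow> h v = v"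
    using assms le by (elim move_avoiding[of p "B - {x}" "g y" x, rotated -1]) auto
  show ?thesis
  proof (rule that[of "h \<circ> g"])
    show "h \<circ> g \<in> G"
      by (rule comp_mem[OF h(1) g(1)])
    fix b assume "b \<in> B"
    then consider "b = x" | "b = y" | "b \<in> B - {x, y}"
      by blast
    then show "(h \<circ> g) b = transp x y b"
      by cases (use g h assms(6,7) in auto)
  qed
qed

lemma classification_if_card_ge_8:
  assumes "8 \<le> card \<Omega>"
  shows "G = {p. p permutes \<Omega>} \<or> card \<Omega> > 3 \<and> G = alt_set \<Omega>"
proof -
  have "4 \<le> card \<Omega> div 2"
    using assms by simp
  from bertrand_variant[OF this]
  obtain p where p: "prime p" "card \<Omega> div 2 < p" "p < 2 * (card \<Omega> div 2) - 2"
    by blast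
  then have p': "p + 3 \<le> card \<Omega>" "card \<Omega> < 2 * p" "3 < p"
    using assms by auto
  obtain A where A: "A \<subseteq> \<Omega>" "card A = p"
    using obtain_subset_with_card_n[of p \<Omega>] p' by auto
  define B where "B = \<Omega> - A"
  have B: "B \<subseteq> \<Omega>" "\<Omega> - B = A"
    using A by (auto simp: B_def)
  have "3 \<le> card B"
    using A p' fin by (simp add: B_def card_Diff_subset finite_subset)
  then obtain D where D: "D \<subseteq> B" "card D = 3"
    using obtain_subset_with_card_n by metis
  then obtain x y z where xyz: "D = {x, y, z}" "distinct [x, y, z]"
    by (auto simp: card_3_iff)
  obtain c where c: "c \<in> G" "prime_cycle c A"
    by (rule exists_prime_cycle[OF A(1)]) (use A(2) p p' in auto)
  have swap: "\<exists>g\<in>G. g ` A = A \<and> (\<forall>b\<in>B. g b = transp v w b)" if vw: "v \<in> B" "w \<in> B" "v \<noteq> w" for v w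
  proof -
    obtain g where g: "g \<in> G" "\<And>b. b \<in> B \<Longrightarrow> g b = transp v w b"
      by (rule swap_on[of p B v w]) (use p p' A B vw in auto)
    have "g ` B = transp v w ` B"
      by (rule image_cong[OF refl g(2)])
    also have "\<dots> = B"
      using vw by (intro permutes_image permutes_swap_id)
    finally have "g ` A = A"
      using image_diff_eq[OF g(1), of B] B(2) by simp
    then show ?thesis
      using g by blast
  qed
  obtain u where u: "u \<in> G" "u ` A = A" "\<forall>b\<in>B. u b = transp x y b"
    using swap[of x y] xyz D by auto
  obtain w where w: "w \<in> G" "w ` A = A" "\<forall>b\<in>B. w b = transp y z b"
    using swap[of y z] xyz D by auto
  have "three_cycle x y z \<in> G"
    by (rule three_cycle_from_transpositions[OF c A(1) _ xyz(2) _ u(1,2) _ w(1,2)])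
      (use u w A p' D xyz in \<open>auto simp: B_def\<close>)
  then show ?thesis
    using classification_if_three_cycle[OF xyz(2)] D B xyz by blast
qed

end

section \<open>Degree seven\<close>

text \<open>On four points the partner of one point determines the pairing, since the two points
  left over can only be swapped. Double transpositions are thus recognised by their value at
  \<open>w\<close>.\<close>

lemma fixed_point_free_involution_eq:
  assumes "card A = 4" "w \<in> A" "f w = g w"
    and f: "f permutes A" "f \<circ> f = id" "\<forall>x\<in>A. f x \<noteq> x"
    and g: "g permutes A" "g \<circ> g = id" "\<forall>x\<in>A. g x \<noteq> x"
  shows "f = g"
proof -
  define v where "v = f w"
  have v: "v \<in> A" "v \<noteq> w"
    using assms(2) f permutes_in_image[OF f(1)] by (auto simp: v_def)
  have "finite A"
    using assms(1) by (intro card_ge_0_finite) simp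
  then have "card (A - {w, v}) = 2"
    using assms(1,2) v by (simp add: card_Diff_subset)
  then obtain a b where ab: "A - {w, v} = {a, b}" "a \<noteq> b"
    by (auto simp: card_2_iff)
  then have A: "A = {w, v, a, b}" "a \<noteq> w" "a \<noteq> v" "b \<noteq> w" "b \<noteq> v"
    using assms(2) v by auto
  have swap: "h v = w \<and> h a = b \<and> h b = a"
    if h: "h permutes A" "h \<circ> h = id" "\<forall>x\<in>A. h x \<noteq> x" "h w = v" for h
  proof -
    have inv: "h (h x) = x" for x
      using fun_cong[OF h(2), of x] by simp
    have "h v = w"
      using inv[of w] h(4) by simp
    moreover have "h a \<in> A" "h b \<in> A"
      using A(1) permutes_in_image[OF h(1)] by auto
    moreover have "h a \<noteq> w" "h a \<noteq> v" "h b \<noteq> w" "h b \<noteq> v"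
      using inv[of a] inv[of b] h(4) \<open>h v = w\<close> A by metis+
    ultimately show ?thesis
      using A h(3) by auto
  qed
  show ?thesis
  proof
    fix x
    show "f x = g x"
    proof (cases "x \<in> A")
      case True
      then show ?thesis
        using A(1) swap[OF f] swap[OF g] assms(3) by (auto simp: v_def)
    next
      case False
      then show ?thesis
        using permutes_not_in[OF f(1)] permutes_not_in[OF g(1)] by simp
    qed
  qed
qed

lemma fixed_point_free_involution_double_transpose:
  assumes "distinct [a, b, c, d]"
  shows "transp a b \<circ> transp c d permutes {a, b, c, d}"
    "(transp a b \<circ> transp c d) \<circ> (transp a b \<circ> transp c d) = id"
    "\<forall>x\<in>{a, b, c, d}. (transp a b \<circ> transp c d) x \<noteq> x"
proof -
  show "transp a b \<circ> transp c d permutes {a, b, c, d}"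
    by (intro permutes_compose permutes_swap_id) auto
qed (use assms in \<open>auto simp: fun_eq_iff transpose_def\<close>)

text \<open>If \<open>t\<close> swaps \<open>a\<close> and \<open>b\<close> and fixes
  \<open>z\<close>, the fourth point has no partner left, so \<open>t\<close> is a
  transposition.\<close>

lemma involution_cases:
  assumes "t permutes A" "t \<circ> t = id" "t \<noteq> id" "card A = 4"
  shows "(\<exists>a\<in>A. \<exists>b\<in>A. a \<noteq> b \<and> t = transp a b) \<or> (\<forall>x\<in>A. t x \<noteq> x)"
proof (cases "\<forall>x\<in>A. t x \<noteq> x")
  case False
  have inv: "t (t x) = x" for x
    using fun_cong[OF assms(2), of x] by simp
  obtain a where a: "t a \<noteq> a"
    using assms(3) by (auto simp: fun_eq_iff)
  define b where "b = t a"
  have aA: "a \<in> A" "b \<in> A" "a \<noteq> b" "t b = a"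
    using a assms(1) permutes_not_in[OF assms(1)] permutes_in_image[OF assms(1)] inv
    by (auto simp: b_def)
  obtain z where z: "z \<in> A" "t z = z"
    using False by blast
  have "finite A"
    using assms(4) by (intro card_ge_0_finite) simp
  have "z \<noteq> a" "z \<noteq> b"
    using z(2) aA a b_def by auto
  have "t x = x" if "x \<noteq> a" "x \<noteq> b" for x
  proof (cases "x \<in> A - {z}")
    case True
    have "{a, b, z} \<subseteq> A" "card {a, b, z} = 3"
      using aA z \<open>z \<noteq> a\<close> \<open>z \<noteq> b\<close> by auto
    then have "card (A - {a, b, z}) = 1"
      using assms(4) \<open>finite A\<close> by (simp add: card_Diff_subset)
    then obtain u where u: "A - {a, b, z} = {u}"
      by (auto simp: card_1_singleton_iff)
    have "t x \<noteq> a" "t x \<noteq> b" "t x \<noteq> z"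
      using inv[of x] that True z(2) aA(4) b_def by auto
    moreover have "t x \<in> A"
      using True permutes_in_image[OF assms(1)] by simp
    ultimately have "t x \<in> {u}" "x \<in> {u}"
      using u True that by auto
    then show ?thesis
      by simp
  next
    case False
    then show ?thesis
      using z permutes_not_in[OF assms(1)] by auto
  qed
  then have "t = transp a b"
    using aA(4) by (auto simp: fun_eq_iff transpose_def b_def)
  then show ?thesis
    using aA by blast
qed blast

context permutation_group
begin

lemma transp_conj_mem: "g \<in> G \<Longrightarrow> transp a b \<in> G \<Longrightarrow> transp (g a) (g b) \<in> G"
  by (rule conj_mem[OF _ _ conj_transpose[OF inj_mem]])

lemma fixes_subset_stabilizer:
  assumes "A \<subseteq> \<Omega>" "g \<in> G" "g ` (\<Omega> - A) = \<Omega> - A"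
  shows "g ` A = A"
  using image_diff_eq[OF assms(2,3)] assms(1) by (simp add: double_diff)

end

context supertransitive_group
begin

text \<open>Homogeneity on pairs conjugates \<open>transp a b\<close> to \<open>transp b c\<close>,
  and the product of the two is the cycle.\<close>

lemma three_cycle_if_transposition:
  assumes "transp a b \<in> G" "a \<noteq> b" "{a, b, c} \<subseteq> \<Omega>" "c \<noteq> a" "c \<noteq> b"
  shows "three_cycle a b c \<in> G"
proof -
  obtain g where g: "g \<in> G" "g ` {a, b} = {b, c}"
    by (rule homogeneous[of "{a, b}" "{b, c}"]) (use assms in auto)
  then have "g a = b \<and> g b = c \<or> g a = c \<and> g b = b"
    by (auto simp: doubleton_eq_iff)
  then have "transp b c \<in> G"
    using transp_conj_mem[OF g(1) assms(1)] by (auto simp: transpose_commute)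
  then show ?thesis
    unfolding three_cycle_def using assms(1) by (intro comp_mem)
qed

lemma card_set_stabilizer:
  assumes "A \<subseteq> \<Omega>" "x \<in> A"
  shows "card {g\<in>G. g ` A = A} = card A * card {g\<in>{g\<in>G. g ` A = A}. g x = x}"
proof -
  interpret H: permutation_group \<Omega> "{g\<in>G. g ` A = A}"
    by (rule stabilizer_group)
  have "(\<lambda>g. g x) ` {g\<in>G. g ` A = A} = A"
  proof (intro equalityI subsetI)
    fix y assume "y \<in> A"
    obtain g where "g \<in> G" "g ` A = A" "g x = y"
      by (rule stabilizer_transitive[OF assms \<open>y \<in> A\<close>])
    then show "y \<in> (\<lambda>g. g x) ` {g\<in>G. g ` A = A}"
      by (intro image_eqI[of _ _ g]) simp_all
  qed (use assms(2) in auto)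
  then show ?thesis
    using H.card_orbit_times_point_stabilizer[of x] by simp
qed

text \<open>One and the same group is transitive on \<open>A\<close> and on its complement, so both
  sizes divide its order.\<close>

lemma set_stabilizer_complement:
  assumes "A \<subseteq> \<Omega>"
  shows "{g\<in>G. g ` (\<Omega> - A) = \<Omega> - A} = {g\<in>G. g ` A = A}"
proof (rule Collect_cong, rule conj_cong[OF refl])
  fix g assume g: "g \<in> G"
  show "g ` (\<Omega> - A) = \<Omega> - A \<longleftrightarrow> g ` A = A"
    using fixes_subset_stabilizer[OF assms g] image_diff_eq[OF g] by (rule iffI)
qed

text \<open>Without 3-cycles there are no transpositions. The stabilizer of a 4-subset then contains
  an involution that pairs up its points and an element of order 3 that rotates three of them;
  together they yield all three double transpositions, and homogeneity spreads these to every
  4-subset.\<close>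

lemma three_cycle_if_card_7:
  assumes n: "card \<Omega> = 7"
  shows "\<exists>a b c. distinct [a, b, c] \<and> {a, b, c} \<subseteq> \<Omega> \<and> three_cycle a b c \<in> G"
proof (rule ccontr)
  assume "\<not> ?thesis"
  then have no: "three_cycle a b c \<notin> G" if "distinct [a, b, c]" "{a, b, c} \<subseteq> \<Omega>" for a b c
    using that by blast
  have no_transp: "transp a b \<notin> G" if ab: "a \<in> \<Omega>" "b \<in> \<Omega>" "a \<noteq> b" for a b
  proof
    assume t: "transp a b \<in> G"
    have "card (\<Omega> - {a, b}) = 5"
      using ab n fin by (simp add: card_Diff_subset)
    then obtain c where "c \<in> \<Omega> - {a, b}"
      by (metis card.empty ex_in_conv zero_neq_numeral)
    then show False
      using three_cycle_if_transposition[OF t, of c] no[of a b c] ab by auto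
  qed
  obtain A where A: "A \<subseteq> \<Omega>" "card A = 4"
    using obtain_subset_with_card_n[of 4 \<Omega>] n by auto
  have finA: "finite A"
    by (rule finite_subset[OF A(1) fin])
  define B where "B = \<Omega> - A"
  have B: "B \<subseteq> \<Omega>" "card B = 3"
    using A n finA by (auto simp: B_def card_Diff_subset)
  then obtain b1 b2 b3 where b: "B = {b1, b2, b3}" "distinct [b1, b2, b3]"
    by (auto simp: card_3_iff)
  define H where "H = {g\<in>G. g ` A = A}"
  interpret H: permutation_group \<Omega> H
    unfolding H_def by (rule stabilizer_group)
  have HB: "H = {g\<in>G. g ` B = B}"
    unfolding H_def B_def by (rule set_stabilizer_complement[OF A(1), symmetric])
  obtain a0 where a0: "a0 \<in> A"
    using A(2) by fastforce
  have four: "4 dvd card H"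
    using card_set_stabilizer[OF A(1) a0] A(2) by (simp add: H_def)
  define H1 where "H1 = {g\<in>H. \<forall>x\<in>{b1}. g x = x}"
  interpret H1: permutation_group \<Omega> H1
    unfolding H1_def by (rule H.fixer_group)
  have H_H1: "card H = 3 * card H1"
    using card_set_stabilizer[OF B(1), of b1] b B(2) by (simp add: HB H1_def)
  define H2 where "H2 = {g\<in>H1. \<forall>x\<in>{b2}. g x = x}"
  interpret H2: permutation_group \<Omega> H2
    unfolding H2_def by (rule H1.fixer_group)
  \<comment> \<open>Fixing \<open>b1\<close> costs a factor 3 and fixing \<open>b2\<close> a factor
    1 or 2, so at least a factor 2 of the 4 survives in the pointwise fixer of
    \<open>B\<close>.\<close>
  have "4 dvd card H1"
    using four unfolding H_H1 by presburger
  have HinjB: "g b2 \<in> {b2, b3}" if "g \<in> H1" for g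
  proof -
    have "g \<in> G" "g ` B = B" "g b1 = b1"
      using that by (auto simp: H1_def HB)
    moreover have "g b2 \<noteq> g b1"
      using b(2) inj_mem[OF \<open>g \<in> G\<close>] by (auto simp: inj_eq)
    ultimately show ?thesis
      using b by auto
  qed
  have "(\<lambda>g. g b2) ` H1 \<subseteq> {b2, b3}"
    using HinjB by blast
  from card_mono[OF _ this] have "card ((\<lambda>g. g b2) ` H1) \<le> 2"
    using b(2) by simp
  moreover have "card H1 = card ((\<lambda>g. g b2) ` H1) * card H2"
    using H1.card_orbit_times_point_stabilizer[of b2] by (simp add: H2_def)
  moreover have "card ((\<lambda>g. g b2) ` H1) \<noteq> 0"
    using H1.finite_G H1.id_mem by auto
  ultimately have "card H1 = card H2 \<or> card H1 = 2 * card H2"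
    by (auto simp: le_Suc_eq numeral_2_eq_2)
  then have "2 dvd card H2"
    using \<open>4 dvd card H1\<close> by presburger
  then obtain t where t: "t \<in> H2" "t \<noteq> id" "t ^^ 2 = id"
    using H2.cauchy[OF two_is_prime_nat] by blast
  have tG: "t \<in> G" "t ` B = B" "t b1 = b1" "t b2 = b2"
    using t(1) by (auto simp: H2_def H1_def HB)
  have "t b3 = b3"
  proof -
    have "t b3 \<in> B" "t b3 \<noteq> t b1" "t b3 \<noteq> t b2"
      using tG(2) b inj_mem[OF tG(1)] by (auto simp: inj_eq)
    then show ?thesis
      using b tG by auto
  qed
  then have tA: "t permutes A"
    using tG b by (intro permutes_if_fixes) (auto simp: B_def)
  have tt: "t \<circ> t = id"
    using t(3) by (simp add: numeral_2_eq_2)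
  have t_free: "\<forall>x\<in>A. t x \<noteq> x"
    using involution_cases[OF tA tt t(2) A(2)] no_transp A(1) tG(1) by blast
  obtain h where h: "h \<in> H" "h \<noteq> id" "h ^^ 3 = id"
    using H.cauchy[of 3] H_H1 by auto
  have hG: "h \<in> G" "h ` A = A" "h ` B = B"
    using h(1) HB by (auto simp: H_def)
  have h3: "h (h (h x)) = x" for x
    using fun_cong[OF h(3), of x] by (simp add: numeral_3_eq_3)
  have h_inj: "h x = h y \<longleftrightarrow> x = y" for x y
    using inj_mem[OF hG(1)] by (rule inj_eq)
  have h_moves: "h (h x) \<noteq> x \<and> h (h x) \<noteq> h x" if "h x \<noteq> x" for x
    using that h3[of x] h_inj by metis
  have h_orbit: "C = {x, h x, h (h x)}" if C: "C \<subseteq> \<Omega>" "card C = 3" "h ` C \<subseteq> C" "x \<in> C" "h x \<noteq> x" for C x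
  proof (rule card_subset_eq[symmetric])
    show "finite C"
      by (rule finite_subset[OF C(1) fin])
    have "h x \<in> C"
      using C(3,4) by blast
    moreover from this have "h (h x) \<in> C"
      using C(3) by blast
    ultimately show "{x, h x, h (h x)} \<subseteq> C"
      using C(4) by simp
    have "distinct [x, h x, h (h x)]"
      using C(5) h_moves[OF C(5)] by auto
    from distinct_card[OF this] show "card {x, h x, h (h x)} = card C"
      by (simp add: C(2))
  qed
  obtain w where w: "w \<in> A" "h w = w"
  proof -
    have "\<exists>x\<in>A. h x = x"
    proof (rule ccontr)
      assume "\<not> ?thesis"
      then have "3 dvd card A"
        using finA hG(2) h(3) by (intro prime_dvd_card_if_no_fixed_point[of 3 A h]) auto
      then show False
        by (simp add: A(2))
    qed
    then show ?thesis
      using that by blast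
  qed
  have h_diff: "h ` (A - {w}) \<subseteq> A - {w}"
  proof
    fix y assume "y \<in> h ` (A - {w})"
    then obtain x where "x \<in> A" "x \<noteq> w" "y = h x"
      by blast
    then show "y \<in> A - {w}"
      using hG(2) h_inj[of x w] w(2) by auto
  qed
  have card_diff: "card (A - {w}) = 3"
    using A(2) w(1) finA by simp
  \<comment> \<open>The three points of \<open>A\<close> other than \<open>w\<close> form one orbit
    of \<open>h\<close> or are all fixed; in the latter case \<open>h\<close> would be a 3-cycle on
    \<open>B\<close>.\<close>
  have h_free: "h x \<noteq> x" if "x \<in> A - {w}" for x
  proof
    assume hx: "h x = x"
    have hA: "h y = y" if "y \<in> A" for y
    proof (rule ccontr)
      assume hy: "h y \<noteq> y"
      then have "A - {w} = {y, h y, h (h y)}"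
        using that w A(1) h_diff card_diff by (intro h_orbit) auto
      then have "x \<in> {y, h y, h (h y)}"
        using \<open>x \<in> A - {w}\<close> by blast
      then show False
        using hx hy h_inj h3[of y] by (metis insertE singletonD)
    qed
    obtain v where v: "h v \<noteq> v"
      using h(2) by (auto simp: fun_eq_iff)
    have vB: "v \<in> B"
      using hA[of v] v permutes_not_in[OF permutes[OF hG(1)], of v] by (auto simp: B_def)
    then have orb: "B = {v, h v, h (h v)}"
      using hG(3) v B by (intro h_orbit) auto
    have d: "distinct [v, h v, h (h v)]"
      using v h_moves[OF v] by auto
    have "h = three_cycle v (h v) (h (h v))"
    proof (rule three_cycleI[OF d refl refl h3])
      fix x assume "x \<noteq> v" "x \<noteq> h v" "x \<noteq> h (h v)"
      then have "x \<notin> B"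
        using orb by blast
      then show "h x = x"
        using hA[of x] permutes_not_in[OF permutes[OF hG(1)], of x] by (auto simp: B_def)
    qed
    then show False
      using no[OF d] hG(1) orb B(1) by simp
  qed
  define x where "x = t w"
  have x: "x \<in> A - {w}"
    using t_free w(1) permutes_in_image[OF tA, of w] by (auto simp: x_def)
  have orb: "A - {w} = {x, h x, h (h x)}"
    using x A(1) h_diff card_diff h_free by (intro h_orbit) auto
  define Q where "Q D \<longleftrightarrow> (\<forall>f. f permutes D \<and> f \<circ> f = id \<and> (\<forall>x\<in>D. f x \<noteq> x) \<longrightarrow> f \<in> G)" for D
  have fpf_conj: "(g \<circ> f \<circ> inv' g) permutes (g ` D) \<and> (g \<circ> f \<circ> inv' g) \<circ> (g \<circ> f \<circ> inv' g) = id
      \<and> (\<forall>x\<in>g ` D. (g \<circ> f \<circ> inv' g) x \<noteq> x)"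
    if g: "g \<in> G" and f: "f permutes D" "f \<circ> f = id" "\<forall>x\<in>D. f x \<noteq> x" for g f D
  proof (intro conjI)
    have "bij g"
      by (rule permutes_bij[OF permutes[OF g]])
    have "bij (g \<circ> f \<circ> inv' g)"
      using permutes_bij[OF f(1)] \<open>bij g\<close> by (intro bij_comp bij_imp_bij_inv)
    then have "\<forall>y. \<exists>!x. (g \<circ> f \<circ> inv' g) x = y"
      unfolding bij_iff .
    moreover have "(g \<circ> f \<circ> inv' g) y = y" if "y \<notin> g ` D" for y
    proof -
      have "inv' g y \<notin> D"
        using that inv_apply(2)[OF g, of y] by (metis imageI)
      then show ?thesis
        using permutes_not_in[OF f(1)] inv_apply(2)[OF g, of y] by simp
    qed
    ultimately show "(g \<circ> f \<circ> inv' g) permutes (g ` D)"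
      unfolding permutes_def by blast
    have "(g \<circ> f \<circ> inv' g) \<circ> (g \<circ> f \<circ> inv' g) = g \<circ> f \<circ> (inv' g \<circ> g) \<circ> f \<circ> inv' g"
      by (simp only: comp_assoc)
    also have "\<dots> = g \<circ> (f \<circ> f) \<circ> inv' g"
      by (simp only: inv_comp(1)[OF g] comp_id comp_assoc)
    also have "\<dots> = id"
      by (simp only: f(2) comp_id inv_comp(2)[OF g])
    finally show "(g \<circ> f \<circ> inv' g) \<circ> (g \<circ> f \<circ> inv' g) = id" .
    show "\<forall>x\<in>g ` D. (g \<circ> f \<circ> inv' g) x \<noteq> x"
      using f(3) inv_apply(1)[OF g] inj_mem[OF g] by (auto simp: inj_eq)
  qed
  \<comment> \<open>The powers of \<open>h\<close> fix \<open>w\<close> and carry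
    \<open>x = t w\<close> to every other point of \<open>A\<close>, so the conjugates of
    \<open>t\<close> by them realise all three possible values at \<open>w\<close>.\<close>
  have "Q A"
    unfolding Q_def
  proof (intro allI impI, elim conjE)
    fix f assume f: "f permutes A" "f \<circ> f = id" "\<forall>x\<in>A. f x \<noteq> x"
    have "f w \<in> A - {w}"
      using f(3) w(1) permutes_in_image[OF f(1), of w] by auto
    then have "f w \<in> {x, h x, h (h x)}"
      unfolding orb .
    then have "f w = id x \<or> f w = h x \<or> f w = (h \<circ> h) x"
      by simp
    then obtain k where k: "k = id \<or> k = h \<or> k = h \<circ> h" "f w = k x"
      by metis
    have kG: "k \<in> G" "k w = w"
      using k(1) id_mem hG(1) comp_mem[OF hG(1,1)] w(2) by auto
    have "(h \<circ> h) ` A = A"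
      unfolding image_comp[symmetric] hG(2) ..
    then have kA: "k ` A = A"
      using k(1) hG(2) by (elim disjE) simp_all
    have "inv' k w = w"
      using inv_apply(1)[OF kG(1), of w] kG(2) by simp
    then have kt: "(k \<circ> t \<circ> inv' k) w = f w"
      by (simp add: k(2) x_def)
    note conj = fpf_conj[OF kG(1) tA tt t_free, unfolded kA]
    have "f = k \<circ> t \<circ> inv' k"
      by (rule fixed_point_free_involution_eq[OF A(2) w(1) kt[symmetric] f
            conj[THEN conjunct1] conj[THEN conjunct2, THEN conjunct1]
            conj[THEN conjunct2, THEN conjunct2]])
    moreover have "k \<circ> t \<circ> inv' k \<in> G"
      by (intro comp_mem inv_mem kG tG)
    ultimately show "f \<in> G"
      by simp
  qed
  have Q: "Q D" if D: "D \<subseteq> \<Omega>" "card D = 4" for D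
    unfolding Q_def
  proof (intro allI impI, elim conjE)
    fix f assume f: "f permutes D" "f \<circ> f = id" "\<forall>x\<in>D. f x \<noteq> x"
    obtain g where g: "g \<in> G" "g ` D = A"
      by (rule homogeneous[OF D(1) A(1)]) (use D A in auto)
    have "g \<circ> f \<circ> inv' g \<in> G"
      using fpf_conj[OF g(1) f] \<open>Q A\<close> g(2) unfolding Q_def by metis
    from comp_mem[OF comp_mem[OF inv_mem[OF g(1)] this] g(1)]
    have "inv' g \<circ> (g \<circ> f \<circ> inv' g) \<circ> g \<in> G" .
    also have "inv' g \<circ> (g \<circ> f \<circ> inv' g) \<circ> g = (inv' g \<circ> g) \<circ> f \<circ> (inv' g \<circ> g)"
      by (simp only: comp_assoc)
    also have "\<dots> = f"
      by (simp only: inv_comp(1)[OF g(1)] id_comp comp_id)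
    finally show "f \<in> G" .
  qed
  have double: "transp a b \<circ> transp c d \<in> G" if d: "distinct [a, b, c, d]" "{a, b, c, d} \<subseteq> \<Omega>" for a b c d
  proof -
    have card4: "card {a, b, c, d} = 4"
      using distinct_card[OF d(1)] by simp
    show ?thesis
      by (rule Q[OF d(2) card4, unfolded Q_def, THEN spec, THEN mp])
        (intro conjI fixed_point_free_involution_double_transpose[OF d(1)])
  qed
  have wO: "w \<notin> {x, h x, h (h x)}"
  proof -
    have "w \<notin> A - {w}"
      by simp
    then show ?thesis
      unfolding orb .
  qed
  have dA: "distinct [w, x, h x, h (h x)]"
    using wO h_free[OF x] h_moves[OF h_free[OF x]] by auto
  have mem: "{w, x, h x, h (h x)} \<subseteq> A"
    using w(1) orb by blast
  have AO: "{w, x, h x, h (h x)} \<subseteq> \<Omega>"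
    using mem A(1) by (rule subset_trans)
  have bO: "b1 \<in> \<Omega>" "b1 \<notin> A"
    using b B by (auto simp: B_def)
  have d1: "distinct [w, x, h x, b1]"
    using dA mem bO(2) by auto
  have d2: "distinct [h (h x), h x, b1]"
    using dA mem bO(2) by auto
  \<comment> \<open>The two 4-subsets share three points. The common factor
    \<open>transp w x\<close> cancels, and two overlapping transpositions remain.\<close>
  have "(transp w x \<circ> transp (h x) (h (h x))) \<circ> (transp w x \<circ> transp (h x) b1) \<in> G"
    by (rule comp_mem[OF double[OF dA AO] double[OF d1]]) (use AO bO(1) in auto)
  also have "(transp w x \<circ> transp (h x) (h (h x))) \<circ> (transp w x \<circ> transp (h x) b1)
      = three_cycle (h (h x)) (h x) b1"
    using dA d1 d2 by (intro three_cycleI[OF d2]) (auto simp: transpose_def)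
  finally show False
    using no[OF d2] AO bO(1) by simp
qed

end

section \<open>Degree six\<close>

lemma permutation_of_three:
  assumes "g permutes C" "card C = 3" "g \<noteq> id"
  shows "(\<exists>a\<in>C. \<exists>b\<in>C. a \<noteq> b \<and> g = transp a b) \<or>
    (\<exists>a b c. distinct [a, b, c] \<and> {a, b, c} \<subseteq> C \<and> g = three_cycle a b c)"
proof -
  have inj: "g x = g y \<longleftrightarrow> x = y" for x y
    using permutes_inj[OF assms(1)] by (rule inj_eq)
  obtain a where a: "g a \<noteq> a"
    using assms(3) by (auto simp: fun_eq_iff)
  define b where "b = g a"
  have aC: "a \<in> C"
    using a permutes_not_in[OF assms(1)] by blast
  then have bC: "b \<in> C" "b \<noteq> a"
    using a permutes_in_image[OF assms(1), of a] by (simp_all add: b_def)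
  have "finite C"
    using assms(2) by (intro card_ge_0_finite) simp
  then have "card (C - {a, b}) = 1"
    using aC bC assms(2) by (simp add: card_Diff_subset)
  then obtain c where c: "C - {a, b} = {c}"
    by (auto simp: card_1_singleton_iff)
  then have cC: "c \<in> C" "c \<noteq> a" "c \<noteq> b" and C: "x \<in> C \<Longrightarrow> x = a \<or> x = b \<or> x = c" for x
    by blast+
  have out: "g x = x" if "x \<noteq> a" "x \<noteq> b" "x \<noteq> c" for x
    using C[of x] that permutes_not_in[OF assms(1), of x] by blast
  have "g b \<in> C" "g c \<in> C"
    using bC cC permutes_in_image[OF assms(1)] by simp_all
  moreover have "g b \<noteq> b" "g c \<noteq> b" "g c \<noteq> g b"
    using inj[of b a] inj[of c a] inj[of c b] bC cC by (auto simp: b_def)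
  ultimately consider "g b = a" "g c = c" | "g b = c" "g c = a"
    using C[of "g b"] C[of "g c"] by metis
  then show ?thesis
  proof cases
    case 1
    have "g x = transp a b x" for x
      using 1 out[of x] by (cases "x = a"; cases "x = b"; cases "x = c") (auto simp: b_def)
    then have "g = transp a b"
      by (rule ext)
    then show ?thesis
      using aC bC by (intro disjI1 bexI[of _ a] bexI[of _ b]) simp_all
  next
    case 2
    have d: "distinct [a, b, c]"
      using bC cC by auto
    then have "g = three_cycle a b c"
      using 2 out by (intro three_cycleI) (auto simp: b_def)
    then show ?thesis
      using d aC bC cC by (intro disjI2 exI[of _ a] exI[of _ b] exI[of _ c]) simp
  qed
qed

context permutation_group
begin

lemma trivial_if_three_fixed:
  assumes "\<And>a b c. distinct [a, b, c] \<Longrightarrow> {a, b, c} \<subseteq> \<Omega> \<Longrightarrow> three_cycle a b c \<notin> G"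
    and "\<And>a b. a \<in> \<Omega> \<Longrightarrow> b \<in> \<Omega> \<Longrightarrow> a \<noteq> b \<Longrightarrow> transp a b \<notin> G"
    and "card \<Omega> = 6" "distinct [x, y, z]" "{x, y, z} \<subseteq> \<Omega>"
    and g: "g \<in> G" "g x = x" "g y = y" "g z = z"
  shows "g = id"
proof (rule ccontr)
  assume "g \<noteq> id"
  have "card {x, y, z} = 3"
    using distinct_card[OF assms(4)] by simp
  then have C: "card (\<Omega> - {x, y, z}) = 3"
    using assms(3,5) by (simp add: card_Diff_subset)
  have "g permutes (\<Omega> - {x, y, z})"
    by (rule permutes_if_fixes[OF g(1)]) (use g in auto)
  from permutation_of_three[OF this C \<open>g \<noteq> id\<close>] show False
  proof (elim disjE bexE exE conjE)
    fix a b assume "a \<in> \<Omega> - {x, y, z}" "b \<in> \<Omega> - {x, y, z}" "a \<noteq> b" "g = transp a b"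
    then show False
      using g(1) assms(2)[of a b] by simp
  next
    fix a b c assume "distinct [a, b, c]" "{a, b, c} \<subseteq> \<Omega> - {x, y, z}" "g = three_cycle a b c"
    then show False
      using g(1) assms(1)[of a b c] by auto
  qed
qed

text \<open>The fixer of two points acts freely on the other four. The two claims bound its order by
  4, and they turn order exactly 4 into transitivity on those four points.\<close>

lemma card_point_pair_stabilizer_le:
  assumes "\<And>a b c. distinct [a, b, c] \<Longrightarrow> {a, b, c} \<subseteq> \<Omega> \<Longrightarrow> three_cycle a b c \<notin> G"
    and "\<And>a b. a \<in> \<Omega> \<Longrightarrow> b \<in> \<Omega> \<Longrightarrow> a \<noteq> b \<Longrightarrow> transp a b \<notin> G"
    and "card \<Omega> = 6" "distinct [x, y, z]" "{x, y, z} \<subseteq> \<Omega>"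
  shows "card {g\<in>G. \<forall>v\<in>{x, y}. g v = v} = card ((\<lambda>g. g z) ` {g\<in>G. \<forall>v\<in>{x, y}. g v = v})"
    and "(\<lambda>g. g z) ` {g\<in>G. \<forall>v\<in>{x, y}. g v = v} \<subseteq> \<Omega> - {x, y}"
proof -
  interpret H: permutation_group \<Omega> "{g\<in>G. \<forall>v\<in>{x, y}. g v = v}"
    by (rule fixer_group)
  have "{h\<in>{g\<in>G. \<forall>v\<in>{x, y}. g v = v}. h z = z} = {id}"
    using trivial_if_three_fixed[OF assms] id_mem by auto
  then show "card {g\<in>G. \<forall>v\<in>{x, y}. g v = v} = card ((\<lambda>g. g z) ` {g\<in>G. \<forall>v\<in>{x, y}. g v = v})"
    using H.card_orbit_times_point_stabilizer[of z] by simp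
  show "(\<lambda>g. g z) ` {g\<in>G. \<forall>v\<in>{x, y}. g v = v} \<subseteq> \<Omega> - {x, y}"
  proof
    fix v assume "v \<in> (\<lambda>g. g z) ` {g\<in>G. \<forall>v\<in>{x, y}. g v = v}"
    then obtain g where g: "g \<in> G" "g x = x" "g y = y" "v = g z"
      by auto
    have "g z \<noteq> g x" "g z \<noteq> g y"
      using inj_mem[OF g(1)] assms(4) by (auto simp: inj_eq)
    moreover have "g z \<in> \<Omega>"
      using image_Omega[OF g(1)] assms(5) by blast
    ultimately show "v \<in> \<Omega> - {x, y}"
      using g by simp
  qed
qed

text \<open>
  For a nontrivial element \<open>g\<close> of a normal subgroup, the commutators of \<open>g\<close> with transpositions
  are products of two transpositions in that subgroup.
\<close>

lemma normal_subgroup_has_three_cycle: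
  assumes normal: "\<And>s g. s permutes \<Omega> \<Longrightarrow> g \<in> G \<Longrightarrow> s \<circ> g \<circ> inv' s \<in> G"
    and n: "5 \<le> card \<Omega>" and g: "g \<in> G" "g \<noteq> id"
  shows "\<exists>a b c. distinct [a, b, c] \<and> {a, b, c} \<subseteq> \<Omega> \<and> three_cycle a b c \<in> G"
proof -
  have inj: "g x = g y \<longleftrightarrow> x = y" for x y
    using inj_mem[OF g(1)] by (rule inj_eq)
  have mem: "g x \<in> \<Omega>" if "x \<in> \<Omega>" for x
    using that image_Omega[OF g(1)] by blast
  have comm: "transp u v \<circ> transp (g u) (g v) \<in> G" if "u \<in> \<Omega>" "v \<in> \<Omega>" for u v
  proof -
    have s: "transp u v permutes \<Omega>"
      using that by (rule permutes_swap_id)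
    have "transp u v \<circ> g \<circ> inv' (transp u v) \<circ> inv' g \<in> G"
      by (rule comp_mem[OF normal[OF s g(1)] inv_mem[OF g(1)]])
    also have "transp u v \<circ> g \<circ> inv' (transp u v) \<circ> inv' g
        = transp u v \<circ> (g \<circ> transp u v) \<circ> inv' g"
      by (simp only: inv_transpose_eq comp_assoc)
    also have "\<dots> = transp u v \<circ> transp (g u) (g v) \<circ> (g \<circ> inv' g)"
      by (simp only: conj_transpose[OF inj_mem[OF g(1)]] comp_assoc)
    also have "\<dots> = transp u v \<circ> transp (g u) (g v)"
      by (simp only: inv_comp(2)[OF g(1)] comp_id)
    finally show ?thesis .
  qed
  obtain x where x: "g x \<noteq> x"
    using g(2) by (auto simp: fun_eq_iff)
  define y where "y = g x"
  have xO: "x \<in> \<Omega>"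
    using x permutes_not_in[OF permutes[OF g(1)]] by blast
  have yO: "y \<in> \<Omega>" "y \<noteq> x"
    using mem[OF xO] x by (simp_all add: y_def)
  show ?thesis
  proof (cases "g y = x")
    \<comment> \<open>With \<open>u = x\<close> and \<open>v = y = g x\<close> the commutator is
      \<open>transp x y \<circ> transp y (g y)\<close>, already a 3-cycle.\<close>
    case False
    have d: "distinct [x, y, g y]"
      using False yO inj[of y x] by (auto simp: y_def)
    have "three_cycle x y (g y) \<in> G"
      using comm[OF xO yO(1)] by (simp add: three_cycle_def y_def[symmetric])
    then show ?thesis
      using d xO yO mem[OF yO(1)] by blast
  next
    case True
    have "card (\<Omega> - {x, y}) \<noteq> 0"
      using n xO yO by (simp add: card_Diff_subset)
    then obtain v where v: "v \<in> \<Omega>" "v \<noteq> x" "v \<noteq> y"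
      by (metis Diff_iff card.empty ex_in_conv insertCI)
    define w where "w = g v"
    have w: "w \<in> \<Omega>" "w \<noteq> x" "w \<noteq> y"
      using mem[OF v(1)] inj[of v x] inj[of v y] v True by (auto simp: w_def y_def)
    have xv: "transp x v \<circ> transp y w \<in> G"
      using comm[OF xO v(1)] by (simp only: y_def[symmetric] w_def[symmetric])
    show ?thesis
    proof (cases "w = v")
      case True
      have "distinct [x, v, y]"
        using v yO by auto
      moreover have "three_cycle x v y \<in> G"
        using xv by (simp only: three_cycle_def True transpose_commute[of v y])
      ultimately show ?thesis
        using xO yO v by blast
    next
      \<comment> \<open>The commutator moves the four points \<open>x, v, y, w\<close>. Conjugating
        it by \<open>transp w e\<close> with a fifth point \<open>e\<close> and multiplying by the
        original cancels \<open>transp x v\<close>; the bound 5 on the degree provides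
        \<open>e\<close>.\<close>
      case False
      have "card (\<Omega> - {x, y, v, w}) \<noteq> 0"
      proof -
        have "card {x, y, v, w} \<le> 4"
          by (intro card_insert_le_m1) auto
        then show ?thesis
          using n xO yO v w by (subst card_Diff_subset) auto
      qed
      then have "\<Omega> - {x, y, v, w} \<noteq> {}"
        by (intro notI) simp
      then obtain e where e: "e \<in> \<Omega>" "e \<noteq> x" "e \<noteq> y" "e \<noteq> v" "e \<noteq> w"
        by blast
      have s: "transp w e permutes \<Omega>"
        using w(1) e(1) by (rule permutes_swap_id)
      have "transp w e \<circ> (transp x v \<circ> transp y w) \<circ> inv' (transp w e) \<circ> (transp x v \<circ> transp y w) \<in> G"
        by (intro comp_mem[OF normal[OF s xv] xv])
      also have "transp w e \<circ> (transp x v \<circ> transp y w) \<circ> inv' (transp w e) \<circ> (transp x v \<circ> transp y w)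
          = three_cycle w e y"
      proof -
        have d: "distinct [w, e, y]"
          using w e by auto
        show ?thesis
          unfolding inv_transpose_eq
          by (rule three_cycleI[OF d]) (use v w e yO False in \<open>auto simp: transpose_def\<close>)
      qed
      finally have "three_cycle w e y \<in> G" .
      then show ?thesis
        using w e yO by (intro exI[of _ w] exI[of _ e] exI[of _ y]) auto
    qed
  qed
qed

text \<open>The powers of \<open>c\<close> form a subgroup of order \<open>card A\<close>. This
  serves to exclude 3-cycles from a group of order 20.\<close>

lemma card_dvd_if_prime_cycle:
  assumes "c \<in> G" "prime_cycle c A"
  shows "card A dvd card G"
proof -
  define p where "p = card A"
  have p: "prime p" "c ^^ p = id" and orbit: "\<And>x. x \<in> A \<Longrightarrow> A = (\<lambda>i. (c ^^ i) x) ` {..<p}"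
    and cA: "c permutes A"
    using assms(2) by (auto simp: prime_cycle_def p_def)
  define P where "P = range (\<lambda>i. c ^^ i)"
  interpret P: permutation_group \<Omega> P
    unfolding P_def using cyclic_group[OF assms(1) p(2) prime_gt_0_nat[OF p(1)]] .
  obtain x where x: "x \<in> A"
    using p(1) by (cases "A = {}") (auto simp: p_def)
  have "(\<lambda>g. g x) ` P = A"
  proof (intro equalityI subsetI)
    show "y \<in> (\<lambda>g. g x) ` P" if "y \<in> A" for y
      using that orbit[OF x] by (auto simp: P_def)
    show "y \<in> A" if "y \<in> (\<lambda>g. g x) ` P" for y
      using that x funpow_image_subset[of c A x] permutes_image[OF cA] by (auto simp: P_def)
  qed
  moreover have "{g\<in>P. g x = x} = {id}"
    using prime_cycle_funpow_fixed[OF assms(2) x] P.id_mem by (auto simp: P_def)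
  ultimately have "card P = card A"
    using P.card_orbit_times_point_stabilizer[of x] by simp
  moreover have "P \<subseteq> G"
    using funpow_mem[OF assms(1)] by (auto simp: P_def)
  ultimately show ?thesis
    using card_cosets_times_subgroup[OF P.permutation_group_axioms] by simp
qed

lemma prime_cycle_three_cycle:
  assumes "distinct [a, b, c]"
  shows "prime_cycle (three_cycle a b c) {a, b, c}"
proof (rule prime_cycleI)
  have card3: "card {a, b, c} = 3"
    using distinct_card[OF assms] by simp
  show "prime (card {a, b, c})"
    unfolding card3 by simp
  show "three_cycle a b c permutes {a, b, c}"
    by (rule three_cycle_permutes) auto
  have "three_cycle a b c (three_cycle a b c (three_cycle a b c x)) = x" for x
    using three_cycle_simps[OF assms] by (cases "x = a"; cases "x = b"; cases "x = c") auto
  then show "three_cycle a b c ^^ card {a, b, c} = id"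
    unfolding card3 by (simp add: fun_eq_iff numeral_3_eq_3)
  show "three_cycle a b c \<noteq> id"
    using three_cycle_simps(1)[OF assms] assms by (metis distinct_length_2_or_more id_apply)
qed

end

section \<open>The order of an exceptional group of degree six\<close>

context supertransitive_group
begin

text \<open>Two counts meet. Fixing two points in turn gives \<open>card G = 30 * card F\<close>
  with \<open>card F <= 4\<close>; the stabilizer of a well-chosen 3-subset makes the order a
  multiple of \<open>20 * 3 * 2\<close>.\<close>

lemma card_eq_120:
  assumes n: "card \<Omega> = 6"
    and no: "\<And>a b c. distinct [a, b, c] \<Longrightarrow> {a, b, c} \<subseteq> \<Omega> \<Longrightarrow> three_cycle a b c \<notin> G"
  shows "card G = 120"
proof -
  have no_transp: "transp a b \<notin> G" if ab: "a \<in> \<Omega>" "b \<in> \<Omega>" "a \<noteq> b" for a b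
  proof
    assume t: "transp a b \<in> G"
    have "card (\<Omega> - {a, b}) = 4"
      using ab n fin by (simp add: card_Diff_subset)
    then obtain c where "c \<in> \<Omega> - {a, b}"
      by (metis card.empty ex_in_conv zero_neq_numeral)
    then show False
      using three_cycle_if_transposition[OF t, of c] no[of a b c] ab by auto
  qed
  obtain D where D: "D \<subseteq> \<Omega>" "card D = 3"
    using obtain_subset_with_card_n[of 3 \<Omega>] n by auto
  then obtain x y z where xyz: "D = {x, y, z}" "distinct [x, y, z]"
    by (auto simp: card_3_iff)
  have xO: "x \<in> \<Omega>" "y \<in> \<Omega>" "z \<in> \<Omega>" "x \<noteq> y" "x \<noteq> z" "y \<noteq> z"
    using D xyz by auto
  define F where "F = {g\<in>G. \<forall>v\<in>{x, y}. g v = v}"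
  interpret F: permutation_group \<Omega> F
    unfolding F_def by (rule fixer_group)
  have O4: "card (\<Omega> - {x, y}) = 4"
    using xO n by (simp add: card_Diff_subset)
  have xyzO: "{x, y, z} \<subseteq> \<Omega>"
    using xO by simp
  note pair_le = card_point_pair_stabilizer_le[OF no no_transp n xyz(2) xyzO, folded F_def]
  have F4: "card F \<le> 4"
  proof -
    have "card ((\<lambda>g. g z) ` F) \<le> 4"
      using card_mono[OF finite_Diff[OF fin] pair_le(2)] O4 by simp
    with pair_le(1) show ?thesis
      by (rule ord_eq_le_trans)
  qed
  have F_eq: "{g\<in>{g\<in>G. g ` {x, y} = {x, y}}. g x = x} = F"
  proof (intro equalityI subsetI)
    fix g assume g: "g \<in> {g\<in>{g\<in>G. g ` {x, y} = {x, y}}. g x = x}"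
    then have "g \<in> G" "g y \<in> {x, y}" "g x = x"
      by auto
    then show "g \<in> F"
      using inj_eq[OF inj_mem[OF \<open>g \<in> G\<close>], of y x] xO by (auto simp: F_def)
  qed (auto simp: F_def)
  have pair: "card {g\<in>G. g ` {x, y} = {x, y}} = 2 * card F"
    using card_set_stabilizer[of "{x, y}" x] xO F_eq by simp
  \<comment> \<open>The setwise stabilizer of \<open>{x, y}\<close> is also transitive on the four
    points outside; comparing the factors 2 and 4 makes \<open>card F\<close> even.\<close>
  have "card {g\<in>G. g ` (\<Omega> - {x, y}) = \<Omega> - {x, y}}
      = 4 * card {g\<in>{g\<in>G. g ` (\<Omega> - {x, y}) = \<Omega> - {x, y}}. g z = z}"
    using card_set_stabilizer[of "\<Omega> - {x, y}" z] xO O4 by simp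
  then have "2 * card F = 4 * card {g\<in>{g\<in>G. g ` {x, y} = {x, y}}. g z = z}"
    using set_stabilizer_complement[of "{x, y}"] xO pair by simp
  then have "2 dvd card F"
    by presburger
  then obtain t where t: "t \<in> F" "t \<noteq> id" "t ^^ 2 = id"
    using F.cauchy[OF two_is_prime_nat] by blast
  have tG: "t \<in> G" "t x = x" "t y = y"
    using t(1) by (auto simp: F_def)
  have tt: "t (t v) = v" for v
    using fun_cong[OF t(3), of v] by (simp add: numeral_2_eq_2)
  have t_z: "t z \<noteq> z"
    using trivial_if_three_fixed[OF no no_transp n xyz(2) _ tG] D xyz t(2) by blast
  define w where "w = t z"
  have w: "w \<in> \<Omega>" "w \<noteq> x" "w \<noteq> y" "w \<noteq> z" "t w = z"
  proof -
    show "w \<in> \<Omega>"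
      using image_Omega[OF tG(1)] xO(3) unfolding w_def by blast
    show "w \<noteq> x" "w \<noteq> y" "w \<noteq> z" "t w = z"
      using tt[of z] tG xO t_z by (auto simp: w_def)
  qed
  \<comment> \<open>The 3-subset is built around the involution \<open>t\<close>, which fixes
    \<open>x\<close> and exchanges the other two of its points; this gives the factor 2.\<close>
  define C where "C = {x, z, w}"
  have C: "C \<subseteq> \<Omega>" "card C = 3"
    using xO w by (auto simp: C_def)
  define H where "H = {g\<in>G. g ` C = C}"
  define H1 where "H1 = {g\<in>H. g x = x}"
  have H1_eq: "H1 = {g\<in>{g\<in>G. g ` C = C}. \<forall>v\<in>{x}. g v = v}"
    by (simp add: H1_def H_def)
  interpret H1: permutation_group \<Omega> H1
    unfolding H1_eq by (intro permutation_group.fixer_group stabilizer_group)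
  have "t ` C = C"
    using tG(2) w(5) by (auto simp: C_def w_def[symmetric])
  then have tH1: "t \<in> H1"
    using tG by (simp add: H1_def H_def)
  have "(\<lambda>g. g z) ` H1 = {z, w}"
  proof (intro equalityI subsetI)
    fix v assume "v \<in> (\<lambda>g. g z) ` H1"
    then obtain g where g: "g \<in> G" "g ` C = C" "g x = x" "v = g z"
      by (auto simp: H1_def H_def)
    have "g z \<in> C"
      using g(2) by (auto simp: C_def)
    then show "v \<in> {z, w}"
      using inj_eq[OF inj_mem[OF g(1)], of z x] g xO by (auto simp: C_def)
  next
    fix v assume "v \<in> {z, w}"
    then show "v \<in> (\<lambda>g. g z) ` H1"
      using tH1 H1.id_mem w_def by (metis (mono_tags, lifting) id_apply image_eqI insertE singletonD)
  qed
  then have "card H1 = 2 * card {g\<in>H1. g z = z}"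
    using H1.card_orbit_times_point_stabilizer[of z] w(4) by simp
  moreover have "card H = 3 * card H1"
    using card_set_stabilizer[OF C(1), of x] C(2) by (simp add: H_def H1_def C_def)
  moreover have "card G = 20 * card H"
  proof -
    have "(\<lambda>g. g ` C) ` G = {B. B \<subseteq> \<Omega> \<and> card B = 3}"
    proof (intro equalityI subsetI)
      fix B assume "B \<in> (\<lambda>g. g ` C) ` G"
      then obtain g where g: "g \<in> G" "B = g ` C"
        by blast
      then show "B \<in> {B. B \<subseteq> \<Omega> \<and> card B = 3}"
        using image_Omega[OF g(1)] C by (auto simp: card_image[OF inj_on_subset[OF inj_mem[OF g(1)] subset_UNIV]])
    next
      fix B assume "B \<in> {B. B \<subseteq> \<Omega> \<and> card B = 3}"
      then have "B \<subseteq> \<Omega>" "card C = card B"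
        using C by auto
      then obtain g where "g \<in> G" "g ` C = B"
        using homogeneous[OF C(1)] by metis
      then show "B \<in> (\<lambda>g. g ` C) ` G"
        by (intro image_eqI[of _ _ g]) simp_all
    qed
    moreover have "6 choose 3 = (20 :: nat)"
      by (simp add: numeral_eq_Suc)
    ultimately have "card ((\<lambda>g. g ` C) ` G) = 20"
      using n_subsets[OF fin, of 3] n by simp
    then show ?thesis
      using card_orbit_times_set_stabilizer[of C] by (simp add: H_def)
  qed
  ultimately have dvd: "card G = 120 * card {g\<in>H1. g z = z}"
    by simp
  have "card G = 30 * card F"
  proof -
    define G1 where "G1 = {g\<in>G. g x = x}"
    have "{g\<in>G. g ` \<Omega> = \<Omega>} = G"
      using image_Omega by auto
    then have "card G = 6 * card G1"
      using card_set_stabilizer[OF order_refl xO(1)] n by (simp add: G1_def)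
    \<comment> \<open>Transitivity of the stabilizer of \<open>x\<close> on the other five points is
      supertransitivity applied to the set of those points.\<close>
    moreover have "G1 = {g\<in>G. g ` (\<Omega> - {x}) = \<Omega> - {x}}"
      using set_stabilizer_complement[of "{x}"] xO(1) by (simp add: G1_def)
    moreover have "card (\<Omega> - {x}) = 5"
      using n xO(1) by simp
    moreover have "{g\<in>G1. g y = y} = F"
      by (auto simp: G1_def F_def)
    ultimately show ?thesis
      using card_set_stabilizer[of "\<Omega> - {x}" y] xO by simp
  qed
  then have "card G \<le> 120"
    using F4 by simp
  moreover have "card G \<noteq> 0"
    using finite_G id_mem by auto
  ultimately show ?thesis
    using dvd by auto
qed

end

section \<open>The exceptional group of degree six as a coset action\<close>

lemma permutation_group_symmetric: "finite \<Omega> \<Longrightarrow> permutation_group \<Omega> {p. p permutes \<Omega>}"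
  by unfold_locales (auto intro: permutes_id permutes_compose permutes_inv)

lemma permutesI_inverse:
  assumes "f \<circ> g = id" "g \<circ> f = id" "\<And>x. x \<notin> A \<Longrightarrow> f x = x"
  shows "f permutes A"
proof -
  have "bij f"
    using assms(2,1) by (rule o_bij)
  then have "\<forall>y. \<exists>!x. f x = y"
    unfolding bij_iff .
  then show ?thesis
    using assms(3) unfolding permutes_def by blast
qed

context supertransitive_group
begin

text \<open>
  \<open>G\<close> has index six in the symmetric group of \<open>\<Omega>\<close> and fixes the trivial coset, so it acts on the
  five others.
\<close>

lemma exotic_if_no_three_cycle:
  assumes n: "card \<Omega> = 6"
    and no: "\<And>a b c. distinct [a, b, c] \<Longrightarrow> {a, b, c} \<subseteq> \<Omega> \<Longrightarrow> three_cycle a b c \<notin> G"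
  shows "\<exists>f. exotic_embedding \<Omega> f \<and> G = f ` carrier (sym_group 5)"
proof -
  have card_G: "card G = 120"
    using n no by (rule card_eq_120)
  define S where "S = {p. p permutes \<Omega>}"
  interpret S: permutation_group \<Omega> S
    unfolding S_def by (rule permutation_group_symmetric[OF fin])
  have GS: "G \<subseteq> S"
    using permutes by (auto simp: S_def)
  define act where "act g Z = (\<circ>) g ` Z" for g :: "'a \<Rightarrow> 'a" and Z :: "('a \<Rightarrow> 'a) set"
  have act_comp: "act g (act h Z) = act (g \<circ> h) Z" for g h Z
    by (simp add: act_def image_image comp_assoc)
  have act_id: "act id Z = Z" for Z
    by (simp add: act_def image_def)
  define X where "X = (\<lambda>s. act s G) ` S"
  have "card S = 720"
    using card_permutations[OF n fin] by (simp add: S_def fact_numeral)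
  then have "card X = 6"
    using S.card_cosets_times_subgroup[OF permutation_group_axioms GS] card_G by (simp add: X_def act_def)
  define Y where "Y = X - {G}"
  have "G \<in> X"
    unfolding X_def using S.id_mem act_id[of G] by (intro image_eqI[of _ _ id]) simp_all
  have finX: "finite X"
    using \<open>card X = 6\<close> by (intro card_ge_0_finite) simp
  have "card Y = 5" "finite Y"
    using \<open>card X = 6\<close> \<open>G \<in> X\<close> finX by (simp_all add: Y_def)
  then obtain b where b: "bij_betw b {1..5::nat} Y"
    using ex_bij_betw_nat_finite_1[of Y] by auto
  define b' where "b' = inv_into {1..5} b"
  have b'b: "b' (b i) = i" if "i \<in> {1..5}" for i
    unfolding b'_def by (rule bij_betw_inv_into_left[OF b that])
  have bb': "b (b' Z) = Z" if "Z \<in> Y" for Z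
    unfolding b'_def by (rule bij_betw_inv_into_right[OF b that])
  have bY: "b i \<in> Y" if "i \<in> {1..5}" for i
    using b that by (rule bij_betwE[THEN bspec])
  have b'Y: "b' Z \<in> {1..5}" if "Z \<in> Y" for Z
    using bij_betw_inv_into[OF b] that unfolding b'_def by (rule bij_betwE[THEN bspec])
  have actG: "act g G = G" if "g \<in> G" for g
    unfolding act_def using coset_eq_subgroup_iff[OF permutation_group_axioms that] that by simp
  have actY: "act g Z \<in> Y" if g: "g \<in> G" and Z: "Z \<in> Y" for g Z
  proof -
    obtain s where s: "s \<in> S" "Z = act s G"
      using Z by (auto simp: Y_def X_def)
    have "act g Z = act (g \<circ> s) G"
      by (simp only: s(2) act_comp)
    moreover have "g \<circ> s \<in> S"
      using GS g s(1) by (intro S.comp_mem) auto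
    ultimately have "act g Z \<in> X"
      by (auto simp: X_def)
    moreover have "act g Z \<noteq> G"
    proof
      assume "act g Z = G"
      then have "act (inv' g) (act g Z) = G"
        using actG[OF inv_mem[OF g]] by simp
      then have "Z = G"
        by (simp only: act_comp inv_comp(1)[OF g] act_id)
      then show False
        using Z by (simp add: Y_def)
    qed
    ultimately show ?thesis
      by (simp add: Y_def)
  qed
  \<comment> \<open>The nontrivial cosets are relabelled by \<open>b\<close>; outside
    \<open>{1..5}\<close> the map is the identity, as \<open>permutes\<close> demands.\<close>
  define \<theta> where "\<theta> g i = (if i \<in> {1..5} then b' (act g (b i)) else i)" for g i
  have \<theta>_comp: "\<theta> g \<circ> \<theta> h = \<theta> (g \<circ> h)" if "g \<in> G" "h \<in> G" for g h
  proof
    fix i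
    show "(\<theta> g \<circ> \<theta> h) i = \<theta> (g \<circ> h) i"
    proof (cases "i \<in> {1..5}")
      case True
      note Y = actY[OF that(2) bY[OF True]]
      have h: "\<theta> h i = b' (act h (b i))" "b' (act h (b i)) \<in> {1..5}"
        using True b'Y[OF Y] by (simp_all only: \<theta>_def if_True)
      have "\<theta> g (\<theta> h i) = b' (act g (b (b' (act h (b i)))))"
        unfolding h(1) using h(2) by (simp only: \<theta>_def if_True)
      also have "\<dots> = b' (act (g \<circ> h) (b i))"
        by (simp only: bb'[OF Y] act_comp)
      finally show ?thesis
        using True by (simp only: comp_apply \<theta>_def if_True)
    qed (simp only: comp_apply \<theta>_def if_False)
  qed
  have \<theta>_id: "\<theta> id = id"
    by (rule ext) (simp add: \<theta>_def act_id b'b)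
  have \<theta>_perm: "\<theta> g permutes {1..5}" if "g \<in> G" for g
  proof (rule permutesI_inverse)
    show "\<theta> g \<circ> \<theta> (inv' g) = id" "\<theta> (inv' g) \<circ> \<theta> g = id"
      using \<theta>_comp[OF that inv_mem[OF that]] \<theta>_comp[OF inv_mem[OF that] that]
        inv_comp[OF that] \<theta>_id by simp_all
    show "\<theta> g i = i" if "i \<notin> {1..5}" for i
      using that by (simp only: \<theta>_def if_False)
  qed
  \<comment> \<open>The core of \<open>G\<close> in \<open>S\<close>, that is, the elements fixing
    every coset. It is normal in the symmetric group and contains no 3-cycle, hence is trivial; this
    makes \<open>\<theta>\<close> injective.\<close>
  define N where "N = {k\<in>G. \<forall>s\<in>S. inv' s \<circ> k \<circ> s \<in> G}"
  have inv_conj: "inv' (inv' s \<circ> k \<circ> s) = inv' s \<circ> inv' k \<circ> s" if "s \<in> S" "k \<in> S" for s k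
  proof (rule inv_unique_comp)
    have "(inv' s \<circ> k \<circ> s) \<circ> (inv' s \<circ> inv' k \<circ> s) = inv' s \<circ> k \<circ> (s \<circ> inv' s) \<circ> inv' k \<circ> s"
      "(inv' s \<circ> inv' k \<circ> s) \<circ> (inv' s \<circ> k \<circ> s) = inv' s \<circ> inv' k \<circ> (s \<circ> inv' s) \<circ> k \<circ> s"
      by (simp_all only: comp_assoc)
    moreover have "inv' s \<circ> k \<circ> (s \<circ> inv' s) \<circ> inv' k \<circ> s = inv' s \<circ> (k \<circ> inv' k) \<circ> s"
      "inv' s \<circ> inv' k \<circ> (s \<circ> inv' s) \<circ> k \<circ> s = inv' s \<circ> (inv' k \<circ> k) \<circ> s"
      by (simp_all only: S.inv_comp(2)[OF that(1)] comp_id comp_assoc)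
    ultimately show "(inv' s \<circ> k \<circ> s) \<circ> (inv' s \<circ> inv' k \<circ> s) = id"
      "(inv' s \<circ> inv' k \<circ> s) \<circ> (inv' s \<circ> k \<circ> s) = id"
      by (simp_all only: S.inv_comp[OF that(2)] comp_id S.inv_comp(1)[OF that(1)])
  qed
  interpret N: permutation_group \<Omega> N
  proof (rule subgroupI)
    show "N \<subseteq> G"
      by (auto simp: N_def)
    show "id \<in> N"
      using id_mem S.inv_comp(1) by (simp add: N_def)
  next
    fix g h assume gh: "g \<in> N" "h \<in> N"
    have "inv' s \<circ> (g \<circ> h) \<circ> s \<in> G" if s: "s \<in> S" for s
    proof -
      have "inv' s \<circ> g \<circ> s \<in> G" "inv' s \<circ> h \<circ> s \<in> G"
        using gh s by (auto simp: N_def)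
      from comp_mem[OF this] have "inv' s \<circ> g \<circ> (s \<circ> inv' s) \<circ> h \<circ> s \<in> G"
        by (simp only: comp_assoc)
      then show ?thesis
        by (simp only: S.inv_comp(2)[OF s] comp_id comp_assoc)
    qed
    then show "g \<circ> h \<in> N"
      using gh comp_mem by (simp add: N_def)
  next
    fix g assume g: "g \<in> N"
    have "inv' s \<circ> inv' g \<circ> s \<in> G" if s: "s \<in> S" for s
    proof -
      have "inv' s \<circ> g \<circ> s \<in> G" "g \<in> S"
        using g s GS by (auto simp: N_def)
      then show ?thesis
        using inv_mem[of "inv' s \<circ> g \<circ> s"] inv_conj[OF s] by simp
    qed
    then show "inv' g \<in> N"
      using g inv_mem by (simp add: N_def)
  qed
  have normal: "s \<circ> k \<circ> inv' s \<in> N" if s: "s permutes \<Omega>" and k: "k \<in> N" for s k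
  proof -
    have sS: "s \<in> S"
      using s by (simp add: S_def)
    have "inv' r \<circ> (s \<circ> k \<circ> inv' s) \<circ> r \<in> G" if r: "r \<in> S" for r
    proof -
      define q where "q = inv' s \<circ> r"
      have q: "q \<in> S"
        unfolding q_def using S.comp_mem[OF S.inv_mem[OF sS] r] .
      have "inv' q = inv' r \<circ> s"
      proof (rule inv_unique_comp)
        have "q \<circ> (inv' r \<circ> s) = inv' s \<circ> (r \<circ> inv' r) \<circ> s" "(inv' r \<circ> s) \<circ> q = inv' r \<circ> (s \<circ> inv' s) \<circ> r"
          by (simp_all only: q_def comp_assoc)
        then show "q \<circ> (inv' r \<circ> s) = id" "(inv' r \<circ> s) \<circ> q = id"
          by (simp_all only: S.inv_comp[OF r] S.inv_comp[OF sS] comp_id)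
      qed
      moreover have "inv' q \<circ> k \<circ> q \<in> G"
        using k q by (simp add: N_def)
      ultimately have "(inv' r \<circ> s) \<circ> k \<circ> (inv' s \<circ> r) \<in> G"
        by (simp only: q_def[symmetric])
      then show ?thesis
        by (simp only: comp_assoc)
    qed
    moreover from this[OF S.id_mem] have "s \<circ> k \<circ> inv' s \<in> G"
      by simp
    ultimately show ?thesis
      by (simp add: N_def)
  qed
  have N_trivial: "k = id" if k: "k \<in> N" for k
  proof (rule ccontr)
    assume "k \<noteq> id"
    obtain a b c where "distinct [a, b, c]" "{a, b, c} \<subseteq> \<Omega>" "three_cycle a b c \<in> N"
      using N.normal_subgroup_has_three_cycle[OF normal _ k \<open>k \<noteq> id\<close>] n by auto
    then show False
      using no by (auto simp: N_def)
  qed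
  have "inj_on \<theta> G"
  proof (rule inj_onI)
    fix g h assume gh: "g \<in> G" "h \<in> G" "\<theta> g = \<theta> h"
    define k where "k = inv' g \<circ> h"
    have k: "k \<in> G"
      unfolding k_def by (intro comp_mem inv_mem gh)
    have \<theta>k: "\<theta> k = id"
      using \<theta>_comp[OF inv_mem[OF gh(1)] gh(2)] \<theta>_comp[OF inv_mem[OF gh(1)] gh(1)]
      by (simp only: gh(3) k_def inv_comp(1)[OF gh(1)] \<theta>_id)
    have fix_Y: "act k Z = Z" if Z: "Z \<in> Y" for Z
    proof -
      have "\<theta> k (b' Z) = b' (act k (b (b' Z)))"
        using b'Y[OF Z] by (simp only: \<theta>_def if_True)
      then have "b' Z = b' (act k Z)"
        by (simp only: \<theta>k id_apply bb'[OF Z])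
      then have "b (b' Z) = b (b' (act k Z))"
        by (rule arg_cong)
      then show ?thesis
        by (simp only: bb'[OF Z] bb'[OF actY[OF k Z]])
    qed
    \<comment> \<open>Acting trivially on five cosets is enough, because elements of
      \<open>G\<close> fix the sixth, trivial coset anyway.\<close>
    have "act k Z = Z" if "Z \<in> X" for Z
      using that fix_Y actG[OF k] by (cases "Z = G") (simp_all add: Y_def)
    then have "inv' s \<circ> k \<circ> s \<in> G" if s: "s \<in> S" for s
    proof -
      have "act s G = act (k \<circ> s) G"
        using \<open>\<And>Z. Z \<in> X \<Longrightarrow> act k Z = Z\<close>[of "act s G"] s by (simp add: X_def act_comp)
      then have "act (inv' s \<circ> (k \<circ> s)) G = G"
        unfolding act_def using S.coset_eq_iff[OF s] by simp
      moreover have "inv' s \<circ> (k \<circ> s) \<in> S"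
        using k GS s by (intro S.comp_mem S.inv_mem) auto
      ultimately have "inv' s \<circ> (k \<circ> s) \<in> G"
        unfolding act_def using S.coset_eq_subgroup_iff[OF permutation_group_axioms] by simp
      then show ?thesis
        by (simp only: comp_assoc)
    qed
    then have "k \<in> N"
      using k by (simp add: N_def)
    from N_trivial[OF this] have "g \<circ> k = g"
      by simp
    moreover have "g \<circ> k = h"
      by (simp add: k_def comp_assoc[symmetric] inv_comp(2)[OF gh(1)])
    ultimately show "g = h"
      by simp
  qed
  define S5 where "S5 = {p. p permutes {1..5::nat}}"
  have card_S5: "card S5 = 120"
    unfolding S5_def using card_permutations[of "{1..5::nat}" 5] by (simp add: fact_numeral)
  have finS5: "finite S5"
    using card_S5 by (intro card_ge_0_finite) simp
  have "\<theta> ` G \<subseteq> S5"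
    using \<theta>_perm by (auto simp: S5_def)
  then have "\<theta> ` G = S5"
    using card_image[OF \<open>inj_on \<theta> G\<close>] card_G card_S5 finS5 by (intro card_subset_eq) simp_all
  with \<open>inj_on \<theta> G\<close> have bij: "bij_betw \<theta> G S5"
    by (simp add: bij_betw_def)
  \<comment> \<open>An embedding has to start from the symmetric group on five letters, so
    \<open>\<theta>\<close> is inverted; it is onto because both orders are 120.\<close>
  define f where "f = inv_into G \<theta>"
  have f: "bij_betw f S5 G"
    unfolding f_def by (rule bij_betw_inv_into[OF bij])
  have f\<theta>: "f (\<theta> g) = g" if "g \<in> G" for g
    unfolding f_def by (rule bij_betw_inv_into_left[OF bij that])
  have carrier: "carrier (sym_group 5) = S5"
    by (simp add: sym_group_def S5_def)
  have "exotic_embedding \<Omega> f"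
    unfolding exotic_embedding_def carrier
  proof (intro conjI)
    show "f \<in> hom (sym_group 5) (sym_group_on \<Omega>)"
    proof (rule homI)
      fix p q assume "p \<in> carrier (sym_group 5)" "q \<in> carrier (sym_group 5)"
      then obtain g h where g: "g \<in> G" "p = \<theta> g" and h: "h \<in> G" "q = \<theta> h"
        using \<open>\<theta> ` G = S5\<close> unfolding carrier by blast
      have "f (p \<circ> q) = f p \<circ> f q"
        by (simp only: g(2) h(2) \<theta>_comp[OF g(1) h(1)] f\<theta>[OF g(1)] f\<theta>[OF h(1)] f\<theta>[OF comp_mem[OF g(1) h(1)]])
      then show "f (p \<otimes>\<^bsub>sym_group 5\<^esub> q) = f p \<otimes>\<^bsub>sym_group_on \<Omega>\<^esub> f q"
        by (simp add: sym_group_def sym_group_on_def)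
    next
      fix p assume "p \<in> carrier (sym_group 5)"
      then have "f p \<in> G"
        using f unfolding carrier by (auto dest: bij_betwE)
      then show "f p \<in> carrier (sym_group_on \<Omega>)"
        using permutes by (simp add: sym_group_on_def)
    qed
    show "inj_on f S5"
      using f by (rule bij_betw_imp_inj_on)
    show "\<not> (\<exists>x\<in>\<Omega>. f ` S5 = {p \<in> carrier (sym_group_on \<Omega>). p x = x})"
    proof
      assume "\<exists>x\<in>\<Omega>. f ` S5 = {p \<in> carrier (sym_group_on \<Omega>). p x = x}"
      then obtain x where x: "x \<in> \<Omega>" "G = {p \<in> carrier (sym_group_on \<Omega>). p x = x}"
        using bij_betw_imp_surj_on[OF f] by auto
      \<comment> \<open>\<open>G\<close> is transitive on \<open>\<Omega>\<close>, which no point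
        stabilizer is.\<close>
      have "card (\<Omega> - {x}) = 5"
        using n x(1) by simp
      then have "\<Omega> - {x} \<noteq> {}"
        by (intro notI) simp
      then obtain y where y: "y \<in> \<Omega>" "y \<noteq> x"
        by blast
      obtain g where "g \<in> G" "g ` \<Omega> = \<Omega>" "g x = y"
        by (rule stabilizer_transitive[OF order_refl x(1) y(1)])
      then show False
        using x(2) y(2) by blast
    qed
  qed
  moreover have "G = f ` carrier (sym_group 5)"
    unfolding carrier using bij_betw_imp_surj_on[OF f] by simp
  ultimately show ?thesis
    by blast
qed

end

section \<open>Supertransitivity of the listed groups\<close>

lemma supertransitive_symmetric: "supertransitive \<Omega> {p. p permutes \<Omega>}"
  unfolding supertransitive_def
proof (intro allI impI ballI)
  fix A i j assume A: "A \<subseteq> \<Omega>" "i \<in> A" "j \<in> A"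
  then have perm: "transp i j permutes A"
    by (intro permutes_swap_id)
  have "transp i j ` A \<subseteq> A" "transp i j permutes \<Omega>"
    by (simp_all only: permutes_image[OF perm] order_refl permutes_subset[OF perm A(1)])
  then show "\<exists>g\<in>set_stabilizer {p. p permutes \<Omega>} A. g i = j"
    by (intro bexI[of _ "transp i j"]) (simp_all add: set_stabilizer_def)
qed

text \<open>A third point of \<open>A\<close> completes \<open>i\<close> and \<open>j\<close> to a
  3-cycle inside \<open>A\<close>. Only \<open>A = {i, j}\<close> needs room outside: a
  transposition of two further points makes the swap even, and \<open>3 < card \<Omega>\<close>
  provides them.\<close>

lemma supertransitive_alternating:
  assumes "finite \<Omega>" "3 < card \<Omega>"
  shows "supertransitive \<Omega> (alt_set \<Omega>)"
  unfolding supertransitive_def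
proof (intro allI impI ballI)
  fix A i j assume A: "A \<subseteq> \<Omega>" "i \<in> A" "j \<in> A"
  have *: "\<exists>g\<in>set_stabilizer (alt_set \<Omega>) A. g i = j"
    if "g permutes \<Omega>" "evenperm g" "g ` A \<subseteq> A" "g i = j" for g
    using that by (intro bexI[of _ g]) (simp_all add: set_stabilizer_def alt_set_def)
  consider "i = j" | k where "i \<noteq> j" "k \<in> A" "k \<noteq> i" "k \<noteq> j" | "i \<noteq> j" "A = {i, j}"
    using A by blast
  then show "\<exists>g\<in>set_stabilizer (alt_set \<Omega>) A. g i = j"
  proof cases
    case 1
    then show ?thesis
      by (intro *[of id]) (simp_all add: permutes_id)
  next
    case 2
    then have d: "distinct [i, j, k]"
      by auto
    have "three_cycle i j k permutes A"
      using A 2 by (intro three_cycle_permutes)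
    then show ?thesis
      using permutes_image[of _ A] permutes_subset[OF _ A(1)]
      by (intro *[of "three_cycle i j k"] evenperm_three_cycle three_cycle_simps(1) d) simp_all
  next
    case 3
    then have "card (\<Omega> - A) = card \<Omega> - 2"
      using A assms(1) by (subst card_Diff_subset) auto
    then have "2 \<le> card (\<Omega> - A)"
      using assms(2) by simp
    then obtain B where "B \<subseteq> \<Omega> - A" "card B = 2"
      using obtain_subset_with_card_n by metis
    then obtain k l where kl: "k \<in> \<Omega>" "l \<in> \<Omega>" "k \<notin> A" "l \<notin> A" "k \<noteq> l"
      by (auto simp: card_2_iff)
    have ne: "k \<noteq> i" "k \<noteq> j" "l \<noteq> i" "l \<noteq> j"
      using kl A by auto
    show ?thesis
    proof (rule *)
      show "transp i j \<circ> transp k l permutes \<Omega>"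
        using A kl by (intro permutes_compose permutes_swap_id) auto
      show "evenperm (transp i j \<circ> transp k l)"
        using 3 kl by (simp add: evenperm_comp permutation_swap_id evenperm_swap)
      show "(transp i j \<circ> transp k l) ` A \<subseteq> A" "(transp i j \<circ> transp k l) i = j"
        using 3 kl ne by (auto simp: transpose_def)
    qed
  qed
qed

context permutation_group
begin

text \<open>An element of order 5 fixes one point and rotates the other five; since \<open>G\<close>
  is not a point stabilizer this makes it doubly transitive, with fixers of one and two points of
  orders 20 and 4. Excluding 3-cycles and then transpositions turns the order 4 into transitivity on
  the remaining four points.\<close>

lemma supertransitive_if_card_120:
  assumes n: "card \<Omega> = 6" and card_G: "card G = 120"
    and not_stabilizer: "\<And>x. x \<in> \<Omega> \<Longrightarrow> G \<noteq> {p. p permutes \<Omega> \<and> p x = x}"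
  shows "supertransitive \<Omega> G"
proof -
  have inj: "g x = g y \<longleftrightarrow> x = y" if "g \<in> G" for g x y
    using inj_mem[OF that] by (rule inj_eq)
  have mem: "g x \<in> \<Omega>" if "g \<in> G" "x \<in> \<Omega>" for g x
    using that(2) image_Omega[OF that(1)] by blast
  have "prime (5 :: nat)" "5 dvd card G"
    using card_G by simp_all
  from cauchy[OF this] obtain c where c: "c \<in> G" "c \<noteq> id" "c ^^ 5 = id"
    by (elim bexE conjE)
  obtain z where z: "z \<in> \<Omega>" "c z = z"
  proof -
    have "\<exists>x\<in>\<Omega>. c x = x"
    proof (rule ccontr)
      assume no_fix: "\<not> ?thesis"
      have "5 dvd card \<Omega>"
      proof (rule prime_dvd_card_if_no_fixed_point[OF _ fin, of 5 c])
        show "c ` \<Omega> \<subseteq> \<Omega>"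
          using image_Omega[OF c(1)] by simp
      qed (use no_fix c(3) in auto)
      then show False
        by (simp add: n)
    qed
    then show ?thesis
      using that by blast
  qed
  define A where "A = \<Omega> - {z}"
  have A5: "card A = 5"
    using n z(1) by (simp add: A_def)
  have cA: "c permutes A"
    using z(2) by (intro permutes_if_fixes[OF c(1)]) (auto simp: A_def)
  have "prime_cycle c A"
    by (rule prime_cycleI) (use A5 cA c in simp_all)
  then have orbit: "\<exists>i. v = (c ^^ i) u" if "u \<in> A" "v \<in> A" for u v
    using that unfolding prime_cycle_def by blast
  have transitive: "\<exists>g\<in>G. g z = v" if v: "v \<in> \<Omega>" for v
  proof (cases "v = z")
    case True
    then show ?thesis
      using id_mem by (intro bexI[of _ id]) simp_all
  next
    case False
    \<comment> \<open>Otherwise \<open>G\<close> would lie in the symmetric group on the other five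
      points, which has order 120 as well, and \<open>G\<close> would be the stabilizer of
      \<open>z\<close>.\<close>
    have "\<exists>g\<in>G. g z \<noteq> z"
    proof (rule ccontr)
      assume "\<not> ?thesis"
      then have sub: "G \<subseteq> {p. p permutes A}"
        using permutes_if_fixes[of _ A] by (auto simp: A_def)
      have "finite A"
        using fin by (simp add: A_def)
      then have "card {p. p permutes A} = 120"
        using card_permutations[OF A5] by (simp add: fact_numeral)
      then have "G = {p. p permutes A}"
        using sub card_G finite_permutations[OF \<open>finite A\<close>] by (intro card_subset_eq) simp_all
      also have "\<dots> = {p. p permutes \<Omega> \<and> p z = z}"
      proof (intro Collect_cong iffI conjI; (elim conjE)?)
        show "p permutes \<Omega>" if "p permutes A" for p
          using that by (rule permutes_subset) (simp add: A_def)
        show "p z = z" if "p permutes A" for p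
          using that by (rule permutes_not_in) (simp add: A_def)
        show "p permutes A" if "p permutes \<Omega>" "p z = z" for p
          using that unfolding permutes_def A_def by blast
      qed
      finally show False
        using not_stabilizer[OF z(1)] by simp
    qed
    then obtain g where g: "g \<in> G" "g z \<noteq> z"
      by blast
    then have "g z \<in> A" "v \<in> A"
      using mem[OF g(1) z(1)] v False by (simp_all add: A_def)
    then obtain i where "v = (c ^^ i) (g z)"
      using orbit by blast
    then show ?thesis
      by (intro bexI[of _ "c ^^ i \<circ> g"] comp_mem funpow_mem c g) simp
  qed
  have move1: "\<exists>g\<in>G. g x = x \<and> g y = y'"
    if x: "x \<in> \<Omega>" and y: "y \<in> \<Omega>" "y \<noteq> x" and y': "y' \<in> \<Omega>" "y' \<noteq> x" for x y y'
  proof -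
    obtain g where g: "g \<in> G" "g z = x"
      using transitive[OF x] by blast
    note gi = inv_apply(2)[OF g(1)]
    have zA: "inv' g v \<in> A" if "v \<in> \<Omega>" "v \<noteq> x" for v
    proof -
      have "inv' g v \<noteq> z"
        using gi[of v] g(2) that(2) by auto
      then show ?thesis
        using mem[OF inv_mem[OF g(1)] that(1)] by (simp add: A_def)
    qed
    obtain i where i: "inv' g y' = (c ^^ i) (inv' g y)"
      using orbit[OF zA[OF y] zA[OF y']] by blast
    have "inv' g x = z"
      using inv_apply(1)[OF g(1), of z] g(2) by simp
    then have "(g \<circ> c ^^ i \<circ> inv' g) x = x"
      using funpow_fixed[of c z i] z(2) g(2) by simp
    moreover have "(g \<circ> c ^^ i \<circ> inv' g) y = y'"
      using i[symmetric] gi[of y'] by simp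
    ultimately show ?thesis
      by (intro bexI[of _ "g \<circ> c ^^ i \<circ> inv' g"] conjI comp_mem funpow_mem inv_mem c g)
  qed
  define G1 where "G1 x = {g\<in>G. \<forall>v\<in>{x}. g v = v}" for x
  have G1: "permutation_group \<Omega> (G1 x)" for x
    unfolding G1_def by (rule fixer_group)
  have card_G1: "card (G1 x) = 20" if x: "x \<in> \<Omega>" for x
  proof -
    have "(\<lambda>g. g x) ` G = \<Omega>"
    proof (intro equalityI subsetI)
      fix v assume v: "v \<in> \<Omega>"
      obtain g h where g: "g \<in> G" "g z = x" and h: "h \<in> G" "h z = v"
        using transitive[OF x] transitive[OF v] by blast
      have "(h \<circ> inv' g) x = v"
        using inv_apply(1)[OF g(1), of z] g(2) h(2) by simp
      then show "v \<in> (\<lambda>g. g x) ` G"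
        using comp_mem[OF h(1) inv_mem[OF g(1)]] by (intro image_eqI[of _ _ "h \<circ> inv' g"]) simp_all
    qed (use mem x in blast)
    then show ?thesis
      using card_orbit_times_point_stabilizer[of x] card_G n by (simp add: G1_def)
  qed
  have card_pair: "card {g\<in>G. \<forall>v\<in>{x, y}. g v = v} = 4" if xy: "x \<in> \<Omega>" "y \<in> \<Omega>" "x \<noteq> y" for x y
  proof -
    interpret H: permutation_group \<Omega> "G1 x"
      by (rule G1)
    have "(\<lambda>g. g y) ` G1 x = \<Omega> - {x}"
    proof (intro equalityI subsetI)
      fix v assume "v \<in> (\<lambda>g. g y) ` G1 x"
      then obtain g where g: "g \<in> G" "g x = x" "v = g y"
        by (auto simp: G1_def)
      then show "v \<in> \<Omega> - {x}"
        using mem[OF g(1) xy(2)] inj[OF g(1), of y x] xy(3) by auto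
    next
      fix v assume "v \<in> \<Omega> - {x}"
      then obtain g where "g \<in> G" "g x = x" "g y = v"
        using move1[of x y v] xy by auto
      then show "v \<in> (\<lambda>g. g y) ` G1 x"
        by (intro image_eqI[of _ _ g]) (simp_all add: G1_def)
    qed
    moreover have "card (\<Omega> - {x}) = 5"
      using n xy(1) by simp
    moreover have "{g\<in>G1 x. g y = y} = {g\<in>G. \<forall>v\<in>{x, y}. g v = v}"
      by (auto simp: G1_def)
    ultimately show ?thesis
      using H.card_orbit_times_point_stabilizer[of y] card_G1[OF xy(1)] by simp
  qed
  have no3: "three_cycle a b d \<notin> G" if abd: "distinct [a, b, d]" "{a, b, d} \<subseteq> \<Omega>" for a b d
  proof
    assume t: "three_cycle a b d \<in> G"
    have card3: "card {a, b, d} = 3"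
      using distinct_card[OF abd(1)] by simp
    then have "card (\<Omega> - {a, b, d}) = 3"
      using n abd(2) by (simp add: card_Diff_subset)
    then have "\<Omega> - {a, b, d} \<noteq> {}"
      by (intro notI) simp
    then obtain e where e: "e \<in> \<Omega>" "e \<noteq> a" "e \<noteq> b" "e \<noteq> d"
      by blast
    \<comment> \<open>A 3-cycle lies in the fixer of any point \<open>e\<close> it misses, and 3
      does not divide 20.\<close>
    interpret H: permutation_group \<Omega> "G1 e"
      by (rule G1)
    have "three_cycle a b d \<in> G1 e"
      using t three_cycle_simps(4)[OF abd(1) e(2-4)] by (simp add: G1_def)
    from H.card_dvd_if_prime_cycle[OF this prime_cycle_three_cycle[OF abd(1)]]
    show False
      unfolding card3 card_G1[OF e(1)] by simp
  qed
  have no_transp: "transp a b \<notin> G" if ab: "a \<in> \<Omega>" "b \<in> \<Omega>" "a \<noteq> b" for a b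
  proof
    assume t: "transp a b \<in> G"
    have "card (\<Omega> - {a, b}) = 4"
      using ab n fin by (simp add: card_Diff_subset)
    then have "\<Omega> - {a, b} \<noteq> {}"
      by (intro notI) simp
    then obtain d where d: "d \<in> \<Omega>" "d \<noteq> a" "d \<noteq> b"
      by blast
    obtain g where g: "g \<in> G" "g b = b" "g a = d"
      using move1[of b a d] ab d by auto
    have "transp d b \<in> G"
      using transp_conj_mem[OF g(1) t] g by simp
    then have "three_cycle a b d \<in> G"
      unfolding three_cycle_def using comp_mem[OF t] by (simp add: transpose_commute)
    then show False
      using no3[of a b d] ab d by auto
  qed
  have move2: "\<exists>g\<in>G. g x = x \<and> g y = y \<and> g u = u'"
    if d: "distinct [x, y, u]" "{x, y, u} \<subseteq> \<Omega>" and u': "u' \<in> \<Omega> - {x, y}" for x y u u'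
  proof -
    define F where "F = {g\<in>G. \<forall>v\<in>{x, y}. g v = v}"
    note pair = card_point_pair_stabilizer_le[OF no3 no_transp n d, folded F_def]
    have "card F = 4" "card (\<Omega> - {x, y}) = 4"
      using card_pair[of x y] d n by (simp_all add: F_def card_Diff_subset)
    then have "card ((\<lambda>g. g u) ` F) = card (\<Omega> - {x, y})"
      using pair(1) by linarith
    from card_subset_eq[OF finite_Diff[OF fin] pair(2) this]
    have "u' \<in> (\<lambda>g. g u) ` F"
      using u' by simp
    then show ?thesis
      by (auto simp: F_def)
  qed
  show ?thesis
    unfolding supertransitive_def
  proof (intro allI impI ballI)
    fix B i j assume B: "B \<subseteq> \<Omega>" and i: "i \<in> B" and j: "j \<in> B"
    have iO: "i \<in> \<Omega>" "j \<in> \<Omega>"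
      using B i j by auto
    have finB: "finite B"
      using B fin by (rule finite_subset)
    have stab: "\<exists>g\<in>set_stabilizer G B. g i = j" if "g \<in> G" "g ` B \<subseteq> B" "g i = j" for g
      using that by (intro bexI[of _ g]) (simp_all add: set_stabilizer_def)
    show "\<exists>g\<in>set_stabilizer G B. g i = j"
    proof (cases "i = j")
      case True
      then show ?thesis
        using id_mem by (intro stab[of id]) simp_all
    next
      case False
      have "{i, j} \<subseteq> B"
        using i j by simp
      consider "B = {i, j}" | "card B = 3" | "4 \<le> card B"
      proof -
        have "2 \<le> card B"
          using card_mono[OF finB \<open>{i, j} \<subseteq> B\<close>] False by simp
        moreover have "B = {i, j}" if "card B = 2"
          using card_subset_eq[OF finB \<open>{i, j} \<subseteq> B\<close>] that False by simp
        ultimately show ?thesis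
          using that by fastforce
      qed
      then show ?thesis
      proof cases
        case 1
        have "card (\<Omega> - {i, j}) = 4"
          using iO n False by (simp add: card_Diff_subset)
        then have "\<Omega> - {i, j} \<noteq> {}"
          by (intro notI) simp
        \<comment> \<open>Any third point will do: \<open>move1\<close> prescribes one image for an
          element with a fixed point.\<close>
        then obtain k where k: "k \<in> \<Omega>" "k \<noteq> i" "k \<noteq> j"
          by blast
        obtain g where g: "g \<in> G" "g k = k" "g i = j"
          using move1[of k i j] k iO by auto
        have "g j \<in> \<Omega>" "g j \<noteq> j"
          using mem[OF g(1) iO(2)] inj[OF g(1), of j i] False g(3) by auto
        then obtain h where h: "h \<in> G" "h j = j" "h (g j) = i"
          using move1[of j "g j" i] iO False by auto
        show ?thesis
          by (rule stab[of "h \<circ> g"]) (use comp_mem[OF h(1) g(1)] g h 1 in simp_all)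
      next
        case 2
        then have "card (B - {i, j}) = 1"
          using \<open>{i, j} \<subseteq> B\<close> False by (simp add: card_Diff_subset)
        then obtain k where "B - {i, j} = {k}"
          by (auto simp: card_1_singleton_iff)
        then have k: "B = {i, j, k}" "k \<noteq> i" "k \<noteq> j"
          using i j by auto
        have kO: "k \<in> \<Omega>"
          using k(1) B by blast
        obtain g where g: "g \<in> G" "g k = k" "g i = j"
          using move1[of k i j] k iO kO by auto
        have gj: "g j \<in> \<Omega>" "g j \<noteq> j" "g j \<noteq> k"
          using mem[OF g(1) iO(2)] inj[OF g(1), of j i] inj[OF g(1), of j k] False g k by auto
        obtain h where h: "h \<in> G" "h j = j" "h k = k" "h (g j) = i"
          using move2[of j k "g j" i] gj iO kO k False by auto
        show ?thesis
          by (rule stab[of "h \<circ> g"]) (use comp_mem[OF h(1) g(1)] g h k in simp_all)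
      next
        case 3
        \<comment> \<open>At most two points lie outside \<open>B\<close>. An element that fixes
          them and sends \<open>i\<close> to \<open>j\<close> preserves \<open>B\<close>
          automatically; \<open>D\<close> pads them to exactly two fixed points, as
          \<open>move2\<close> requires.\<close>
        have "card (\<Omega> - B) \<le> 2"
          using 3 n B finB by (simp add: card_Diff_subset)
        moreover have "card (\<Omega> - {i, j}) = 4"
          using iO n False by (simp add: card_Diff_subset)
        ultimately obtain D where D: "\<Omega> - B \<subseteq> D" "D \<subseteq> \<Omega> - {i, j}" "card D = 2"
          using exists_subset_between[of "\<Omega> - B" 2 "\<Omega> - {i, j}"] i j fin by auto
        then obtain x y where xy: "D = {x, y}" "x \<noteq> y"
          by (auto simp: card_2_iff)
        obtain g where g: "g \<in> G" "g x = x" "g y = y" "g i = j"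
          using move2[of x y i j] xy D(2) iO by auto
        have "g v = v" if "v \<in> \<Omega> - B" for v
          using that D(1) xy(1) g by auto
        then have "g ` (\<Omega> - B) = \<Omega> - B"
          by (metis image_cong image_ident)
        then have "g ` B = B"
          by (rule fixes_subset_stabilizer[OF B g(1)])
        then show ?thesis
          using g by (intro stab[of g]) simp_all
      qed
    qed
  qed
qed

end

lemma supertransitive_exotic:
  assumes "permutation_group \<Omega> G" "card \<Omega> = 6" "exotic_embedding \<Omega> f"
    and "G = f ` carrier (sym_group 5)"
  shows "supertransitive \<Omega> G"
proof (rule permutation_group.supertransitive_if_card_120[OF assms(1,2)])
  have "card (carrier (sym_group 5)) = 120"
    using card_permutations[of "{1..5::nat}" 5] by (simp add: sym_group_def fact_numeral)
  then show "card G = 120"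
    using assms(3,4) by (simp add: exotic_embedding_def card_image)
  show "G \<noteq> {p. p permutes \<Omega> \<and> p x = x}" if "x \<in> \<Omega>" for x
    using that assms(3,4) by (auto simp: exotic_embedding_def sym_group_on_def)
qed

lemma (in supertransitive_group) classification:
  "G = {p. p permutes \<Omega>} \<or> card \<Omega> > 3 \<and> G = alt_set \<Omega> \<or>
    card \<Omega> = 6 \<and> (\<exists>f. exotic_embedding \<Omega> f \<and> G = f ` carrier (sym_group 5))"
proof (cases "\<exists>a b c. distinct [a, b, c] \<and> {a, b, c} \<subseteq> \<Omega> \<and> three_cycle a b c \<in> G")
  case True
  then show ?thesis
    using classification_if_three_cycle by blast
next
  case False
  have "card \<Omega> \<le> 2 \<or> 3 \<le> card \<Omega> \<and> card \<Omega> \<le> 5 \<or> card \<Omega> = 6 \<or> card \<Omega> = 7 \<or> 8 \<le> card \<Omega>"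
    by linarith
  then show ?thesis
    using classification_if_card_le_2 classification_if_card_3_to_5 classification_if_card_ge_8
      three_cycle_if_card_7 exotic_if_no_three_cycle False by (elim disjE) blast+
qed

theorem theorem2:
  fixes \<Omega> :: "'a set" and G :: "('a \<Rightarrow> 'a) set"
  assumes "finite \<Omega>" and "subgroup G (sym_group_on \<Omega>)"
  shows "((\<exists>!\<phi>. symmetric_quasi_value \<Omega> G \<phi>) \<longleftrightarrow> supertransitive \<Omega> G) \<and>
    (supertransitive \<Omega> G \<longleftrightarrow>
      G = carrier (sym_group_on \<Omega>) \<or>
      (card \<Omega> > 3 \<and> G = alt_set \<Omega>) \<or>
      (card \<Omega> = 6 \<and> (\<exists>f. exotic_embedding \<Omega> f \<and> G = f ` carrier (sym_group 5))))"
proof -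
  interpret permutation_group \<Omega> G
    using assms by (rule permutation_groupI)
  have carrier: "carrier (sym_group_on \<Omega>) = {p. p permutes \<Omega>}"
    by (simp add: sym_group_on_def)
  have "G = {p. p permutes \<Omega>} \<or> (card \<Omega> > 3 \<and> G = alt_set \<Omega>) \<or>
      (card \<Omega> = 6 \<and> (\<exists>f. exotic_embedding \<Omega> f \<and> G = f ` carrier (sym_group 5)))"
    if "supertransitive \<Omega> G"
  proof -
    interpret supertransitive_group \<Omega> G
      by unfold_locales (rule that)
    show ?thesis
      by (rule classification)
  qed
  moreover have "supertransitive \<Omega> G"
    if "G = {p. p permutes \<Omega>} \<or> (card \<Omega> > 3 \<and> G = alt_set \<Omega>) \<or>
      (card \<Omega> = 6 \<and> (\<exists>f. exotic_embedding \<Omega> f \<and> G = f ` carrier (sym_group 5)))"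
    using that
  proof (elim disjE conjE exE)
    assume "G = {p. p permutes \<Omega>}"
    then show ?thesis
      by (simp only: supertransitive_symmetric)
  next
    assume "card \<Omega> > 3" "G = alt_set \<Omega>"
    then show ?thesis
      by (simp only: supertransitive_alternating[OF fin])
  next
    fix f assume "card \<Omega> = 6" "exotic_embedding \<Omega> f" "G = f ` carrier (sym_group 5)"
    then show ?thesis
      by (rule supertransitive_exotic[OF permutation_group_axioms])
  qed
  ultimately show ?thesis
    unfolding carrier using unique_symmetric_quasi_value_iff by blast
qed

end
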